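(* Let $b$ be a canonically compactifiable graph over a countably infinite set $X$, let $m$ be such that $(X,m)$ is a finite discrete measure space, let $R$ be the Royden compactification of $X$, $\partial_R X=R\setminus X$ the Royden boundary, and let $\mu$ be a Radon measure on $\mathcal{B}(\partial_R X)$. Let $\varphi:\partial_R X\to\mathbb{R}$ be bounded and measurable such that $\int_{\partial_R X}\varphi\,d\mu=0$. (i) There is a unique solution $u\in D(Q)$ of the Neumann problem for $\varphi$ that satisfies $\sum_{x\in X}u(x)m(x)=0$. (ii) For this function $u$ and every $x\in X$ we have $$u(x)=\lim_{t\to\infty}\mathbb{E}_x\int_0^t\varphi(Y_s)\,dL_s=\int_0^\infty\int_{\partial_R X}\varphi(y)\,\widehat p_s(x,y)\,d\mu(y)\,ds=\int_{\partial_R X}\varphi(y)\,\widehat g(x,y)\,d\mu(y),$$ where $Y$ is the Hunt process on $R$ with transition densities $\widehat p_t$ with respect to $\widehat m$, $(L_t)_{t\ge0}$ is its local time on $\partial_R X$ with respect to $\mu$, and $\widehat g$ is the Green kernel.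
   Context: A graph on a countable set $X$ is a symmetric function $b:X\times X\to[0,\infty)$ vanishing on the diagonal with $\sum_{y\in X}b(x,y)<\infty$ for every $x\in X$; it is connected if for all $x,y\in X$ there are $x_1,\dots,x_n\in X$ with $b(x,x_1)>0,\dots,b(x_n,y)>0$. $X$ carries the discrete topology. Let $\widetilde Q(u)=\frac12\sum_{x,y\in X}b(x,y)(u(x)-u(y))^2$ for $u:X\to\mathbb{R}$ and $\widetilde D=\{u:X\to\mathbb{R}:\widetilde Q(u)<\infty\}$. A connected graph $b$ over a countably infinite set $X$ is canonically compactifiable if $\widetilde D\subseteq\ell^\infty(X)$. $(X,m)$ is a finite discrete measure space: $m:X\to(0,\infty)$, $m(X)=\sum_{x\in X}m(x)<\infty$. Neumann form: $D(Q)=\widetilde D\cap\ell^2(X,m)$ (here $=\widetilde D$), $Q(u,v)=\frac12\sum_{x,y}b(x,y)(u(x)-u(y))(v(x)-v(y))$. The Neumann Laplacian $L$ is the self-adjoint generator of $Q$ on $\ell^2(X,m)$: $u\in D(L)$, $Lu=f$ iff $u\in D(Q)$, $f\in\ell^2(X,m)$ and $Q(u,v)=\langle f,v\rangle_{\ell^2(X,m)}$ for all $v\in D(Q)$. The formal Laplacian is $\widetilde Lf(x)=\frac1{m(x)}\sum_{y\in X}b(x,y)(f(x)-f(y))$, for $f:X\to\mathbb{R}$ with $\sum_yb(x,y)|f(y)|<\infty$ for all $x$. The Royden compactification $R$ is the (unique up to homeomorphism) separable compact Hausdorff space such that $X$ is a dense open subset of $R$ whose subspace topology is discrete, every $f\in\widetilde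 D$ extends uniquely to a continuous function $\widehat f$ on $R$, and the functions $\widehat f$, $f\in\widetilde D$, separate the points of $R$. Let $\widehat m(B)=m(X\cap B)$ for $B\in\mathcal{B}(R)$. Normal derivative (with respect to $\mu$): $\psi\in L^2(\partial_R X,\mu)$ is the normal derivative $\frac{\partial}{\partial n}u$ of $u\in D(Q)$ with $\widetilde Lu\in\ell^2(X,m)$ if $Q(u,v)-\langle\widetilde Lu,v\rangle_{\ell^2(X,m)}=\int_{\partial_R X}\psi\,\widehat v\,d\mu$ for every $v\in D(Q)$; it is unique if it exists. For bounded measurable $\varphi:\partial_R X\to\mathbb{R}$, $u\in D(Q)$ is a solution of the Neumann problem for $\varphi$ if $\widetilde Lu\equiv0$ and $\varphi$ is a representative of $\frac{\partial}{\partial n}u$. Heat kernel: $p_t(x,y)=\frac1{m(y)}e^{-tL}1_y(x)$ for $x,y\in X$, $t>0$, where $1_y$ is the indicator function of $\{y\}$; for each $t>0$ it has a unique continuous extension $\widehat p_t$ to $R\times R$, which is symmetric. Let $\widehat P_t(x,B)=\int_B\widehat p_t(x,y)\,\widehat m(dy)$, $x\in R$, $B\in\mathcal{B}(R)$, and $\widehat P_th(x)=\int_R h(y)\widehat P_t(x,dy)$. There is a Hunt process $Y=(Y_t)_{t\ge0}$ on $R$ with $\mathbb{P}_x(Y_t\in B)=\widehat P_t(x,B)$ for all $x\in R$, $B\in\mathcal{B}(R)$, $t>0$. View $\mu$ as a Radon measure on $R$. The local time $(L_t)_{t\ge0}$ of $Y$ on $\partial_R X$ with respect to $\mu$ is the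 positive continuous additive functional of $Y$ (unique up to equivalence of additive functionals) in Revuz correspondence with $\mu$, i.e. such that $$\int_X h(x)\,\mathbb{E}_x\Big[\int_0^tf(Y_s)\,dL_s\Big]\,dm(x)=\int_0^t\int_{R}f\cdot\widehat P_sh\,d\mu\,ds$$ for every $t>0$ and all bounded measurable $f,h:R\to\mathbb{R}$. In $\int_0^t\varphi(Y_s)\,dL_s$ the function $\varphi$ is extended by $0$ to $R$. The Green kernel is $\widehat g(x,y)=\int_0^\infty\left(\widehat p_t(x,y)-\frac1{m(X)}\right)dt$, $x\in X$, $y\in R$ (the integral exists). *)

theory Defs
  imports "HOL-Probability.Probability"
begin

section \<open>Graphs, energy and the Neumann form\<close>

text \<open>The vertex set is a countable type; functions on it are then total functions.\<close>

definition is_graph :: "('x::countable \<Rightarrow> 'x \<Rightarrow> real) \<Rightarrow> bool" where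
  "is_graph b \<longleftrightarrow>
     (\<forall>x y. 0 \<le> b x y) \<and> (\<forall>x y. b x y = b y x) \<and> (\<forall>x. b x x = 0) \<and>
     (\<forall>x. (\<lambda>y. b x y) summable_on UNIV)"

definition graph_connected :: "('x::countable \<Rightarrow> 'x \<Rightarrow> real) \<Rightarrow> bool" where
  "graph_connected b \<longleftrightarrow> (\<forall>x y. (\<lambda>v w. 0 < b v w)\<^sup>+\<^sup>+ x y)"

definition energy :: "('x::countable \<Rightarrow> 'x \<Rightarrow> real) \<Rightarrow> ('x \<Rightarrow> real) \<Rightarrow> ennreal" where
  "energy b u = (\<Sum>\<^sub>\<infinity>(x, y)\<in>UNIV. ennreal (b x y * (u x - u y)\<^sup>2)) / 2"

definition finite_energy :: "('x::countable \<Rightarrow> 'x \<Rightarrow> real) \<Rightarrow> ('x \<Rightarrow> real) set" where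
  "finite_energy b = {u. energy b u < \<infinity>}"

definition canonically_compactifiable :: "('x::countable \<Rightarrow> 'x \<Rightarrow> real) \<Rightarrow> bool" where
  "canonically_compactifiable b \<longleftrightarrow>
     is_graph b \<and> graph_connected b \<and> infinite (UNIV :: 'x set) \<and>
     (\<forall>u \<in> finite_energy b. bounded (range u))"

definition finite_discrete_measure :: "('x::countable \<Rightarrow> real) \<Rightarrow> bool" where
  "finite_discrete_measure m \<longleftrightarrow> (\<forall>x. 0 < m x) \<and> m summable_on UNIV"

definition vertex_measure :: "('x::countable \<Rightarrow> real) \<Rightarrow> 'x measure" where
  "vertex_measure m = point_measure UNIV (\<lambda>x. ennreal (m x))"

definition ell2 :: "('x::countable \<Rightarrow> real) \<Rightarrow> ('x \<Rightarrow> real) set" where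
  "ell2 m = {f. (\<lambda>x. (f x)\<^sup>2 * m x) summable_on UNIV}"

definition ell2_inner :: "('x::countable \<Rightarrow> real) \<Rightarrow> ('x \<Rightarrow> real) \<Rightarrow> ('x \<Rightarrow> real) \<Rightarrow> real" where
  "ell2_inner m f g = (\<Sum>\<^sub>\<infinity>x. f x * g x * m x)"

definition ell2_norm :: "('x::countable \<Rightarrow> real) \<Rightarrow> ('x \<Rightarrow> real) \<Rightarrow> real" where
  "ell2_norm m f = sqrt (ell2_inner m f f)"

definition form_domain ::
  "('x::countable \<Rightarrow> 'x \<Rightarrow> real) \<Rightarrow> ('x \<Rightarrow> real) \<Rightarrow> ('x \<Rightarrow> real) set" where
  "form_domain b m = finite_energy b \<inter> ell2 m"

definition Qform ::
  "('x::countable \<Rightarrow> 'x \<Rightarrow> real) \<Rightarrow> ('x \<Rightarrow> real) \<Rightarrow> ('x \<Rightarrow> real) \<Rightarrow> real" where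
  "Qform b u v = 1/2 * (\<Sum>\<^sub>\<infinity>(x, y)\<in>UNIV. b x y * (u x - u y) * (v x - v y))"

text \<open>\<open>neumann_laplacian b m u f\<close> means \<open>u \<in> D(L)\<close> and \<open>L u = f\<close>.\<close>

definition neumann_laplacian ::
  "('x::countable \<Rightarrow> 'x \<Rightarrow> real) \<Rightarrow> ('x \<Rightarrow> real) \<Rightarrow> ('x \<Rightarrow> real) \<Rightarrow> ('x \<Rightarrow> real) \<Rightarrow> bool" where
  "neumann_laplacian b m u f \<longleftrightarrow>
     u \<in> form_domain b m \<and> f \<in> ell2 m \<and> (\<forall>v \<in> form_domain b m. Qform b u v = ell2_inner m f v)"

definition formal_domain :: "('x::countable \<Rightarrow> 'x \<Rightarrow> real) \<Rightarrow> ('x \<Rightarrow> real) set" where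
  "formal_domain b = {f. \<forall>x. (\<lambda>y. b x y * \<bar>f y\<bar>) summable_on UNIV}"

definition formal_laplacian ::
  "('x::countable \<Rightarrow> 'x \<Rightarrow> real) \<Rightarrow> ('x \<Rightarrow> real) \<Rightarrow> ('x \<Rightarrow> real) \<Rightarrow> 'x \<Rightarrow> real" where
  "formal_laplacian b m f x = 1 / m x * (\<Sum>\<^sub>\<infinity>y. b x y * (f x - f y))"


section \<open>The Royden compactification\<close>

text \<open>The compactification is (the universe of) a Hausdorff type \<open>'r\<close>, into which the vertex set
  is embedded by \<open>\<iota>\<close>; subsets and functions on the vertex set are transported along \<open>\<iota>\<close>.\<close>

definition continuous_extension ::
  "('x \<Rightarrow> 'r::t2_space) \<Rightarrow> ('x \<Rightarrow> real) \<Rightarrow> ('r \<Rightarrow> real) \<Rightarrow> bool" where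
  "continuous_extension \<iota> f F \<longleftrightarrow> continuous_on UNIV F \<and> (\<forall>x. F (\<iota> x) = f x)"

definition royden_compactification ::
  "('x::countable \<Rightarrow> 'x \<Rightarrow> real) \<Rightarrow> ('x \<Rightarrow> 'r::t2_space) \<Rightarrow> bool" where
  "royden_compactification b \<iota> \<longleftrightarrow>
     compact (UNIV :: 'r set) \<and> separable_space (euclidean :: 'r topology) \<and>
     inj \<iota> \<and> open (range \<iota>) \<and> closure (range \<iota>) = UNIV \<and>
     subtopology euclidean (range \<iota>) = discrete_topology (range \<iota>) \<and>
     (\<forall>f \<in> finite_energy b. \<exists>!F. continuous_extension \<iota> f F) \<and>
     (\<forall>p q. p \<noteq> q \<longrightarrow>
        (\<exists>f \<in> finite_energy b. \<exists>F. continuous_extension \<iota> f F \<and> F p \<noteq> F q))"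

definition royden_ext :: "('x \<Rightarrow> 'r::t2_space) \<Rightarrow> ('x \<Rightarrow> real) \<Rightarrow> 'r \<Rightarrow> real" where
  "royden_ext \<iota> f = (THE F. continuous_extension \<iota> f F)"

definition royden_boundary :: "('x \<Rightarrow> 'r::t2_space) \<Rightarrow> 'r set" where
  "royden_boundary \<iota> = UNIV - range \<iota>"

definition royden_measure :: "('x::countable \<Rightarrow> real) \<Rightarrow> ('x \<Rightarrow> 'r::t2_space) \<Rightarrow> 'r measure" where
  "royden_measure m \<iota> = distr (vertex_measure m) borel \<iota>"

definition radon_measure_on :: "'r::t2_space set \<Rightarrow> 'r measure \<Rightarrow> bool" where
  "radon_measure_on S \<mu> \<longleftrightarrow>
     sets \<mu> = sets (restrict_space borel S) \<and>
     (\<forall>K. K \<subseteq> S \<and> compact K \<longrightarrow> emeasure \<mu> K < \<infinity>) \<and>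
     (\<forall>B \<in> sets \<mu>. emeasure \<mu> B = (SUP K \<in> {K. K \<subseteq> B \<and> compact K}. emeasure \<mu> K))"


section \<open>The Neumann problem\<close>

text \<open>Elements of \<open>L\<^sup>2(\<partial>\<^sub>R X, \<mu>)\<close> are given by representatives.\<close>

definition normal_derivative ::
  "('x::countable \<Rightarrow> 'x \<Rightarrow> real) \<Rightarrow> ('x \<Rightarrow> real) \<Rightarrow> ('x \<Rightarrow> 'r::t2_space) \<Rightarrow> 'r measure \<Rightarrow>
   ('x \<Rightarrow> real) \<Rightarrow> ('r \<Rightarrow> real) \<Rightarrow> bool" where
  "normal_derivative b m \<iota> \<mu> u \<psi> \<longleftrightarrow>
     u \<in> form_domain b m \<and> u \<in> formal_domain b \<and> formal_laplacian b m u \<in> ell2 m \<and>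
     \<psi> \<in> borel_measurable \<mu> \<and> integrable \<mu> (\<lambda>y. (\<psi> y)\<^sup>2) \<and>
     (\<forall>v \<in> form_domain b m.
        Qform b u v - ell2_inner m (formal_laplacian b m u) v = (\<integral>y. \<psi> y * royden_ext \<iota> v y \<partial>\<mu>))"

definition neumann_solution ::
  "('x::countable \<Rightarrow> 'x \<Rightarrow> real) \<Rightarrow> ('x \<Rightarrow> real) \<Rightarrow> ('x \<Rightarrow> 'r::t2_space) \<Rightarrow> 'r measure \<Rightarrow>
   ('r \<Rightarrow> real) \<Rightarrow> ('x \<Rightarrow> real) \<Rightarrow> bool" where
  "neumann_solution b m \<iota> \<mu> \<phi> u \<longleftrightarrow>
     (\<forall>x. formal_laplacian b m u x = 0) \<and> normal_derivative b m \<iota> \<mu> u \<phi>"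


section \<open>Heat semigroup, heat kernel and Green kernel\<close>

text \<open>The operators \<open>T t = e\<^sup>-\<^sup>t\<^sup>L\<close> are characterised as the strongly continuous semigroup of
  symmetric contractions on \<open>\<ell>\<^sup>2(X, m)\<close> whose generator is \<open>-L\<close> (with equality of domains).
  Only the values of \<open>T t\<close> on \<open>ell2 m\<close> for \<open>t \<ge> 0\<close> are relevant.\<close>

definition heat_semigroup ::
  "('x::countable \<Rightarrow> 'x \<Rightarrow> real) \<Rightarrow> ('x \<Rightarrow> real) \<Rightarrow>
   (real \<Rightarrow> ('x \<Rightarrow> real) \<Rightarrow> 'x \<Rightarrow> real) \<Rightarrow> bool" where
  "heat_semigroup b m T \<longleftrightarrow>
     (\<forall>t \<ge> 0. \<forall>f \<in> ell2 m. T t f \<in> ell2 m \<and> ell2_norm m (T t f) \<le> ell2_norm m f) \<and>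
     (\<forall>t \<ge> 0. \<forall>f \<in> ell2 m. \<forall>g \<in> ell2 m. \<forall>c d.
        T t (\<lambda>x. c * f x + d * g x) = (\<lambda>x. c * T t f x + d * T t g x)) \<and>
     (\<forall>t \<ge> 0. \<forall>f \<in> ell2 m. \<forall>g \<in> ell2 m. ell2_inner m (T t f) g = ell2_inner m f (T t g)) \<and>
     (\<forall>f \<in> ell2 m. T 0 f = f) \<and>
     (\<forall>s \<ge> 0. \<forall>t \<ge> 0. \<forall>f \<in> ell2 m. T (s + t) f = T s (T t f)) \<and>
     (\<forall>f \<in> ell2 m. ((\<lambda>t. ell2_norm m (\<lambda>x. T t f x - f x)) \<longlongrightarrow> 0) (at_right 0)) \<and>
     (\<forall>u f. neumann_laplacian b m u f \<longleftrightarrow>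
        u \<in> ell2 m \<and> f \<in> ell2 m \<and>
        ((\<lambda>t. ell2_norm m (\<lambda>x. (u x - T t u x) / t - f x)) \<longlongrightarrow> 0) (at_right 0))"

definition heat_kernel ::
  "('x \<Rightarrow> real) \<Rightarrow> (real \<Rightarrow> ('x \<Rightarrow> real) \<Rightarrow> 'x \<Rightarrow> real) \<Rightarrow> real \<Rightarrow> 'x \<Rightarrow> 'x \<Rightarrow> real" where
  "heat_kernel m T t x y = 1 / m y * T t (indicator {y}) x"

definition heat_kernel_ext ::
  "('x \<Rightarrow> real) \<Rightarrow> ('x \<Rightarrow> 'r::t2_space) \<Rightarrow> (real \<Rightarrow> ('x \<Rightarrow> real) \<Rightarrow> 'x \<Rightarrow> real) \<Rightarrow>
   (real \<Rightarrow> 'r \<Rightarrow> 'r \<Rightarrow> real) \<Rightarrow> bool" where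
  "heat_kernel_ext m \<iota> T p \<longleftrightarrow>
     (\<forall>t > 0. continuous_on UNIV (\<lambda>(y, z). p t y z) \<and>
        (\<forall>x y. p t (\<iota> x) (\<iota> y) = heat_kernel m T t x y))"

definition green_kernel ::
  "('x::countable \<Rightarrow> real) \<Rightarrow> ('x \<Rightarrow> 'r) \<Rightarrow> (real \<Rightarrow> 'r \<Rightarrow> 'r \<Rightarrow> real) \<Rightarrow> 'x \<Rightarrow> 'r \<Rightarrow> real" where
  "green_kernel m \<iota> p x y = (LBINT t:{0<..}. p t (\<iota> x) y - 1 / (\<Sum>\<^sub>\<infinity>z. m z))"

definition trans_prob ::
  "('x::countable \<Rightarrow> real) \<Rightarrow> ('x \<Rightarrow> 'r::t2_space) \<Rightarrow> (real \<Rightarrow> 'r \<Rightarrow> 'r \<Rightarrow> real) \<Rightarrow>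
   real \<Rightarrow> 'r \<Rightarrow> 'r set \<Rightarrow> real" where
  "trans_prob m \<iota> p t x B = (LINT y:B|royden_measure m \<iota>. p t x y)"

definition trans_op ::
  "('x::countable \<Rightarrow> real) \<Rightarrow> ('x \<Rightarrow> 'r::t2_space) \<Rightarrow> (real \<Rightarrow> 'r \<Rightarrow> 'r \<Rightarrow> real) \<Rightarrow>
   real \<Rightarrow> ('r \<Rightarrow> real) \<Rightarrow> 'r \<Rightarrow> real" where
  "trans_op m \<iota> p t h x = (LINT y|royden_measure m \<iota>. h y * p t x y)"


section \<open>Hunt processes\<close>

text \<open>Time is indexed by \<open>ennreal\<close> in filtrations so that stopping times may be infinite;
  the index \<open>\<infinity>\<close> gives the \<open>\<sigma>\<close>-algebra generated by the whole path.\<close>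

definition path_algebra ::
  "'w set \<Rightarrow> (real \<Rightarrow> 'w \<Rightarrow> 'r::t2_space) \<Rightarrow> ennreal \<Rightarrow> 'w measure" where
  "path_algebra \<Omega> Y t =
     sigma \<Omega> {Y s -` B \<inter> \<Omega> | s B. 0 \<le> s \<and> ennreal s \<le> t \<and> B \<in> sets borel}"

text \<open>\<open>initial_law P \<nu>\<close> is the completed law \<open>\<integral> P x (\<cdot>) \<nu>(dx)\<close> of the process started in \<open>\<nu>\<close>.\<close>

definition initial_law :: "('r::t2_space \<Rightarrow> 'w measure) \<Rightarrow> 'r measure \<Rightarrow> 'w measure" where
  "initial_law P \<nu> = completion (\<nu> \<bind> P)"

text \<open>The minimal completed admissible filtration: events which for every initial distribution
  agree up to a null set with an event of the path filtration.\<close>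

definition augmented_filtration ::
  "'w set \<Rightarrow> (real \<Rightarrow> 'w \<Rightarrow> 'r::t2_space) \<Rightarrow> ('r \<Rightarrow> 'w measure) \<Rightarrow> ennreal \<Rightarrow> 'w measure" where
  "augmented_filtration \<Omega> Y P t =
     sigma \<Omega> {A. A \<subseteq> \<Omega> \<and> (\<forall>\<nu> \<in> space (prob_algebra borel). \<exists>B \<in> sets (path_algebra \<Omega> Y t).
       (A - B) \<union> (B - A) \<in> null_sets (initial_law P \<nu>))}"

text \<open>A conservative Hunt process with state space (the universe of) \<open>'r\<close>. No cemetery is adjoined,
  because \<open>1 \<in> D(Q)\<close> and \<open>L 1 = 0\<close>, so that the transition probabilities have total mass one.
  The strong Markov property is the defining property of the conditional probability of
  \<open>{Y\<^bsub>S+s\<^esub> \<in> B}\<close> given the \<open>\<sigma>\<close>-algebra of the \<open>S\<close>-past, on \<open>{S < \<infinity>}\<close>.\<close>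

definition hunt_process ::
  "'w set \<Rightarrow> (real \<Rightarrow> 'w \<Rightarrow> 'r::t2_space) \<Rightarrow> (real \<Rightarrow> 'w \<Rightarrow> 'w) \<Rightarrow> ('r \<Rightarrow> 'w measure) \<Rightarrow> bool" where
  "hunt_process \<Omega> Y \<theta> P \<longleftrightarrow>
     P \<in> borel \<rightarrow>\<^sub>M prob_algebra (path_algebra \<Omega> Y \<infinity>) \<and>
     (\<forall>x. AE \<omega> in P x. Y 0 \<omega> = x) \<and>
     (\<forall>t \<ge> 0. \<forall>\<omega> \<in> \<Omega>. \<theta> t \<omega> \<in> \<Omega> \<and> (\<forall>s \<ge> 0. Y s (\<theta> t \<omega>) = Y (s + t) \<omega>)) \<and>
     (\<forall>\<omega> \<in> \<Omega>. (\<forall>t \<ge> 0. ((\<lambda>s. Y s \<omega>) \<longlongrightarrow> Y t \<omega>) (at_right t)) \<and>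
               (\<forall>t > 0. \<exists>l. ((\<lambda>s. Y s \<omega>) \<longlongrightarrow> l) (at_left t))) \<and>
     (\<forall>t < \<infinity>. sets (augmented_filtration \<Omega> Y P t) =
               (\<Inter>s \<in> {t<..}. sets (augmented_filtration \<Omega> Y P s))) \<and>
     (\<forall>\<nu> \<in> space (prob_algebra borel). \<forall>S. stopping_time (augmented_filtration \<Omega> Y P) S \<longrightarrow>
        (\<forall>A \<in> sets (filtration.pre_sigma \<Omega> (augmented_filtration \<Omega> Y P) S).
         \<forall>s \<ge> 0. \<forall>B \<in> sets borel.
           emeasure (initial_law P \<nu>) {\<omega> \<in> A. S \<omega> < \<infinity> \<and> Y (enn2real (S \<omega>) + s) \<omega> \<in> B} =
           (\<integral>\<^sup>+\<omega> \<in> {\<omega> \<in> A. S \<omega> < \<infinity>}.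
              emeasure (P (Y (enn2real (S \<omega>)) \<omega>)) {\<omega>' \<in> \<Omega>. Y s \<omega>' \<in> B} \<partial>initial_law P \<nu>))) \<and>
     (\<forall>\<nu> \<in> space (prob_algebra borel). \<forall>S :: nat \<Rightarrow> 'w \<Rightarrow> ennreal.
        (\<forall>n. stopping_time (augmented_filtration \<Omega> Y P) (S n)) \<and> (\<forall>n. \<forall>\<omega> \<in> \<Omega>. S n \<omega> \<le> S (Suc n) \<omega>) \<longrightarrow>
        (AE \<omega> in initial_law P \<nu>. (SUP n. S n \<omega>) < \<infinity> \<longrightarrow>
           (\<lambda>n. Y (enn2real (S n \<omega>)) \<omega>) \<longlonglongrightarrow> Y (enn2real (SUP n. S n \<omega>)) \<omega>))"

definition has_transition_densities ::
  "('x::countable \<Rightarrow> real) \<Rightarrow> ('x \<Rightarrow> 'r::t2_space) \<Rightarrow> (real \<Rightarrow> 'r \<Rightarrow> 'r \<Rightarrow> real) \<Rightarrow>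
   'w set \<Rightarrow> (real \<Rightarrow> 'w \<Rightarrow> 'r) \<Rightarrow> ('r \<Rightarrow> 'w measure) \<Rightarrow> bool" where
  "has_transition_densities m \<iota> p \<Omega> Y P \<longleftrightarrow>
     (\<forall>x. \<forall>t > 0. \<forall>B \<in> sets borel.
        measure (P x) {\<omega> \<in> \<Omega>. Y t \<omega> \<in> B} = trans_prob m \<iota> p t x B)"


section \<open>Additive functionals and local time\<close>

text \<open>Sets of outer capacity zero. An open \<open>U\<close> has capacity
  \<open>inf {Q(u) + \<parallel>u\<parallel>\<^sup>2 | u \<in> D(Q), u \<ge> 1 a.e. on U}\<close>, and the measure on \<open>R\<close> lives on the vertices.\<close>

definition exceptional ::
  "('x::countable \<Rightarrow> 'x \<Rightarrow> real) \<Rightarrow> ('x \<Rightarrow> real) \<Rightarrow> ('x \<Rightarrow> 'r::t2_space) \<Rightarrow> 'r set \<Rightarrow> bool" where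
  "exceptional b m \<iota> N \<longleftrightarrow>
     (\<forall>\<epsilon> > 0. \<exists>U. open U \<and> N \<subseteq> U \<and>
        (\<exists>u \<in> form_domain b m. (\<forall>x. \<iota> x \<in> U \<longrightarrow> 1 \<le> u x) \<and>
            Qform b u u + ell2_inner m u u < \<epsilon>))"

definition pcaf ::
  "('x::countable \<Rightarrow> 'x \<Rightarrow> real) \<Rightarrow> ('x \<Rightarrow> real) \<Rightarrow> ('x \<Rightarrow> 'r::t2_space) \<Rightarrow>
   'w set \<Rightarrow> (real \<Rightarrow> 'w \<Rightarrow> 'r) \<Rightarrow> (real \<Rightarrow> 'w \<Rightarrow> 'w) \<Rightarrow> ('r \<Rightarrow> 'w measure) \<Rightarrow>
   (real \<Rightarrow> 'w \<Rightarrow> real) \<Rightarrow> bool" where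
  "pcaf b m \<iota> \<Omega> Y \<theta> P L \<longleftrightarrow>
     (\<forall>t \<ge> 0. L t \<in> borel_measurable (augmented_filtration \<Omega> Y P (ennreal t))) \<and>
     (\<exists>\<Lambda> \<in> sets (augmented_filtration \<Omega> Y P \<infinity>). \<exists>N. exceptional b m \<iota> N \<and>
        (\<forall>x. x \<notin> N \<longrightarrow> emeasure (completion (P x)) \<Lambda> = 1) \<and>
        (\<forall>t > 0. \<theta> t ` \<Lambda> \<subseteq> \<Lambda>) \<and>
        (\<forall>\<omega> \<in> \<Lambda>. L 0 \<omega> = 0 \<and> (\<forall>t \<ge> 0. 0 \<le> L t \<omega>) \<and> continuous_on {0..} (\<lambda>t. L t \<omega>) \<and>
           (\<forall>s \<ge> 0. \<forall>t \<ge> 0. L (s + t) \<omega> = L t \<omega> + L s (\<theta> t \<omega>))))"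

text \<open>The pathwise Lebesgue-Stieltjes integral \<open>\<integral>\<^sub>0\<^sup>t f(Y\<^sub>s) dL\<^sub>s\<close>.\<close>

definition af_integral ::
  "(real \<Rightarrow> 'w \<Rightarrow> 'r) \<Rightarrow> (real \<Rightarrow> 'w \<Rightarrow> real) \<Rightarrow> ('r \<Rightarrow> real) \<Rightarrow> real \<Rightarrow> 'w \<Rightarrow> real" where
  "af_integral Y L f t \<omega> =
     (LINT s:{0..t}|interval_measure (\<lambda>s. L (max 0 s) \<omega>). f (Y s \<omega>))"

text \<open>The integrability requirements exclude that the left-hand side of the Revuz identity is
  only formally defined. \<open>distr \<mu> borel (\<lambda>y. y)\<close> is \<open>\<mu>\<close> regarded as a measure on \<open>R\<close>.\<close>

definition local_time ::
  "('x::countable \<Rightarrow> 'x \<Rightarrow> real) \<Rightarrow> ('x \<Rightarrow> real) \<Rightarrow> ('x \<Rightarrow> 'r::t2_space) \<Rightarrow> 'r measure \<Rightarrow>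
   (real \<Rightarrow> 'r \<Rightarrow> 'r \<Rightarrow> real) \<Rightarrow>
   'w set \<Rightarrow> (real \<Rightarrow> 'w \<Rightarrow> 'r) \<Rightarrow> (real \<Rightarrow> 'w \<Rightarrow> 'w) \<Rightarrow> ('r \<Rightarrow> 'w measure) \<Rightarrow>
   (real \<Rightarrow> 'w \<Rightarrow> real) \<Rightarrow> bool" where
  "local_time b m \<iota> \<mu> p \<Omega> Y \<theta> P L \<longleftrightarrow>
     pcaf b m \<iota> \<Omega> Y \<theta> P L \<and>
     (\<forall>t > 0. \<forall>f \<in> borel_measurable borel. \<forall>h \<in> borel_measurable borel.
        bounded (range f) \<and> bounded (range h) \<longrightarrow>
          (\<forall>x. integrable (completion (P (\<iota> x))) (af_integral Y L f t)) \<and>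
          integrable (vertex_measure m)
            (\<lambda>x. h (\<iota> x) * (\<integral>\<omega>. af_integral Y L f t \<omega> \<partial>completion (P (\<iota> x)))) \<and>
          (\<integral>x. h (\<iota> x) * (\<integral>\<omega>. af_integral Y L f t \<omega> \<partial>completion (P (\<iota> x))) \<partial>vertex_measure m) =
          (LBINT s:{0..t}. \<integral>y. f y * trans_op m \<iota> p s h y \<partial>distr \<mu> borel (\<lambda>y. y)))"

end

theory Submission
  imports Defs
begin

text \<open>Since every function of finite energy is bounded, the oscillation of \<open>u\<close> is controlled by
  \<open>Q(u)\<close>. Hence \<open>v \<mapsto> \<integral> \<phi> v d\<mu>\<close>, with \<open>v\<close> extended to the
  boundary, is a bounded functional on the energy space modulo constants
  (constants are annihilated because \<open>\<phi>\<close> has integral zero), and its Riesz representer \<open>u\<close> solves the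
  Neumann problem. The same oscillation bound is a Poincare inequality, which makes \<open>Q(e\<^sup>-\<^sup>t\<^sup>L f)\<close> decay
  exponentially; this gives a uniform exponential bound on \<open>p\<^sub>t(x, \<cdot>) - 1/m(X)\<close>. With
  \<open>f = 1\<^sub>x - m(x)/m(X)\<close> one has \<open>m(x) \<integral> \<phi> p\<^sub>t(x, \<cdot>) d\<mu> = Q(u, e\<^sup>-\<^sup>t\<^sup>L f) = - d/dt \<langle>u, e\<^sup>-\<^sup>t\<^sup>L f\<rangle>\<close>, whose
  integral over \<open>t > 0\<close> is \<open>\<langle>u, f\<rangle> = m(x) u(x)\<close>. Fubini turns this into the Green kernel formula, and the
  Revuz identity for \<open>h = 1\<^sub>x\<close> into the probabilistic one.\<close>

section \<open>Semi-inner products on spaces of functions\<close>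

text \<open>The semigroup is known only through its axioms, without spectral calculus. Decay and
  derivative identities are therefore proved for \<open>g\<close> in the domain of \<open>L\<close>,
  where real functions such as \<open>\<langle>T t g, h\<rangle>\<close> can be differentiated, and
  are carried to all functions of finite energy by density (\<open>lap_dense\<close>). The detour is
  forced: the indicator of a vertex has finite energy but need not lie in the domain of
  \<open>L\<close>. Boundary points are reached only as limits of vertices, so bounds must be
  uniform over vertices and norms in \<open>ell2 m\<close> do not suffice. The oscillation bound
  makes the energy dominate the sup norm of mean zero functions, and such bounds pass to the
  boundary. This is why \<open>f\<close> is centred: the semigroup preserves the mean, so sup bound
  and Poincare inequality stay available for all times, and the subtracted constant is invisible to
  \<phi>. Constants: \<open>osc_const\<close> bounds squared oscillations by the energy,
  \<open>gap_const = osc_const * mass\<close> is the resulting Poincare constant, and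
  \<open>1 / gap_const\<close> is the decay rate.\<close>

locale semi_inner_space =
  fixes V :: "('a \<Rightarrow> real) set" and B :: "('a \<Rightarrow> real) \<Rightarrow> ('a \<Rightarrow> real) \<Rightarrow> real"
  assumes lin: "u \<in> V \<Longrightarrow> v \<in> V \<Longrightarrow> (\<lambda>x. c * u x + d * v x) \<in> V"
    and sym: "u \<in> V \<Longrightarrow> v \<in> V \<Longrightarrow> B u v = B v u"
    and bilin: "u \<in> V \<Longrightarrow> v \<in> V \<Longrightarrow> w \<in> V \<Longrightarrow>
      B (\<lambda>x. c * u x + d * v x) w = c * B u w + d * B v w"
    and nonneg: "u \<in> V \<Longrightarrow> 0 \<le> B u u"
begin

definition nrm :: "('a \<Rightarrow> real) \<Rightarrow> real" where "nrm u = sqrt (B u u)"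

lemma diff_mem: "u \<in> V \<Longrightarrow> v \<in> V \<Longrightarrow> (\<lambda>x. u x - v x) \<in> V"
  using lin[of u v 1 "-1"] by simp

lemma add_mem: "u \<in> V \<Longrightarrow> v \<in> V \<Longrightarrow> (\<lambda>x. u x + v x) \<in> V"
  using lin[of u v 1 1] by simp

lemma scale_mem: "u \<in> V \<Longrightarrow> (\<lambda>x. c * u x) \<in> V"
  using lin[of u u c 0] by simp

lemma diff_left: "u \<in> V \<Longrightarrow> v \<in> V \<Longrightarrow> w \<in> V \<Longrightarrow> B (\<lambda>x. u x - v x) w = B u w - B v w"
  using bilin[of u v w 1 "-1"] by simp

lemma scale_left: "u \<in> V \<Longrightarrow> w \<in> V \<Longrightarrow> B (\<lambda>x. c * u x) w = c * B u w"
  using bilin[of u u w c 0] by simp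

lemma diff_right: "u \<in> V \<Longrightarrow> v \<in> V \<Longrightarrow> w \<in> V \<Longrightarrow> B w (\<lambda>x. u x - v x) = B w u - B w v"
  using diff_left[of u v w] sym diff_mem by metis

lemma bilin_right: "u \<in> V \<Longrightarrow> v \<in> V \<Longrightarrow> w \<in> V \<Longrightarrow>
    B w (\<lambda>x. c * u x + d * v x) = c * B w u + d * B w v"
  using bilin[of u v w c d] sym lin by metis

lemma expand:
  assumes "u \<in> V" "v \<in> V"
  shows "B (\<lambda>x. c * u x + d * v x) (\<lambda>x. c * u x + d * v x) = c\<^sup>2 * B u u + 2 * c * d * B u v + d\<^sup>2 * B v v"
  using assms by (simp add: bilin bilin_right lin sym[of v u] algebra_simps power2_eq_square)

lemma cauchy_schwarz_sq:
  assumes "u \<in> V" "v \<in> V"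
  shows "(B u v)\<^sup>2 \<le> B u u * B v v"
proof -
  have q: "0 \<le> B u u + 2 * t * B u v + t\<^sup>2 * B v v" for t
    using nonneg[OF lin[OF assms, of 1 t]] expand[OF assms, of 1 t] by simp
  show ?thesis
  proof (cases "B v v = 0")
    case True
    have "B u v = 0"
    proof (rule ccontr)
      assume n: "B u v \<noteq> 0"
      \<comment> \<open>In the degenerate direction the polynomial is affine in \<open>t\<close>;
        this \<open>t\<close> gives it the value -1.\<close>
      have "0 \<le> B u u + 2 * (-(B u u + 1) / (2 * B u v)) * B u v"
        using q[of "-(B u u + 1) / (2 * B u v)"] True by simp
      also have "\<dots> = -1" using n by (simp add: field_simps)
      finally show False by simp
    qed
    then show ?thesis using True by simp
  next
    case False
    then have p: "B v v > 0" using nonneg[OF assms(2)] by simp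
    \<comment> \<open>The polynomial at its minimiser.\<close>
    have "0 \<le> B u u + 2 * (-B u v / B v v) * B u v + (-B u v / B v v)\<^sup>2 * B v v" by (rule q)
    also have "\<dots> = B u u - (B u v)\<^sup>2 / B v v"
      using p by (simp add: field_simps power2_eq_square)
    finally show ?thesis using p by (simp add: field_simps)
  qed
qed

lemma nrm_ge_0: "u \<in> V \<Longrightarrow> 0 \<le> nrm u"
  by (simp add: nrm_def nonneg)

lemma nrm_sq: "u \<in> V \<Longrightarrow> (nrm u)\<^sup>2 = B u u"
  by (simp add: nrm_def nonneg)

lemma cauchy_schwarz: "u \<in> V \<Longrightarrow> v \<in> V \<Longrightarrow> \<bar>B u v\<bar> \<le> nrm u * nrm v"
  unfolding nrm_def real_sqrt_mult[symmetric]
  by (rule real_le_rsqrt) (simp add: cauchy_schwarz_sq)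

lemma nrm_triangle:
  assumes "u \<in> V" "v \<in> V"
  shows "nrm (\<lambda>x. u x + v x) \<le> nrm u + nrm v"
proof (rule power2_le_imp_le)
  have "(nrm (\<lambda>x. u x + v x))\<^sup>2 = B u u + 2 * B u v + B v v"
    using expand[OF assms, of 1 1] nrm_sq[OF add_mem[OF assms]] by simp
  also have "\<dots> \<le> (nrm u + nrm v)\<^sup>2"
    using cauchy_schwarz[OF assms] nrm_sq assms by (simp add: power2_sum)
  finally show "(nrm (\<lambda>x. u x + v x))\<^sup>2 \<le> (nrm u + nrm v)\<^sup>2" .
qed (simp add: nrm_ge_0 assms)

lemma nrm_scale: "u \<in> V \<Longrightarrow> nrm (\<lambda>x. c * u x) = \<bar>c\<bar> * nrm u"
  using expand[of u u c 0] by (simp add: nrm_def real_sqrt_mult)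

lemma nrm_minus_commute: "u \<in> V \<Longrightarrow> v \<in> V \<Longrightarrow> nrm (\<lambda>x. u x - v x) = nrm (\<lambda>x. v x - u x)"
  using nrm_scale[OF diff_mem, of u v "-1"] by simp

lemma nrm_triangle3:
  assumes "u \<in> V" "v \<in> V" "w \<in> V"
  shows "nrm (\<lambda>x. u x - w x) \<le> nrm (\<lambda>x. u x - v x) + nrm (\<lambda>x. v x - w x)"
  using nrm_triangle[OF diff_mem[OF assms(1,2)] diff_mem[OF assms(2,3)]] by simp

lemma nrm_triangle_diff:
  assumes "u \<in> V" "v \<in> V"
  shows "\<bar>nrm u - nrm v\<bar> \<le> nrm (\<lambda>x. u x - v x)"
  using nrm_triangle[OF diff_mem[OF assms] assms(2)] nrm_triangle[OF diff_mem[OF assms(2,1)] assms(1)]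
    nrm_minus_commute[OF assms] by simp

lemma tendsto_B_left:
  assumes "\<And>n. s n \<in> V" "u \<in> V" "w \<in> V" "((\<lambda>n. nrm (\<lambda>x. s n x - u x)) \<longlongrightarrow> 0) F"
  shows "((\<lambda>n. B (s n) w) \<longlongrightarrow> B u w) F"
proof (rule LIM_zero_cancel)
  have "((\<lambda>n. nrm (\<lambda>x. s n x - u x) * nrm w) \<longlongrightarrow> 0) F"
    using tendsto_mult_left_zero[OF assms(4)] .
  then show "((\<lambda>n. B (s n) w - B u w) \<longlongrightarrow> 0) F"
    by (rule Lim_null_comparison[rotated])
      (use cauchy_schwarz[OF diff_mem[OF assms(1,2)] assms(3)] diff_left assms in auto)
qed

lemma tendsto_nrm:
  assumes "\<And>n. s n \<in> V" "u \<in> V" "((\<lambda>n. nrm (\<lambda>x. s n x - u x)) \<longlongrightarrow> 0) F"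
  shows "((\<lambda>n. nrm (s n)) \<longlongrightarrow> nrm u) F"
  by (rule LIM_zero_cancel, rule Lim_null_comparison[OF _ assms(3)])
    (use nrm_triangle_diff assms in auto)

text \<open>The functional lives on a subspace \<open>W\<close> only; its representer is then a limit of elements of
  \<open>W\<close>. Applied to \<open>\<ell> = B u\<close> this is the orthogonal projection onto the closure of \<open>W\<close>.\<close>

theorem riesz_subspace:
  assumes complete: "\<And>s. (\<And>n::nat. s n \<in> V) \<Longrightarrow>
      (\<And>e. e > 0 \<Longrightarrow> \<exists>N. \<forall>i\<ge>N. \<forall>j\<ge>N. B (\<lambda>x. s i x - s j x) (\<lambda>x. s i x - s j x) < e) \<Longrightarrow>
      \<exists>z\<in>V. (\<lambda>n. nrm (\<lambda>x. s n x - z x)) \<longlonglongrightarrow> 0"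
    and W: "W \<subseteq> V" "W \<noteq> {}" "\<And>u v c d. u \<in> W \<Longrightarrow> v \<in> W \<Longrightarrow> (\<lambda>x. c * u x + d * v x) \<in> W"
    and l: "\<And>u v c d. u \<in> W \<Longrightarrow> v \<in> W \<Longrightarrow> l (\<lambda>x. c * u x + d * v x) = c * l u + d * l v"
    and bound: "\<And>u. u \<in> W \<Longrightarrow> \<bar>l u\<bar> \<le> A * nrm u"
  shows "\<exists>z\<in>V. (\<forall>w\<in>W. B z w = l w) \<and> (\<exists>s. (\<forall>n::nat. s n \<in> W) \<and> (\<lambda>n. nrm (\<lambda>x. s n x - z x)) \<longlonglongrightarrow> 0)"
proof -
  \<comment> \<open>A minimising sequence of this functional converges to the representer. It is
    bounded below by completing the square:
    \<open>J w \<ge> (nrm w - A)\<^sup>2 - A\<^sup>2\<close>.\<close>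
  define J where "J w = B w w - 2 * l w" for w
  have J_ge: "J w \<ge> - A\<^sup>2" if "w \<in> W" for w
  proof -
    have "0 \<le> (nrm w - A)\<^sup>2" by simp
    then have "- A\<^sup>2 \<le> (nrm w)\<^sup>2 - 2 * (A * nrm w)" by (simp add: power2_diff algebra_simps)
    then show ?thesis using bound[OF that] nrm_sq[of w] that W unfolding J_def by auto
  qed
  have J_bdd: "bdd_below (J ` W)" using J_ge by (auto intro!: bdd_belowI)
  define i where "i = Inf (J ` W)"
  have i_le: "i \<le> J w" if "w \<in> W" for w
    unfolding i_def using that J_bdd by (auto intro: cInf_lower)
  have "\<exists>w\<in>W. J w < i + 1 / real (Suc n)" for n
    using cInf_lessD[of "J ` W" "i + 1 / real (Suc n)"] W(2) unfolding i_def by auto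
  then obtain s where s: "\<And>n. s n \<in> W" "\<And>n. J (s n) < i + 1 / real (Suc n)" by metis
  have sV: "s n \<in> V" for n using s W by auto
  have J_lin: "J (\<lambda>x. c * u x + d * v x) =
      c\<^sup>2 * B u u + 2 * c * d * B u v + d\<^sup>2 * B v v - 2 * (c * l u + d * l v)"
    if "u \<in> W" "v \<in> W" for u v c d
    using expand[OF subsetD[OF W(1) that(1)] subsetD[OF W(1) that(2)], of c d] l[OF that]
    unfolding J_def by simp
  \<comment> \<open>Parallelogram identity: the midpoint of two near-minimisers lies in
    \<open>W\<close>, so its value is at least \<open>i\<close>, which forces the two to be
    close.\<close>
  have par: "B (\<lambda>x. s j x - s k x) (\<lambda>x. s j x - s k x) \<le> 2 / real (Suc j) + 2 / real (Suc k)" for j k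
  proof -
    have "B (\<lambda>x. s j x - s k x) (\<lambda>x. s j x - s k x) =
        2 * J (s j) + 2 * J (s k) - 4 * J (\<lambda>x. (1/2) * s j x + (1/2) * s k x)"
      unfolding J_lin[OF s(1) s(1)] using expand[OF sV sV, of 1 j "-1" k]
      by (simp add: J_def field_simps)
    also have "\<dots> \<le> 2 * (i + 1 / real (Suc j)) + 2 * (i + 1 / real (Suc k)) - 4 * i"
    proof -
      have "2 * a + 2 * a' - 4 * a'' \<le> 2 * (i + e) + 2 * (i + e') - 4 * i"
        if "a < i + e" "a' < i + e'" "i \<le> a''" for a a' a'' e e' :: real
        using that by simp
      then show ?thesis using s(2)[of j] s(2)[of k] i_le[OF W(3)[OF s(1)[of j] s(1)[of k]]] by blast
    qed
    finally show ?thesis by simp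
  qed
  have cauchy: "\<exists>N. \<forall>i\<ge>N. \<forall>j\<ge>N. B (\<lambda>x. s i x - s j x) (\<lambda>x. s i x - s j x) < e" if "e > 0" for e
  proof -
    obtain N where N: "inverse (real (Suc N)) < e / 4"
      using reals_Archimedean[of "e/4"] \<open>e > 0\<close> by (metis divide_pos_pos zero_less_numeral)
    have "B (\<lambda>x. s j x - s k x) (\<lambda>x. s j x - s k x) < e" if "j \<ge> N" "k \<ge> N" for j k
    proof -
      have "2 / real (Suc j) \<le> 2 / real (Suc N)" "2 / real (Suc k) \<le> 2 / real (Suc N)"
        using that by (auto intro!: divide_left_mono)
      moreover have "2 / real (Suc N) < e / 2" using N by (simp add: inverse_eq_divide)
      ultimately show ?thesis using par[of j k] by linarith
    qed
    then show ?thesis by blast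
  qed
  obtain z where z: "z \<in> V" "(\<lambda>n. nrm (\<lambda>x. s n x - z x)) \<longlonglongrightarrow> 0"
    using complete[of s, OF sV cauchy] by blast
  have "B z w = l w" if w: "w \<in> W" for w
  proof -
    have wV: "w \<in> V" using w W by auto
    \<comment> \<open>First variation. As \<open>z\<close> may lie outside \<open>W\<close>, the
      competitor is \<open>s n + t w\<close>, and the error 1/(n+1) of the minimising sequence
      vanishes in the limit.\<close>
    have q: "0 \<le> t\<^sup>2 * B w w + 2 * t * (B z w - l w)" for t
    proof (rule LIMSEQ_le)
      show "(\<lambda>n. - 1 / real (Suc n)) \<longlonglongrightarrow> 0"
        using tendsto_minus[OF LIMSEQ_inverse_real_of_nat] by (simp add: inverse_eq_divide)
      show "(\<lambda>n. t\<^sup>2 * B w w + 2 * t * (B (s n) w - l w)) \<longlonglongrightarrow> t\<^sup>2 * B w w + 2 * t * (B z w - l w)"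
        by (intro tendsto_intros tendsto_B_left sV z wV)
      have "- 1 / real (Suc n) \<le> t\<^sup>2 * B w w + 2 * t * (B (s n) w - l w)" for n
        using s(2)[of n] i_le[OF W(3)[OF s(1)[of n] w, of 1 t]] J_lin[OF s(1)[of n] w, of 1 t]
        by (simp add: J_def algebra_simps)
      then show "\<exists>N. \<forall>n\<ge>N. - 1 / real (Suc n) \<le> t\<^sup>2 * B w w + 2 * t * (B (s n) w - l w)"
        by blast
    qed
    \<comment> \<open>Taking \<open>t = -r\<close> in \<open>q\<close> leaves
      \<open>0 \<le> - r\<^sup>2 * (a + 2)\<close>; the summand 1 in the denominator covers null
      vectors \<open>w\<close>.\<close>
    define a r where "a = B w w" and "r = (B z w - l w) / (a + 1)"
    have a: "a \<ge> 0" using nonneg[OF wV] by (simp add: a_def)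
    then have r: "B z w - l w = r * (a + 1)" by (simp add: r_def)
    have "r\<^sup>2 * (a + 2) \<le> 0"
      using q[of "-r"] by (simp add: a_def[symmetric] r algebra_simps power2_eq_square)
    then have "r = 0" using a by (simp add: mult_le_0_iff)
    then show ?thesis using r by simp
  qed
  then show ?thesis using s(1) z by blast
qed

end

section \<open>The energy space of a canonically compactifiable graph\<close>

text \<open>Meant for pairings with the indicator of \<open>z\<close>, whose edge terms live on the
  row and the column of \<open>z\<close>. The corner lies on both; its value 0 makes the double
  count harmless.\<close>

lemma has_sum_cross:
  fixes k :: "'a \<times> 'a \<Rightarrow> 'b::real_normed_vector"
  assumes "\<And>x y. x \<noteq> z \<Longrightarrow> y \<noteq> z \<Longrightarrow> k (x, y) = 0" and "k (z, z) = 0"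
    and "((\<lambda>y. k (z, y)) has_sum r) UNIV" and "((\<lambda>x. k (x, z)) has_sum s) UNIV"
  shows "(k has_sum (r + s)) UNIV"
proof -
  have 1: "(k has_sum r) (Pair z ` UNIV)"
    using assms(3) by (subst has_sum_reindex) (auto simp: inj_on_def o_def)
  have "(k has_sum s) ((\<lambda>x. (x, z)) ` UNIV)"
    using assms(4) by (subst has_sum_reindex) (auto simp: inj_on_def o_def)
  then have 2: "(k has_sum s) ((\<lambda>x. (x, z)) ` (UNIV - {z}))"
    by (rule has_sum_cong_neutral[THEN iffD1, rotated -1]) (use assms(2) in auto)
  have "(k has_sum (r + s)) (Pair z ` UNIV \<union> (\<lambda>x. (x, z)) ` (UNIV - {z}))"
    by (rule has_sum_Un_disjoint[OF 1 2]) auto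
  then show ?thesis
    by (rule has_sum_cong_neutral[THEN iffD1, rotated -1]) (use assms(1) in \<open>auto simp: image_iff\<close>)
qed

definition edge_term :: "('x \<Rightarrow> 'x \<Rightarrow> real) \<Rightarrow> ('x \<Rightarrow> real) \<Rightarrow> ('x \<Rightarrow> real) \<Rightarrow> 'x \<times> 'x \<Rightarrow> real" where
  "edge_term b u v = (\<lambda>(x, y). b x y * (u x - u y) * (v x - v y))"

text \<open>As the terms are nonnegative, both sides say that the finite partial sums are bounded.
  From here on the energy is handled by real summability.\<close>

lemma energy_finite_iff:
  assumes "is_graph b"
  shows "u \<in> finite_energy b \<longleftrightarrow> edge_term b u u summable_on UNIV"
proof -
  have nn: "edge_term b u u e \<ge> 0" for e
    using assms by (auto simp: edge_term_def is_graph_def mult.assoc split: prod.split)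
  have e: "energy b u = (\<Sum>\<^sub>\<infinity>e\<in>UNIV. ennreal (edge_term b u u e)) / 2"
    unfolding energy_def edge_term_def
    by (intro arg_cong2[where f = "(/)"] infsum_cong) (auto simp: power2_eq_square mult.assoc)
  have "ennreal (x) / 2 < top" for x by (simp add: ennreal_divide_eq_top_iff less_top[symmetric])
  show ?thesis
  proof
    assume s: "edge_term b u u summable_on UNIV"
    have "(\<Sum>\<^sub>\<infinity>e\<in>UNIV. ennreal (edge_term b u u e)) = ennreal (infsum (edge_term b u u) UNIV)"
      unfolding infsum_nonneg_is_SUPREMUM_ennreal[OF s nn]
      by (subst nonneg_infsum_complete) (auto simp: sum_ennreal nn)
    then show "u \<in> finite_energy b"
      by (simp add: finite_energy_def e ennreal_divide_eq_top_iff less_top[symmetric])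
  next
    assume "u \<in> finite_energy b"
    then have "(\<Sum>\<^sub>\<infinity>e\<in>UNIV. ennreal (edge_term b u u e)) < top"
      by (simp add: finite_energy_def e ennreal_divide_eq_top_iff less_top[symmetric])
    then obtain c where c: "0 \<le> c" "(\<Sum>\<^sub>\<infinity>e\<in>UNIV. ennreal (edge_term b u u e)) = ennreal c"
      using less_top_ennreal by blast
    show "edge_term b u u summable_on UNIV"
    proof (rule nonneg_bdd_above_summable_on)
      have "sum (edge_term b u u) F \<le> c" if "finite F" for F
      proof -
        have "ennreal (sum (edge_term b u u) F) = (\<Sum>e\<in>F. ennreal (edge_term b u u e))"
          by (simp add: sum_ennreal nn)
        also have "\<dots> \<le> (\<Sum>\<^sub>\<infinity>e\<in>UNIV. ennreal (edge_term b u u e))"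
          by (subst nonneg_infsum_complete) (use that in \<open>auto intro!: SUP_upper\<close>)
        finally show ?thesis using c by simp
      qed
      then show "bdd_above (sum (edge_term b u u) ` {F. F \<subseteq> UNIV \<and> finite F})"
        by (auto intro!: bdd_aboveI)
    qed (rule nn)
  qed
qed

locale compactifiable_graph =
  fixes b :: "'x::countable \<Rightarrow> 'x \<Rightarrow> real"
  assumes compactifiable: "canonically_compactifiable b"
begin

abbreviation "D \<equiv> finite_energy b"
abbreviation "E \<equiv> edge_term b"

lemma graph: "is_graph b"
  using compactifiable by (simp add: canonically_compactifiable_def)

lemma b_nonneg: "0 \<le> b x y" and b_sym: "b x y = b y x" and b_diag: "b x x = 0"
  and b_summable: "b x summable_on UNIV"
  using graph by (auto simp: is_graph_def)

lemma D_iff: "u \<in> D \<longleftrightarrow> E u u summable_on UNIV"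
  by (rule energy_finite_iff[OF graph])

lemma D_bounded: "u \<in> D \<Longrightarrow> bounded (range u)"
  using compactifiable by (simp add: canonically_compactifiable_def)

lemma E_nonneg: "0 \<le> E u u e"
  by (auto simp: edge_term_def b_nonneg mult.assoc split: prod.split)

lemma E_sym: "E u v = E v u"
  by (auto simp: edge_term_def fun_eq_iff)

lemma E_bilin: "E (\<lambda>x. c * u x + d * v x) w e = c * E u w e + d * E v w e"
  by (auto simp: edge_term_def algebra_simps split: prod.split)

lemma Q_eq: "Qform b u v = infsum (E u v) UNIV / 2"
  by (simp add: Qform_def edge_term_def)

lemma E_le:
  assumes "\<And>x y. \<bar>u x - u y\<bar> \<le> \<bar>v x - v y\<bar>"
  shows "E u u e \<le> E v v e"
proof -
  have "(u x - u y)\<^sup>2 \<le> (v x - v y)\<^sup>2" for x y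
    using assms[of x y] by (simp add: abs_le_square_iff)
  then show ?thesis
    by (cases e) (auto simp: edge_term_def power2_eq_square mult.assoc intro!: mult_left_mono b_nonneg)
qed

lemma D_lin:
  assumes "u \<in> D" "v \<in> D"
  shows "(\<lambda>x. c * u x + d * v x) \<in> D"
  unfolding D_iff
proof (rule summable_on_comparison_test)
  show "(\<lambda>e. 2 * c\<^sup>2 * E u u e + 2 * d\<^sup>2 * E v v e) summable_on UNIV"
    using assms by (intro summable_on_add summable_on_cmult_right) (auto simp: D_iff)
  show "E (\<lambda>x. c * u x + d * v x) (\<lambda>x. c * u x + d * v x) e \<le> 2 * c\<^sup>2 * E u u e + 2 * d\<^sup>2 * E v v e" for e
  proof (cases e)
    case (Pair x y)
    have "(c * p + d * q)\<^sup>2 \<le> 2 * c\<^sup>2 * p\<^sup>2 + 2 * d\<^sup>2 * q\<^sup>2" for p q :: real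
      using zero_le_power2[of "c * p - d * q"] by (simp add: power2_eq_square algebra_simps)
    from mult_left_mono[OF this[of "u x - u y" "v x - v y"] b_nonneg[of x y]]
    show ?thesis unfolding Pair by (simp add: edge_term_def power2_eq_square algebra_simps)
  qed
qed (rule E_nonneg)

text \<open>Polarization. The coefficients 1 are kept so that \<open>D_lin\<close> applies
  literally.\<close>

lemma E_summable:
  assumes "u \<in> D" "v \<in> D"
  shows "E u v summable_on UNIV"
proof -
  have 1: "E (\<lambda>x. 1 * u x + 1 * v x) (\<lambda>x. 1 * u x + 1 * v x) summable_on UNIV"
    using D_lin[OF assms, of 1 1] unfolding D_iff .
  have eq: "E u v = (\<lambda>e. (1/2) * (E (\<lambda>x. 1 * u x + 1 * v x) (\<lambda>x. 1 * u x + 1 * v x) e + (-1) * E u u e + (-1) * E v v e))"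
    by (auto simp: edge_term_def algebra_simps fun_eq_iff)
  show ?thesis
    using 1 assms unfolding D_iff by (subst eq)
    (intro summable_on_cmult_right summable_on_add; assumption)
qed

text \<open>Constants are null vectors, so the form is only semidefinite, and limits in its seminorm
  are blind to added constants.\<close>

sublocale Q: semi_inner_space D "Qform b"
proof
  show "Qform b (\<lambda>x. c * u x + d * v x) w = c * Qform b u w + d * Qform b v w"
    if "u \<in> D" "v \<in> D" "w \<in> D" for u v w c d
  proof -
    have "infsum (E (\<lambda>x. c * u x + d * v x) w) UNIV = infsum (\<lambda>e. c * E u w e + d * E v w e) UNIV"
      by (rule infsum_cong) (simp add: E_bilin)
    also have "\<dots> = c * infsum (E u w) UNIV + d * infsum (E v w) UNIV"
      using that by (subst infsum_add) (auto intro!: summable_on_cmult_right E_summable simp: infsum_cmult_right E_summable)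
    finally show ?thesis by (simp add: Q_eq)
  qed
  show "0 \<le> Qform b u u" for u
    by (simp add: Q_eq infsum_nonneg E_nonneg)
qed (auto simp: D_lin Q_eq E_sym)

lemma Q_const: "Qform b (\<lambda>_. c) v = 0" "Qform b v (\<lambda>_. c) = 0"
  by (auto simp: Q_eq edge_term_def case_prod_unfold)

lemma const_D: "(\<lambda>_. c) \<in> D"
  by (simp add: D_iff edge_term_def case_prod_unfold)

lemma Q_shift:
  "Qform b (\<lambda>x. u x + c) v = Qform b u v" "Qform b v (\<lambda>x. u x + c) = Qform b v u"
  "Qform b (\<lambda>x. u x - c) v = Qform b u v" "Qform b v (\<lambda>x. u x - c) = Qform b v u"
  by (auto simp: Q_eq edge_term_def)

text \<open>The normal contraction property of Dirichlet forms; it holds edge by edge.\<close>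

lemma contraction_D:
  assumes "\<And>x y. \<bar>u x - u y\<bar> \<le> \<bar>v x - v y\<bar>" "v \<in> D"
  shows "u \<in> D" and "Qform b u u \<le> Qform b v v"
proof -
  show u: "u \<in> D" using assms(2) unfolding D_iff
    by (rule summable_on_comparison_test) (use E_le[OF assms(1)] E_nonneg in auto)
  show "Qform b u u \<le> Qform b v v"
    unfolding Q_eq using u assms(2) E_le[OF assms(1)]
    by (auto simp: D_iff intro!: divide_right_mono infsum_mono)
qed

text \<open>On each edge the increment of the maximum is at most the larger of the two increments,
  so energies at worst add up.\<close>

lemma max_D:
  assumes "u \<in> D" "v \<in> D"
  shows "(\<lambda>x. max (u x) (v x)) \<in> D"
    and "Qform b (\<lambda>x. max (u x) (v x)) (\<lambda>x. max (u x) (v x)) \<le> Qform b u u + Qform b v v"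
proof -
  let ?w = "\<lambda>x. max (u x) (v x)"
  have le: "E ?w ?w e \<le> E u u e + E v v e" for e
  proof (cases e)
    case (Pair x y)
    have "\<bar>?w x - ?w y\<bar> \<le> max \<bar>u x - u y\<bar> \<bar>v x - v y\<bar>" by (auto simp: max_def)
    then have "\<bar>?w x - ?w y\<bar>\<^sup>2 \<le> (max \<bar>u x - u y\<bar> \<bar>v x - v y\<bar>)\<^sup>2" by (rule power_mono) simp
    also have "\<dots> \<le> (u x - u y)\<^sup>2 + (v x - v y)\<^sup>2" by (auto simp: max_def)
    finally have "(?w x - ?w y)\<^sup>2 \<le> (u x - u y)\<^sup>2 + (v x - v y)\<^sup>2" by simp
    from mult_left_mono[OF this b_nonneg[of x y]] show ?thesis
      unfolding Pair by (simp add: edge_term_def power2_eq_square algebra_simps)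
  qed
  have s: "(\<lambda>e. E u u e + E v v e) summable_on UNIV"
    using assms by (auto simp: D_iff intro: summable_on_add)
  show w: "?w \<in> D" unfolding D_iff by (rule summable_on_comparison_test[OF s le E_nonneg])
  have "infsum (E ?w ?w) UNIV \<le> infsum (\<lambda>e. E u u e + E v v e) UNIV"
    by (rule infsum_mono) (use w s le in \<open>auto simp: D_iff\<close>)
  then show "Qform b ?w ?w \<le> Qform b u u + Qform b v v"
    unfolding Q_eq using assms by (subst (asm) infsum_add) (auto simp: D_iff)
qed

text \<open>Lower semicontinuity of the energy: finite partial sums converge and inherit the bound.
  The bounds \<open>c n\<close> may vary, as decay estimates along an approximating sequence
  require.\<close>

lemma fatou:
  assumes "\<And>n::nat. s n \<in> D" "\<And>x. (\<lambda>n. s n x) \<longlonglongrightarrow> u x"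
    and "\<And>n. Qform b (s n) (s n) \<le> c n" "c \<longlonglongrightarrow> C"
  shows "u \<in> D" and "Qform b u u \<le> C"
proof -
  have le: "sum (E u u) F \<le> 2 * C" if "finite F" for F
  proof (rule LIMSEQ_le)
    show "(\<lambda>n. sum (E (s n) (s n)) F) \<longlonglongrightarrow> sum (E u u) F"
      by (auto simp: edge_term_def case_prod_unfold intro!: tendsto_sum tendsto_intros assms)
    show "(\<lambda>n. 2 * c n) \<longlonglongrightarrow> 2 * C" by (intro tendsto_intros assms)
    have "sum (E (s n) (s n)) F \<le> 2 * c n" for n
      using finite_sum_le_infsum[of "E (s n) (s n)" UNIV F] assms(1)[of n] assms(3)[of n] that E_nonneg
      by (simp add: D_iff Q_eq)
    then show "\<exists>N. \<forall>n\<ge>N. sum (E (s n) (s n)) F \<le> 2 * c n" by blast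
  qed
  show u: "u \<in> D" unfolding D_iff
    by (rule nonneg_bdd_above_summable_on[OF E_nonneg]) (use le in \<open>auto intro!: bdd_aboveI\<close>)
  show "Qform b u u \<le> C"
    using infsum_le_finite_sums[of "E u u" UNIV "2 * C"] le u by (auto simp: D_iff Q_eq)
qed

section \<open>Control of oscillations by the energy\<close>

lemma edge_bound:
  assumes "u \<in> D" "0 < b x y"
  shows "(u x - u y)\<^sup>2 \<le> 2 / b x y * Qform b u u"
proof -
  have "sum (E u u) {(x, y)} \<le> infsum (E u u) UNIV"
    by (rule finite_sum_le_infsum) (use assms E_nonneg in \<open>auto simp: D_iff\<close>)
  then show ?thesis using assms(2)
    by (simp add: Q_eq edge_term_def field_simps power2_eq_square)
qed

text \<open>Connectedness enters here: increments telescope along a path, with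
  \<open>(p + q)\<^sup>2 \<le> 2 * p\<^sup>2 + 2 * q\<^sup>2\<close> at each edge. The constant
  still depends on both vertices.\<close>

lemma path_bound:
  shows "\<exists>C\<ge>0. \<forall>u\<in>D. (u x - u y)\<^sup>2 \<le> C * Qform b u u"
proof -
  have "(\<lambda>v w. 0 < b v w)\<^sup>+\<^sup>+ x y"
    using compactifiable by (simp add: canonically_compactifiable_def graph_connected_def)
  then show ?thesis
  proof (induction rule: tranclp_induct)
    case (base y)
    then show ?case using edge_bound by (intro exI[of _ "2 / b x y"]) auto
  next
    case (step y z)
    then obtain C where C: "C \<ge> 0" "\<And>u. u \<in> D \<Longrightarrow> (u x - u y)\<^sup>2 \<le> C * Qform b u u" by blast
    have "(u x - u z)\<^sup>2 \<le> (2 * C + 2 * (2 / b y z)) * Qform b u u" if "u \<in> D" for u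
    proof -
      have "(u x - u z)\<^sup>2 \<le> 2 * (u x - u y)\<^sup>2 + 2 * (u y - u z)\<^sup>2"
        using zero_le_power2[of "(u x - u y) - (u y - u z)"] by (simp add: power2_eq_square algebra_simps)
      also have "\<dots> \<le> 2 * (C * Qform b u u) + 2 * (2 / b y z * Qform b u u)"
        using C(2)[OF that] edge_bound[OF that step(2)] by simp
      finally show ?thesis by (simp add: algebra_simps)
    qed
    then show ?case using C(1) step(2) by (intro exI[of _ "2 * C + 2 * (2 / b y z)"]) auto
  qed
qed

text \<open>If the bound failed, the supremum of suitably scaled functions \<open>\<bar>u\<^sub>n - u\<^sub>n(o)\<bar>\<close> would be an
  unbounded function of finite energy.\<close>

lemma uniform_bound_base: "\<exists>C. \<forall>u\<in>D. \<forall>x. (u x - u z)\<^sup>2 \<le> C * Qform b u u"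
proof (rule ccontr)
  assume "\<not> ?thesis"
  then have "\<forall>n. \<exists>u\<in>D. \<exists>x. (u x - u z)\<^sup>2 > (2 ^ n * (real n)\<^sup>2) * Qform b u u"
    by (metis not_le)
  then obtain f p where f: "\<And>n. f n \<in> D" "\<And>n. (f n (p n) - f n z)\<^sup>2 > (2 ^ n * (real n)\<^sup>2) * Qform b (f n) (f n)"
    by metis
  \<comment> \<open>Zero energy would give \<open>f n\<close> equal values at \<open>p n\<close> and
    \<open>z\<close> by \<open>path_bound\<close>, against the strict inequality in
    \<open>f\<close>.\<close>
  have pos: "Qform b (f n) (f n) > 0" for n
  proof (rule ccontr)
    assume "\<not> ?thesis"
    then have "Qform b (f n) (f n) = 0" using Q.nonneg[OF f(1)[of n]] by simp
    with path_bound[of "p n" z] f(1)[of n] f(2)[of n] show False by force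
  qed
  \<comment> \<open>The scaling turns the energy into the summable \<open>(1/2) ^ n\<close>, while
    the factor \<open>2 ^ n * (real n)\<^sup>2\<close> of the counterexample leaves a value above
    \<open>n\<close> at \<open>p n\<close>.\<close>
  define a where "a n = 1 / sqrt (2 ^ n * Qform b (f n) (f n))" for n
  define v where "v n x = \<bar>a n * f n x - a n * f n z\<bar>" for n x
  have a2: "(a n)\<^sup>2 * Qform b (f n) (f n) = (1/2) ^ n" for n
    using pos[of n] by (simp add: a_def power_divide field_simps)
  have v_D: "v n \<in> D" and v_Q: "Qform b (v n) (v n) \<le> (1/2) ^ n" for n
  proof -
    have *: "\<bar>v n x - v n y\<bar> \<le> \<bar>a n * f n x - a n * f n y\<bar>" for x y
      by (simp add: v_def)
    show "v n \<in> D" by (rule contraction_D[OF *]) (rule Q.scale_mem[OF f(1)])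
    have "Qform b (v n) (v n) \<le> Qform b (\<lambda>x. a n * f n x) (\<lambda>x. a n * f n x)"
      by (rule contraction_D[OF *]) (rule Q.scale_mem[OF f(1)])
    also have "\<dots> = (1/2) ^ n" using Q.expand[OF f(1) f(1), of "a n" n 0 n] a2[of n] by simp
    finally show "Qform b (v n) (v n) \<le> (1/2) ^ n" .
  qed
  have v_p: "v n (p n) > real n" if "n > 0" for n
  proof -
    have "(real n)\<^sup>2 = (a n)\<^sup>2 * (2 ^ n * (real n)\<^sup>2 * Qform b (f n) (f n))"
      using a2[of n] by (simp add: field_simps power_one_over)
    also have "\<dots> < (a n)\<^sup>2 * (f n (p n) - f n z)\<^sup>2"
      using f(2)[of n] pos[of n] by (intro mult_strict_left_mono) (auto simp: a_def)
    also have "\<dots> = (v n (p n))\<^sup>2"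
      by (simp add: v_def power_mult_distrib[symmetric] right_diff_distrib)
    finally show ?thesis by (rule power2_less_imp_less) (simp add: v_def)
  qed
  \<comment> \<open>These finite suprema increase and have energy at most 2;
    \<open>path_bound\<close> bounds them at each vertex, so a limit exists, of finite energy by
    \<open>fatou\<close>.\<close>
  define w where "w N x = Max ((\<lambda>n. v n x) ` {..N})" for N x
  have w_Suc: "w (Suc N) = (\<lambda>x. max (v (Suc N) x) (w N x))" for N
    by (auto simp: w_def atMost_Suc fun_eq_iff)
  have w: "w N \<in> D \<and> Qform b (w N) (w N) \<le> (\<Sum>n\<le>N. (1/2) ^ n)" for N
  proof (induction N)
    case 0
    then show ?case using v_D[of 0] v_Q[of 0] by (simp add: w_def)
  next
    case (Suc N)
    then show ?case using max_D[OF v_D[of "Suc N"], of "w N"] v_Q[of "Suc N"] unfolding w_Suc by auto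
  qed
  have geo: "(\<Sum>n\<le>N. (1/2::real) ^ n) \<le> 2" for N
  proof -
    have "(\<Sum>n\<le>N. (1/2::real) ^ n) = 2 - (1/2) ^ N" by (induction N) auto
    then show ?thesis by simp
  qed
  have bd: "\<exists>c. \<forall>n. v n x \<le> c" for x
  proof -
    obtain C where C: "C \<ge> 0" "\<And>u. u \<in> D \<Longrightarrow> (u x - u z)\<^sup>2 \<le> C * Qform b u u"
      using path_bound by blast
    have "v n x \<le> sqrt C" for n
    proof (rule real_le_rsqrt)
      have "(v n x)\<^sup>2 = (v n x - v n z)\<^sup>2" by (simp add: v_def)
      also have "\<dots> \<le> C * Qform b (v n) (v n)" by (rule C(2)[OF v_D])
      also have "\<dots> \<le> C * 1"
        by (intro mult_left_mono C(1) order_trans[OF v_Q]) (simp add: power_le_one)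
      finally show "(v n x)\<^sup>2 \<le> C" by simp
    qed
    then show ?thesis by blast
  qed
  have "\<exists>l. (\<lambda>N. w N x) \<longlonglongrightarrow> l \<and> (\<forall>N. w N x \<le> l)" for x
  proof -
    obtain c where c: "\<And>n. v n x \<le> c" using bd by blast
    show ?thesis
      by (rule incseq_convergent[of "\<lambda>N. w N x" c])
        (auto simp: incseq_Suc_iff w_Suc w_def c intro!: exI)
  qed
  then obtain g where g: "\<And>x. (\<lambda>N. w N x) \<longlonglongrightarrow> g x" "\<And>x N. w N x \<le> g x" by metis
  have "g \<in> D"
    by (rule fatou[of w g "\<lambda>_. 2"]) (use w g order_trans[OF conjunct2[OF w] geo] in auto)
  then obtain K where K: "\<And>x. \<bar>g x\<bar> \<le> K" using D_bounded[of g] by (auto simp: bounded_iff)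
  obtain n where n: "real n > K" "n > 0"
    using reals_Archimedean2[of "max K 0"] by (metis max_less_iff_conj of_nat_0_less_iff)
  have "v n (p n) \<le> w n (p n)" by (simp add: w_def)
  also have "\<dots> \<le> g (p n)" by (rule g)
  finally show False using v_p[OF n(2)] n(1) K[of "p n"] by linarith
qed

text \<open>A uniform bound for the free effective resistances, the suprema of
  \<open>(u x - u y)\<^sup>2\<close> over \<open>u\<close> with energy at most 1. Positivity is part
  of the choice because the constant is divided by.\<close>

definition osc_const :: real where
  "osc_const = (SOME C. C > 0 \<and> (\<forall>u\<in>D. \<forall>x y. (u x - u y)\<^sup>2 \<le> C * Qform b u u))"

lemma osc_const_pos: "osc_const > 0"
  and osc_bound: "u \<in> D \<Longrightarrow> (u x - u y)\<^sup>2 \<le> osc_const * Qform b u u"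
proof -
  fix z :: 'x
  obtain C where C: "\<And>u x. u \<in> D \<Longrightarrow> (u x - u z)\<^sup>2 \<le> C * Qform b u u"
    using uniform_bound_base by blast
  \<comment> \<open>Comparison through the base vertex \<open>z\<close> costs the factor 4; absolute
    value and 1 make the constant positive.\<close>
  have "(u x - u y)\<^sup>2 \<le> (4 * \<bar>C\<bar> + 1) * Qform b u u" if "u \<in> D" for u x y
  proof -
    have "(u x - u y)\<^sup>2 \<le> 2 * (u x - u z)\<^sup>2 + 2 * (u y - u z)\<^sup>2"
      using zero_le_power2[of "(u x - u z) + (u y - u z)"] by (simp add: power2_eq_square algebra_simps)
    also have "\<dots> \<le> 4 * (C * Qform b u u)"
      using C[OF that, of x] C[OF that, of y] by simp
    also have "\<dots> \<le> (4 * \<bar>C\<bar> + 1) * Qform b u u"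
      using mult_right_mono[of "4 * C" "4 * \<bar>C\<bar> + 1" "Qform b u u"] Q.nonneg[OF that]
      by (simp add: mult.assoc)
    finally show ?thesis .
  qed
  then have "\<exists>C>0. \<forall>u\<in>D. \<forall>x y. (u x - u y)\<^sup>2 \<le> C * Qform b u u"
    by (intro exI[of _ "4 * \<bar>C\<bar> + 1"]) auto
  from someI_ex[OF this[unfolded Bex_def]]
  show "osc_const > 0" "u \<in> D \<Longrightarrow> (u x - u y)\<^sup>2 \<le> osc_const * Qform b u u"
    unfolding osc_const_def[symmetric] by auto
qed

lemma osc_bound_nrm: "u \<in> D \<Longrightarrow> \<bar>u x - u y\<bar> \<le> sqrt osc_const * Q.nrm u"
  unfolding Q.nrm_def real_sqrt_mult[symmetric] by (rule real_le_rsqrt) (simp add: osc_bound)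

text \<open>Normalised at one vertex, the sequence converges pointwise by the oscillation bound;
  \<open>fatou\<close> upgrades this to convergence in energy.\<close>

lemma Q_complete:
  assumes "\<And>n::nat. s n \<in> D"
    and cau: "\<And>e. e > 0 \<Longrightarrow> \<exists>N. \<forall>i\<ge>N. \<forall>j\<ge>N. Qform b (\<lambda>x. s i x - s j x) (\<lambda>x. s i x - s j x) < e"
  shows "\<exists>z\<in>D. (\<lambda>n. Q.nrm (\<lambda>x. s n x - z x)) \<longlonglongrightarrow> 0"
proof -
  fix o' :: 'x
  define r where "r n x = s n x - s n o'" for n x
  have "Cauchy (\<lambda>n. r n x)" for x
  proof (rule metric_CauchyI)
    fix e :: real assume e: "e > 0"
    obtain N where N: "\<And>i j. i \<ge> N \<Longrightarrow> j \<ge> N \<Longrightarrow>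
        Qform b (\<lambda>x. s i x - s j x) (\<lambda>x. s i x - s j x) < e\<^sup>2 / osc_const"
      using cau[of "e\<^sup>2 / osc_const"] e osc_const_pos by auto
    have "dist (r i x) (r j x) < e" if "i \<ge> N" "j \<ge> N" for i j
    proof -
      have "(r i x - r j x)\<^sup>2 \<le> osc_const * Qform b (\<lambda>x. s i x - s j x) (\<lambda>x. s i x - s j x)"
        using osc_bound[OF Q.diff_mem[OF assms(1)[of i] assms(1)[of j]], of x o'] by (simp add: r_def algebra_simps)
      also have "\<dots> < osc_const * (e\<^sup>2 / osc_const)"
        by (intro mult_strict_left_mono N that osc_const_pos)
      also have "\<dots> = e\<^sup>2" using osc_const_pos by simp
      finally have "\<bar>r i x - r j x\<bar>\<^sup>2 < e\<^sup>2" by simp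
      from power2_less_imp_less[OF this] e show ?thesis by (simp add: dist_real_def)
    qed
    then show "\<exists>M. \<forall>i\<ge>M. \<forall>j\<ge>M. dist (r i x) (r j x) < e" by blast
  qed
  then have "\<exists>l. (\<lambda>n. r n x) \<longlonglongrightarrow> l" for x
    using Cauchy_convergent[of "\<lambda>n. r n x"] unfolding convergent_def by simp
  then obtain z where z: "\<And>x. (\<lambda>n. r n x) \<longlonglongrightarrow> z x" by metis
  \<comment> \<open>Fatou in the second index with the first one fixed; the shift by
    \<open>N\<close> in \<open>q\<close> makes the energy bound hold for every
    \<open>k\<close>.\<close>
  have fat: "(\<lambda>x. s i x - s i o' - z x) \<in> D \<and>
      Qform b (\<lambda>x. s i x - s i o' - z x) (\<lambda>x. s i x - s i o' - z x) \<le> e"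
    if "\<And>j. j \<ge> N \<Longrightarrow> Qform b (\<lambda>x. s i x - s j x) (\<lambda>x. s i x - s j x) \<le> e" for i N e
  proof -
    define q where "q k = (\<lambda>x. r i x - r (k + N) x)" for k
    have q: "q k = (\<lambda>x. (s i x - s (k + N) x) - (s i o' - s (k + N) o'))" for k
      by (auto simp: q_def r_def)
    have "q k \<in> D" for k unfolding q
      by (intro Q.diff_mem assms const_D)
    moreover have "Qform b (q k) (q k) \<le> e" for k unfolding q Q_shift by (rule that) simp
    moreover have "(\<lambda>k. q k x) \<longlonglongrightarrow> s i x - s i o' - z x" for x
      unfolding q_def using LIMSEQ_ignore_initial_segment[OF z, of N x]
      by (auto simp: r_def intro!: tendsto_intros)
    ultimately show ?thesis
      using fatou[of q "\<lambda>x. s i x - s i o' - z x" "\<lambda>_. e" e] by auto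
  qed
  obtain N where N: "\<And>i j. i \<ge> N \<Longrightarrow> j \<ge> N \<Longrightarrow>
        Qform b (\<lambda>x. s i x - s j x) (\<lambda>x. s i x - s j x) < 1"
    using cau[of 1] by auto
  have "(\<lambda>x. s N x - s N o' - z x) \<in> D"
    using fat[of N N 1] N[of N] less_imp_le by auto
  from Q.diff_mem[OF Q.diff_mem[OF assms(1)[of N] const_D[of "s N o'"]] this]
  have zD: "z \<in> D" by simp
  have "(\<lambda>n. Qform b (\<lambda>x. s n x - z x) (\<lambda>x. s n x - z x)) \<longlonglongrightarrow> 0"
  proof (rule LIMSEQ_I)
    fix e :: real assume e: "e > 0"
    obtain N where N: "\<And>i j. i \<ge> N \<Longrightarrow> j \<ge> N \<Longrightarrow>
        Qform b (\<lambda>x. s i x - s j x) (\<lambda>x. s i x - s j x) < e / 2"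
      using cau[of "e / 2"] e by auto
    have "norm (Qform b (\<lambda>x. s n x - z x) (\<lambda>x. s n x - z x) - 0) < e" if "n \<ge> N" for n
    proof -
      have "Qform b (\<lambda>x. s n x - s n o' - z x) (\<lambda>x. s n x - s n o' - z x) \<le> e / 2"
        using fat[of N n "e/2"] N[OF that] less_imp_le by blast
      also have "(\<lambda>x. s n x - s n o' - z x) = (\<lambda>x. (s n x - z x) - s n o')" by auto
      finally show ?thesis using e Q.nonneg[OF Q.diff_mem[OF assms(1)[of n] zD]] by (simp add: Q_shift)
    qed
    then show "\<exists>N. \<forall>n\<ge>N. norm (Qform b (\<lambda>x. s n x - z x) (\<lambda>x. s n x - z x) - 0) < e" by blast
  qed
  from tendsto_real_sqrt[OF this] show ?thesis using zD unfolding Q.nrm_def by auto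
qed

end

section \<open>The Neumann Laplacian\<close>

locale weighted_graph = compactifiable_graph b
  for b :: "'x::countable \<Rightarrow> 'x \<Rightarrow> real" +
  fixes m :: "'x \<Rightarrow> real"
  assumes finite_measure: "finite_discrete_measure m"
begin

abbreviation "H \<equiv> ell2 m"
abbreviation ip (\<open>\<langle>_,/ _\<rangle>\<close>) where "ip \<equiv> ell2_inner m"

definition mass :: real where "mass = (\<Sum>\<^sub>\<infinity>x. m x)"

lemma m_pos: "0 < m x" and m_summable: "m summable_on UNIV"
  using finite_measure by (auto simp: finite_discrete_measure_def)

lemma m_has_sum: "(m has_sum mass) UNIV"
  unfolding mass_def using m_summable by simp

lemma mass_pos: "0 < mass"
proof -
  fix x :: 'x
  have "sum m {x} \<le> infsum m UNIV"
    by (rule finite_sum_le_infsum[OF m_summable]) (auto intro: less_imp_le m_pos)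
  then show ?thesis using m_pos[of x] by (simp add: mass_def)
qed

lemma H_iff: "f \<in> H \<longleftrightarrow> (\<lambda>x. f x * f x * m x) summable_on UNIV"
  by (simp add: ell2_def power2_eq_square)

lemma H_nonneg: "0 \<le> f x * f x * m x"
  using m_pos[of x] by simp

lemma H_lin:
  assumes "f \<in> H" "g \<in> H"
  shows "(\<lambda>x. c * f x + d * g x) \<in> H"
  unfolding H_iff
proof (rule summable_on_comparison_test)
  show "(\<lambda>x. 2 * c\<^sup>2 * (f x * f x * m x) + 2 * d\<^sup>2 * (g x * g x * m x)) summable_on UNIV"
    using assms by (intro summable_on_add summable_on_cmult_right) (auto simp: H_iff)
  show "(c * f x + d * g x) * (c * f x + d * g x) * m x
      \<le> 2 * c\<^sup>2 * (f x * f x * m x) + 2 * d\<^sup>2 * (g x * g x * m x)" for x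
  proof -
    have "(c * p + d * q)\<^sup>2 \<le> 2 * c\<^sup>2 * p\<^sup>2 + 2 * d\<^sup>2 * q\<^sup>2" for p q :: real
      using zero_le_power2[of "c * p - d * q"] by (simp add: power2_eq_square algebra_simps)
    from mult_right_mono[OF this[of "f x" "g x"], of "m x"] m_pos[of x]
    show ?thesis by (simp add: power2_eq_square algebra_simps)
  qed
qed (rule H_nonneg)

lemma ip_summable:
  assumes "f \<in> H" "g \<in> H"
  shows "(\<lambda>x. f x * g x * m x) summable_on UNIV"
proof -
  have 1: "(\<lambda>x. (1 * f x + 1 * g x) * (1 * f x + 1 * g x) * m x) summable_on UNIV"
    using H_lin[OF assms, of 1 1] unfolding H_iff .
  have eq: "(\<lambda>x. f x * g x * m x) = (\<lambda>x. (1/2) * ((1 * f x + 1 * g x) * (1 * f x + 1 * g x) * m x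
      + (-1) * (f x * f x * m x) + (-1) * (g x * g x * m x)))"
    by (auto simp: algebra_simps fun_eq_iff)
  show ?thesis
    using 1 assms unfolding H_iff by (subst eq)
      (intro summable_on_cmult_right summable_on_add; assumption)
qed

sublocale H: semi_inner_space "ell2 m" "ell2_inner m"
proof
  show "\<langle>\<lambda>x. c * u x + d * v x, w\<rangle> = c * \<langle>u, w\<rangle> + d * \<langle>v, w\<rangle>"
    if "u \<in> H" "v \<in> H" "w \<in> H" for u v w c d
  proof -
    have "\<langle>\<lambda>x. c * u x + d * v x, w\<rangle> = infsum (\<lambda>x. c * (u x * w x * m x) + d * (v x * w x * m x)) UNIV"
      unfolding ell2_inner_def by (rule infsum_cong) (simp add: algebra_simps)
    also have "\<dots> = c * \<langle>u, w\<rangle> + d * \<langle>v, w\<rangle>"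
      unfolding ell2_inner_def using that
      by (subst infsum_add) (auto intro!: summable_on_cmult_right ip_summable simp: infsum_cmult_right ip_summable)
    finally show ?thesis .
  qed
  show "0 \<le> \<langle>u, u\<rangle>" for u
    unfolding ell2_inner_def by (rule infsum_nonneg) (rule H_nonneg)
  show "\<langle>u, v\<rangle> = \<langle>v, u\<rangle>" for u v
    unfolding ell2_inner_def by (rule infsum_cong) (simp add: mult.commute)
qed (rule H_lin)

lemma ell2_norm_eq: "ell2_norm m f = H.nrm f"
  by (simp add: ell2_norm_def H.nrm_def)

lemma bounded_H:
  assumes "bounded (range f)"
  shows "f \<in> H"
proof -
  obtain c where c: "\<And>x. \<bar>f x\<bar> \<le> c" using assms by (auto simp: bounded_iff)
  show ?thesis unfolding H_iff
  proof (rule summable_on_comparison_test)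
    show "(\<lambda>x. c\<^sup>2 * m x) summable_on UNIV" by (intro summable_on_cmult_right m_summable)
    show "f x * f x * m x \<le> c\<^sup>2 * m x" for x
      using power_mono[OF c[of x], of 2] m_pos[of x]
      by (intro mult_right_mono) (auto simp: power2_eq_square)
  qed (rule H_nonneg)
qed

lemma D_H: "u \<in> D \<Longrightarrow> u \<in> H"
  by (intro bounded_H D_bounded)

lemma form_domain_eq: "form_domain b m = D"
  using D_H by (auto simp: form_domain_def)

lemma const_H: "(\<lambda>_. c) \<in> H"
  by (intro D_H const_D)

lemma ip_const: "\<langle>\<lambda>_. c, \<lambda>_. d\<rangle> = c * d * mass"
  unfolding ell2_inner_def mass_def by (rule infsum_cmult_right) (rule m_summable)

lemma ip_indicator: "\<langle>f, indicator {z}\<rangle> = f z * m z"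
proof -
  have "((\<lambda>x. f x * indicator {z} x * m x) has_sum (f z * m z)) UNIV"
    by (rule has_sum_cong_neutral[THEN iffD1, OF _ _ _ has_sum_finiteI[of "{z}"]]) auto
  then show ?thesis unfolding ell2_inner_def by (rule infsumI)
qed

lemma indicator_H: "indicator {z} \<in> H"
  by (rule bounded_H) (auto simp: bounded_iff indicator_def intro!: exI[of _ 1])

text \<open>Evaluation at \<open>z\<close> is, up to the factor \<open>m z\<close>, the pairing with
  an indicator of norm \<open>sqrt (m z)\<close>. Hence convergence in \<open>ell2 m\<close> implies
  pointwise convergence.\<close>

lemma eval_bound:
  assumes "f \<in> H"
  shows "\<bar>f z\<bar> \<le> H.nrm f / sqrt (m z)"
proof -
  have "\<bar>\<langle>f, indicator {z}\<rangle>\<bar> \<le> H.nrm f * H.nrm (indicator {z})"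
    by (intro H.cauchy_schwarz assms indicator_H)
  then have "\<bar>f z\<bar> * m z \<le> H.nrm f * sqrt (m z)"
    using m_pos[of z] by (simp add: ip_indicator H.nrm_def abs_mult)
  moreover have "m z = sqrt (m z) * sqrt (m z)" using m_pos[of z] by simp
  ultimately have "(\<bar>f z\<bar> * sqrt (m z)) * sqrt (m z) \<le> H.nrm f * sqrt (m z)"
    by (simp only: mult.assoc)
  then have "\<bar>f z\<bar> * sqrt (m z) \<le> H.nrm f"
    by (rule mult_right_le_imp_le) (simp add: m_pos)
  then show ?thesis by (simp add: pos_le_divide_eq m_pos)
qed

lemma nrm_H_eq_0: "f \<in> H \<Longrightarrow> \<langle>f, f\<rangle> = 0 \<Longrightarrow> f z = 0"
  using eval_bound[of f z] by (simp add: H.nrm_def)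

section \<open>Means, the Poincare inequality and the Riesz representer\<close>

definition mean :: "('x \<Rightarrow> real) \<Rightarrow> real" where "mean f = \<langle>f, \<lambda>_. 1\<rangle> / mass"

lemma mean_ip: "\<langle>f, \<lambda>_. 1\<rangle> = mean f * mass"
  using mass_pos by (simp add: mean_def)

lemma ip_const_right: "f \<in> H \<Longrightarrow> \<langle>f, \<lambda>_. c\<rangle> = c * mean f * mass"
  using H.scale_left[of "\<lambda>_. 1" f c] H.sym[of f "\<lambda>_. c"] H.sym[of f "\<lambda>_. 1"] const_H
  by (simp add: mean_ip mult.assoc)

lemma mean_diff: "f \<in> H \<Longrightarrow> g \<in> H \<Longrightarrow> mean (\<lambda>x. f x - g x) = mean f - mean g"
  by (simp add: mean_def H.diff_left const_H diff_divide_distrib)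

lemma mean_const: "mean (\<lambda>_. c) = c"
  using mass_pos by (simp add: mean_def ip_const)

lemma mean_has_sum: "f \<in> H \<Longrightarrow> ((\<lambda>x. f x * m x) has_sum (mean f * mass)) UNIV"
  using has_sum_infsum[OF ip_summable[OF _ const_H[of 1], of f]]
  by (simp add: mean_ip[symmetric] ell2_inner_def)

lemma mean_eq_0_iff: "f \<in> H \<Longrightarrow> mean f = 0 \<longleftrightarrow> ((\<lambda>x. f x * m x) has_sum 0) UNIV"
  using mean_has_sum[of f] has_sum_unique mass_pos by fastforce

lemma mean_indicator: "mean (indicator {z}) = m z / mass"
  using H.sym[OF indicator_H const_H, of z 1] by (simp add: mean_def ip_indicator)

text \<open>Average the oscillation bound over \<open>y\<close> with weights \<open>m y\<close>: for
  mean zero, the sum of \<open>(u x - u y) * m y\<close> over \<open>y\<close> is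
  \<open>u x * mass\<close>.\<close>

lemma mean_0_bound:
  assumes "u \<in> D" "mean u = 0"
  shows "\<bar>u x\<bar> \<le> sqrt osc_const * Q.nrm u"
proof -
  let ?c = "sqrt osc_const * Q.nrm u"
  have uH: "u \<in> H" using assms by (rule_tac D_H)
  have 1: "((\<lambda>y. (u x - u y) * m y) has_sum (u x * mass)) UNIV"
    using has_sum_add[OF has_sum_cmult_right[OF m_has_sum, of "u x"]
      has_sum_cmult_right[OF mean_has_sum[OF uH], of "-1"]] assms(2)
    by (simp add: left_diff_distrib)
  have 2: "((\<lambda>y. ?c * m y) has_sum (?c * mass)) UNIV"
    by (rule has_sum_cmult_right[OF m_has_sum])
  have b: "\<bar>(u x - u y) * m y\<bar> \<le> ?c * m y" for y
    using osc_bound_nrm[OF assms(1), of x y] m_pos[of y] by (auto simp: abs_mult intro!: mult_right_mono)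
  have "u x * mass \<le> ?c * mass"
    by (rule has_sum_mono[OF 1 2]) (use b in \<open>simp add: abs_le_iff\<close>)
  moreover have "- 1 * (u x * mass) \<le> ?c * mass"
    by (rule has_sum_mono[OF has_sum_cmult_right[OF 1, of "- 1"] 2]) (use b in \<open>simp add: abs_le_iff\<close>)
  ultimately have "\<bar>u x\<bar> * mass \<le> ?c * mass" by (auto simp: abs_if)
  then show ?thesis using mass_pos by simp
qed

text \<open>Summing the squared sup bound against \<open>m\<close> yields this Poincare constant;
  its reciprocal is a lower bound for the spectral gap of \<open>L\<close>.\<close>

definition gap_const :: real where "gap_const = osc_const * mass"

lemma gap_const_pos: "0 < gap_const"
  using osc_const_pos mass_pos by (simp add: gap_const_def)

lemma poincare:
  assumes "u \<in> D" "mean u = 0"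
  shows "H.nrm u \<le> sqrt gap_const * Q.nrm u"
proof -
  have "\<langle>u, u\<rangle> \<le> infsum (\<lambda>x. (sqrt osc_const * Q.nrm u)\<^sup>2 * m x) UNIV"
    unfolding ell2_inner_def
  proof (rule infsum_mono)
    show "u x * u x * m x \<le> (sqrt osc_const * Q.nrm u)\<^sup>2 * m x" for x
      using power_mono[OF mean_0_bound[OF assms, of x], of 2] m_pos[of x]
      by (intro mult_right_mono) (auto simp: power2_eq_square)
  qed (use D_H[OF assms(1)] in \<open>auto simp: H_iff intro: summable_on_cmult_right m_summable\<close>)
  also have "\<dots> = (sqrt gap_const * Q.nrm u)\<^sup>2"
    using osc_const_pos mass_pos
    by (subst infsum_cmult_right) (auto simp: m_summable mass_def[symmetric] gap_const_def power_mult_distrib)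
  finally show ?thesis
    unfolding H.nrm_def using Q.nrm_ge_0[OF assms(1)] gap_const_pos by (intro real_le_lsqrt) auto
qed

text \<open>The bound forces \<open>l\<close> to vanish on constants, and the form ignores them too;
  so the mean of the representer can be set to 0.\<close>

lemma Q_riesz:
  assumes l: "\<And>u v c d. u \<in> D \<Longrightarrow> v \<in> D \<Longrightarrow> l (\<lambda>x. c * u x + d * v x) = c * l u + d * l v"
    and bound: "\<And>u. u \<in> D \<Longrightarrow> \<bar>l u\<bar> \<le> A * Q.nrm u"
  shows "\<exists>g\<in>D. mean g = 0 \<and> (\<forall>v\<in>D. Qform b g v = l v)"
proof -
  have "\<exists>z\<in>D. (\<forall>w\<in>D. Qform b z w = l w) \<and>
      (\<exists>s. (\<forall>n::nat. s n \<in> D) \<and> (\<lambda>n. Q.nrm (\<lambda>x. s n x - z x)) \<longlonglongrightarrow> 0)"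
  proof (rule Q.riesz_subspace[where W = D])
    show "\<exists>z\<in>D. (\<lambda>n. Q.nrm (\<lambda>x. s n x - z x)) \<longlonglongrightarrow> 0"
      if "\<And>n::nat. s n \<in> D"
        "\<And>e. e > 0 \<Longrightarrow> \<exists>N. \<forall>i\<ge>N. \<forall>j\<ge>N. Qform b (\<lambda>x. s i x - s j x) (\<lambda>x. s i x - s j x) < e" for s
      using Q_complete[OF that] .
  qed (use const_D assms in \<open>auto simp: D_lin\<close>)
  then obtain z where z: "z \<in> D" "\<And>w. w \<in> D \<Longrightarrow> Qform b z w = l w" by blast
  show ?thesis
    by (intro bexI[of _ "\<lambda>x. z x - mean z"] conjI ballI)
      (use z in \<open>auto simp: Q_shift mean_diff D_H const_H mean_const Q.diff_mem const_D\<close>)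
qed

text \<open>Only edges at \<open>z\<close> contribute, each in both orientations, which cancels the
  factor 1/2 of the form. Testing with indicators thus recovers the formal Laplacian.\<close>

lemma Q_indicator:
  assumes "u \<in> D"
  shows "indicator {z} \<in> D" and "Qform b u (indicator {z}) = m z * formal_laplacian b m u z"
    and "u \<in> formal_domain b"
proof -
  have bs: "(\<lambda>y. b z y * \<bar>f y\<bar>) summable_on UNIV" if bf: "bounded (range f)" for f :: "'x \<Rightarrow> real" and z
  proof -
    obtain c where c: "\<And>x. \<bar>f x\<bar> \<le> c" using bf by (auto simp: bounded_iff)
    show ?thesis
    proof (rule summable_on_comparison_test)
      show "(\<lambda>y. c * b z y) summable_on UNIV" by (intro summable_on_cmult_right b_summable)
      show "b z y * \<bar>f y\<bar> \<le> c * b z y" for y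
        using mult_left_mono[OF c b_nonneg, of z y y] by (simp add: mult.commute)
    qed (simp add: b_nonneg)
  qed
  have bs': "(\<lambda>y. b z y * f y) summable_on UNIV" if "bounded (range f)" for f :: "'x \<Rightarrow> real" and z
    using bs[OF that, of z] by (rule_tac abs_summable_summable) (simp add: abs_mult b_nonneg)
  have E: "(E f (indicator {z}) has_sum (S + S)) UNIV"
    if bf: "bounded (range f)" and S: "S = (\<Sum>\<^sub>\<infinity>y. b z y * (f z - f y))" for f S
  proof (rule has_sum_cross[where z = z])
    have bd: "bounded (range (\<lambda>y. f z - f y))"
    proof -
      obtain c where "\<And>x. \<bar>f x\<bar> \<le> c" using bf by (auto simp: bounded_iff)
      then have "\<bar>f z - f y\<bar> \<le> 2 * c" for y
        using abs_triangle_ineq4[of "f z" "f y"] by (metis add_mono mult_2 order_trans)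
      then show ?thesis by (auto simp: bounded_iff)
    qed
    have s: "((\<lambda>y. b z y * (f z - f y)) has_sum S) UNIV"
      unfolding S by (rule has_sum_infsum[OF bs'[OF bd]])
    have "E f (indicator {z}) (z, y) = b z y * (f z - f y)"
         "E f (indicator {z}) (y, z) = b z y * (f z - f y)" for y
      using b_diag by (auto simp: edge_term_def indicator_def b_sym[of y z] algebra_simps)
    with s show "((\<lambda>y. E f (indicator {z}) (z, y)) has_sum S) UNIV"
      "((\<lambda>x. E f (indicator {z}) (x, z)) has_sum S) UNIV" by simp_all
    show "E f (indicator {z}) (x, y) = 0" if "x \<noteq> z" "y \<noteq> z" for x y
      using that by (simp add: edge_term_def)
    show "E f (indicator {z}) (z, z) = 0"
      by (simp add: edge_term_def)
  qed
  have "bounded (range (indicator {z} :: 'x \<Rightarrow> real))"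
    by (auto simp: bounded_iff indicator_def intro!: exI[of _ 1])
  from E[OF this refl] show "indicator {z} \<in> D" unfolding D_iff summable_on_def by blast
  have "infsum (E u (indicator {z})) UNIV = 2 * (\<Sum>\<^sub>\<infinity>y. b z y * (u z - u y))"
    using E[OF D_bounded[OF assms] refl] by (simp add: infsumI)
  then show "Qform b u (indicator {z}) = m z * formal_laplacian b m u z"
    using m_pos[of z] by (simp add: Q_eq formal_laplacian_def)
  show "u \<in> formal_domain b"
    using bs[OF D_bounded[OF assms]] by (simp add: formal_domain_def)
qed

section \<open>The Poisson equation and density of the domain of \<open>L\<close>\<close>

abbreviation "lap \<equiv> neumann_laplacian b m"

lemma lap_iff: "lap u f \<longleftrightarrow> u \<in> D \<and> f \<in> H \<and> (\<forall>v\<in>D. Qform b u v = \<langle>f, v\<rangle>)"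
  by (simp add: neumann_laplacian_def form_domain_eq)

lemma lap_lin: "lap u f \<Longrightarrow> lap v g \<Longrightarrow> lap (\<lambda>x. c * u x + d * v x) (\<lambda>x. c * f x + d * g x)"
  by (auto simp: lap_iff D_lin H_lin Q.bilin H.bilin D_H)

lemma lap_const: "lap (\<lambda>_. c) (\<lambda>_. 0)"
  by (auto simp: lap_iff const_D const_H Q_const ell2_inner_def)

text \<open>The energy is the pairing of \<open>f\<close> with the centred \<open>g\<close>, whose
  norm Poincare absorbs. In this form the spectral gap yields a differential inequality along the
  semigroup.\<close>

lemma lap_energy_le:
  assumes "lap g f"
  shows "Qform b g g \<le> gap_const * \<langle>f, f\<rangle>"
proof -
  let ?g = "\<lambda>x. g x - mean g"
  have g: "g \<in> D" "f \<in> H" "?g \<in> D" "mean ?g = 0" "Q.nrm ?g = Q.nrm g"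
    using assms by (auto simp: lap_iff Q.diff_mem const_D mean_diff D_H const_H mean_const Q.nrm_def Q_shift)
  have "(Q.nrm g)\<^sup>2 = Qform b g ?g" using g by (simp add: Q.nrm_sq Q_shift)
  also have "\<dots> = \<langle>f, ?g\<rangle>" using assms g by (simp add: lap_iff)
  also have "\<dots> \<le> H.nrm f * H.nrm ?g"
    using H.cauchy_schwarz[OF g(2) D_H[OF g(3)]] by simp
  also have "\<dots> \<le> H.nrm f * (sqrt gap_const * Q.nrm g)"
    using poincare[OF g(3,4)] g by (intro mult_left_mono) (auto simp: H.nrm_ge_0)
  finally have "Q.nrm g * Q.nrm g \<le> (H.nrm f * sqrt gap_const) * Q.nrm g"
    by (simp add: power2_eq_square mult.assoc)
  then have "Q.nrm g \<le> H.nrm f * sqrt gap_const"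
    using Q.nrm_ge_0[OF g(1)] H.nrm_ge_0[OF g(2)] gap_const_pos
    by (cases "Q.nrm g = 0") auto
  then have "(Q.nrm g)\<^sup>2 \<le> (H.nrm f * sqrt gap_const)\<^sup>2"
    using Q.nrm_ge_0[OF g(1)] by (intro power_mono)
  then show ?thesis using gap_const_pos g by (simp add: Q.nrm_sq H.nrm_sq power_mult_distrib mult.commute)
qed

text \<open>The pairing with \<open>h\<close> ignores constants because \<open>h\<close> has mean
  zero; on centred functions Poincare bounds it by the energy.\<close>

lemma green_exists:
  assumes "h \<in> H" "mean h = 0"
  shows "\<exists>g. lap g h"
proof -
  have "\<exists>g\<in>D. mean g = 0 \<and> (\<forall>v\<in>D. Qform b g v = \<langle>h, v\<rangle>)"
  proof (rule Q_riesz)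
    show "\<langle>h, \<lambda>x. c * u x + d * v x\<rangle> = c * \<langle>h, u\<rangle> + d * \<langle>h, v\<rangle>" if "u \<in> D" "v \<in> D" for u v c d
      using that assms by (simp add: H.bilin_right D_H)
    show "\<bar>\<langle>h, u\<rangle>\<bar> \<le> (H.nrm h * sqrt gap_const) * Q.nrm u" if u: "u \<in> D" for u
    proof -
      let ?u = "\<lambda>x. u x - mean u"
      have g: "?u \<in> D" "mean ?u = 0" "Q.nrm ?u = Q.nrm u"
        using u by (auto simp: Q.diff_mem const_D mean_diff D_H const_H mean_const Q.nrm_def Q_shift)
      have "\<langle>h, u\<rangle> = \<langle>h, ?u\<rangle>"
        using assms u by (simp add: H.diff_right D_H const_H ip_const_right)
      also have "\<bar>\<dots>\<bar> \<le> H.nrm h * H.nrm ?u"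
        by (rule H.cauchy_schwarz[OF assms(1) D_H[OF g(1)]])
      also have "\<dots> \<le> H.nrm h * (sqrt gap_const * Q.nrm u)"
        using poincare[OF g(1,2)] g assms by (intro mult_left_mono) (auto simp: H.nrm_ge_0)
      finally show ?thesis by (simp add: mult.assoc)
    qed
  qed
  then show ?thesis using assms by (auto simp: lap_iff)
qed

text \<open>Projection onto the energy closure of the domain of \<open>L\<close> changes
  \<open>u\<close> by a constant only, which a shift repairs. The common mean is recorded so that
  Poincare applies to the differences.\<close>

lemma lap_dense:
  assumes u: "u \<in> D"
  shows "\<exists>s r. (\<forall>n::nat. lap (s n) (r n) \<and> mean (s n) = mean u) \<and> (\<lambda>n. Q.nrm (\<lambda>x. s n x - u x)) \<longlonglongrightarrow> 0"
proof -
  let ?W = "{g. \<exists>f. lap g f}"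
  have sub: "?W \<subseteq> D" by (auto simp: lap_iff)
  have "\<exists>z\<in>D. (\<forall>w\<in>?W. Qform b z w = Qform b u w) \<and>
      (\<exists>s. (\<forall>n::nat. s n \<in> ?W) \<and> (\<lambda>n. Q.nrm (\<lambda>x. s n x - z x)) \<longlonglongrightarrow> 0)"
  proof (rule Q.riesz_subspace[where A = "Q.nrm u"])
    show "\<exists>z\<in>D. (\<lambda>n. Q.nrm (\<lambda>x. s n x - z x)) \<longlonglongrightarrow> 0"
      if "\<And>n::nat. s n \<in> D"
        "\<And>e. e > 0 \<Longrightarrow> \<exists>N. \<forall>i\<ge>N. \<forall>j\<ge>N. Qform b (\<lambda>x. s i x - s j x) (\<lambda>x. s i x - s j x) < e" for s
      using Q_complete[OF that] .
    show "?W \<noteq> {}" using lap_const by blast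
    show "(\<lambda>x. c * f x + d * g x) \<in> ?W" if "f \<in> ?W" "g \<in> ?W" for f g c d
      using that lap_lin by blast
    show "Qform b u (\<lambda>x. c * f x + d * g x) = c * Qform b u f + d * Qform b u g"
      if "f \<in> ?W" "g \<in> ?W" for f g c d
      using that sub u by (simp add: Q.bilin_right subsetD)
    show "\<bar>Qform b u v\<bar> \<le> Q.nrm u * Q.nrm v" if "v \<in> ?W" for v
      using that sub u by (intro Q.cauchy_schwarz) auto
  qed (rule sub)
  then obtain z s where z: "z \<in> D" "\<And>w f. lap w f \<Longrightarrow> Qform b z w = Qform b u w"
    and s: "\<And>n::nat. \<exists>f. lap (s n) f" "(\<lambda>n. Q.nrm (\<lambda>x. s n x - z x)) \<longlonglongrightarrow> 0" by blast
  obtain r where r: "\<And>n. lap (s n) (r n)" using s(1) by metis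
  define c where "c = mean (\<lambda>x. z x - u x)"
  define d where "d = (\<lambda>x. (z x - u x) - c)"
  have zu: "(\<lambda>x. z x - u x) \<in> D" by (intro Q.diff_mem z u)
  have d: "d \<in> D" "mean d = 0" unfolding d_def c_def
    by (auto simp: Q.diff_mem z u const_D mean_diff D_H zu const_H mean_const)
  \<comment> \<open>The residual \<open>d\<close> is orthogonal in energy to the domain of
    \<open>L\<close>; testing this with a solution of \<open>L g = d\<close> gives
    \<open>\<langle>d, d\<rangle> = 0\<close>.\<close>
  obtain g where g: "lap g d" using green_exists[OF D_H[OF d(1)] d(2)] by blast
  have "\<langle>d, d\<rangle> = Qform b g d" using g d by (simp add: lap_iff)
  also have "\<dots> = Qform b d g" using g d by (intro Q.sym) (auto simp: lap_iff)
  also have "\<dots> = 0"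
    using z(2)[OF g] g z(1) u unfolding d_def Q_shift by (simp add: Q.diff_left lap_iff)
  finally have "d x = 0" for x using nrm_H_eq_0[OF D_H[OF d(1)]] by blast
  then have zu': "z x = u x + c" for x using d_def by (metis add.commute diff_add_cancel add_0)
  define s' where "s' n x = s n x - (mean (s n) - mean u)" for n x
  have sD: "s n \<in> D" for n using r[of n] by (simp add: lap_iff)
  have "lap (s' n) (r n)" for n
  proof -
    have "(\<lambda>x. 1 * s n x + (-1) * (mean (s n) - mean u)) = s' n" "(\<lambda>x. 1 * r n x + (-1) * 0) = r n"
      by (simp_all add: s'_def fun_eq_iff)
    then show ?thesis using lap_lin[OF r[of n] lap_const, of 1 "-1" "mean (s n) - mean u"] by simp
  qed
  moreover have "mean (s' n) = mean u" for n
    unfolding s'_def by (simp add: mean_diff D_H sD const_H mean_const)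
  moreover have "(\<lambda>n. Q.nrm (\<lambda>x. s' n x - u x)) \<longlonglongrightarrow> 0"
  proof -
    have "(\<lambda>x. s' n x - u x) = (\<lambda>x. (s n x - z x) + (c + mean u - mean (s n)))" for n
      using zu' by (auto simp: s'_def fun_eq_iff)
    then have "Q.nrm (\<lambda>x. s' n x - u x) = Q.nrm (\<lambda>x. s n x - z x)" for n
      by (simp only: Q.nrm_def Q_shift)
    then show ?thesis using s(2) by simp
  qed
  ultimately show ?thesis by blast
qed

end

section \<open>The heat semigroup\<close>

lemma set_integrable_exp_minus:
  fixes a :: real
  assumes "a > 0"
  shows "set_integrable lborel {0<..} (\<lambda>s. exp (- a * s))"
proof -
  have "(\<lambda>s. exp (- a * s)) absolutely_integrable_on {0..}"
    by (rule nonnegative_absolutely_integrable_1[OF integrable_on_exp_minus_to_infinity[OF assms]]) simp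
  then have "set_integrable lborel {0..} (\<lambda>s. exp (- a * s))"
    unfolding set_integrable_def by (subst (asm) integrable_completion) auto
  then show ?thesis by (rule set_integrable_subset) auto
qed

locale heat = weighted_graph b m
  for b :: "'x::countable \<Rightarrow> 'x \<Rightarrow> real" and m :: "'x \<Rightarrow> real" +
  fixes T :: "real \<Rightarrow> ('x \<Rightarrow> real) \<Rightarrow> 'x \<Rightarrow> real"
  assumes semigroup: "heat_semigroup b m T"
begin

lemma T_H: "0 \<le> t \<Longrightarrow> f \<in> H \<Longrightarrow> T t f \<in> H"
  and T_contr: "0 \<le> t \<Longrightarrow> f \<in> H \<Longrightarrow> H.nrm (T t f) \<le> H.nrm f"
  and T_lin: "0 \<le> t \<Longrightarrow> f \<in> H \<Longrightarrow> g \<in> H \<Longrightarrow>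
    T t (\<lambda>x. c * f x + d * g x) = (\<lambda>x. c * T t f x + d * T t g x)"
  and T_sym: "0 \<le> t \<Longrightarrow> f \<in> H \<Longrightarrow> g \<in> H \<Longrightarrow> \<langle>T t f, g\<rangle> = \<langle>f, T t g\<rangle>"
  and T_0: "f \<in> H \<Longrightarrow> T 0 f = f"
  and T_add: "0 \<le> s \<Longrightarrow> 0 \<le> t \<Longrightarrow> f \<in> H \<Longrightarrow> T (s + t) f = T s (T t f)"
  and T_cont: "f \<in> H \<Longrightarrow> ((\<lambda>t. H.nrm (\<lambda>x. T t f x - f x)) \<longlongrightarrow> 0) (at_right 0)"
  and T_gen: "lap u f \<longleftrightarrow> u \<in> H \<and> f \<in> H \<and>
    ((\<lambda>t. H.nrm (\<lambda>x. (u x - T t u x) / t - f x)) \<longlongrightarrow> 0) (at_right 0)"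
proof -
  note S = semigroup[unfolded heat_semigroup_def ell2_norm_eq]
  note S1 = conjunct1[OF S] and S' = conjunct2[OF S]
  note S2 = conjunct1[OF S'] and S' = conjunct2[OF S']
  note S3 = conjunct1[OF S'] and S' = conjunct2[OF S']
  note S4 = conjunct1[OF S'] and S' = conjunct2[OF S']
  note S5 = conjunct1[OF S'] and S' = conjunct2[OF S']
  note S6 = conjunct1[OF S'] and S7 = conjunct2[OF S']
  show "0 \<le> t \<Longrightarrow> f \<in> H \<Longrightarrow> T t f \<in> H" "0 \<le> t \<Longrightarrow> f \<in> H \<Longrightarrow> H.nrm (T t f) \<le> H.nrm f"
    using S1 by auto
  show "0 \<le> t \<Longrightarrow> f \<in> H \<Longrightarrow> g \<in> H \<Longrightarrow>
    T t (\<lambda>x. c * f x + d * g x) = (\<lambda>x. c * T t f x + d * T t g x)"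
    using S2 by simp
  show "0 \<le> t \<Longrightarrow> f \<in> H \<Longrightarrow> g \<in> H \<Longrightarrow> \<langle>T t f, g\<rangle> = \<langle>f, T t g\<rangle>"
    using S3 by blast
  show "f \<in> H \<Longrightarrow> T 0 f = f" using S4 by blast
  show "0 \<le> s \<Longrightarrow> 0 \<le> t \<Longrightarrow> f \<in> H \<Longrightarrow> T (s + t) f = T s (T t f)" using S5 by blast
  show "f \<in> H \<Longrightarrow> ((\<lambda>t. H.nrm (\<lambda>x. T t f x - f x)) \<longlongrightarrow> 0) (at_right 0)" using S6 by blast
  show "lap u f \<longleftrightarrow> u \<in> H \<and> f \<in> H \<and>
    ((\<lambda>t. H.nrm (\<lambda>x. (u x - T t u x) / t - f x)) \<longlongrightarrow> 0) (at_right 0)"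
    by (rule S7[rule_format])
qed

lemma T_diff: "0 \<le> t \<Longrightarrow> f \<in> H \<Longrightarrow> g \<in> H \<Longrightarrow> T t (\<lambda>x. f x - g x) = (\<lambda>x. T t f x - T t g x)"
  using T_lin[of t f g 1 "-1"] by simp

lemma T_small_time:
  assumes "f \<in> H" "e > 0"
  shows "\<exists>\<delta>>0. \<forall>r. 0 \<le> r \<longrightarrow> r < \<delta> \<longrightarrow> H.nrm (\<lambda>x. T r f x - f x) < e"
proof -
  have "eventually (\<lambda>r. H.nrm (\<lambda>x. T r f x - f x) < e) (at_right 0)"
    using order_tendstoD(2)[OF T_cont[OF assms(1)] assms(2)] .
  then obtain \<delta> where \<delta>: "\<delta> > 0" "\<And>r. 0 < r \<Longrightarrow> r < \<delta> \<Longrightarrow> H.nrm (\<lambda>x. T r f x - f x) < e"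
    by (auto simp: eventually_at_right_field)
  have "H.nrm (\<lambda>x. T 0 f x - f x) < e"
    using assms by (simp add: T_0 H.nrm_def ell2_inner_def)
  with \<delta> show ?thesis by (metis less_eq_real_def)
qed

text \<open>Strong continuity at time 0 spreads to all times, uniformly in \<open>s\<close>, and
  thereby becomes two-sided.\<close>

lemma T_shift_nrm:
  assumes "f \<in> H" "0 \<le> s" "0 \<le> r"
  shows "H.nrm (\<lambda>x. T (s + r) f x - T s f x) \<le> H.nrm (\<lambda>x. T r f x - f x)"
proof -
  have "(\<lambda>x. T (s + r) f x - T s f x) = T s (\<lambda>x. T r f x - f x)"
    using assms by (simp add: T_add T_diff T_H)
  then show ?thesis using assms by (simp add: T_contr H.diff_mem T_H)
qed

lemma T_ip_continuous:
  assumes "f \<in> H" "h \<in> H"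
  shows "continuous_on {0..} (\<lambda>t. \<langle>T t f, h\<rangle>)"
  unfolding continuous_on_iff
proof (intro ballI allI impI)
  fix t e :: real assume t: "t \<in> {0..}" and e: "0 < e"
  have pos: "0 < H.nrm h + 1" using H.nrm_ge_0[OF assms(2)] by simp
  obtain \<delta> where \<delta>: "\<delta> > 0" "\<And>r. 0 \<le> r \<Longrightarrow> r < \<delta> \<Longrightarrow> H.nrm (\<lambda>x. T r f x - f x) < e / (H.nrm h + 1)"
    using T_small_time[OF assms(1), of "e / (H.nrm h + 1)"] e pos by auto
  have main: "\<bar>\<langle>T (s + r) f, h\<rangle> - \<langle>T s f, h\<rangle>\<bar> < e" if "0 \<le> s" "0 \<le> r" "r < \<delta>" for s r
  proof -
    have "\<bar>\<langle>T (s + r) f, h\<rangle> - \<langle>T s f, h\<rangle>\<bar> = \<bar>\<langle>\<lambda>x. T (s + r) f x - T s f x, h\<rangle>\<bar>"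
      using that assms by (simp add: H.diff_left T_H)
    also have "\<dots> \<le> H.nrm (\<lambda>x. T (s + r) f x - T s f x) * H.nrm h"
      using that assms by (intro H.cauchy_schwarz H.diff_mem T_H) auto
    also have "\<dots> \<le> (e / (H.nrm h + 1)) * H.nrm h"
      using T_shift_nrm[OF assms(1) that(1,2)] \<delta>(2)[OF that(2,3)] H.nrm_ge_0[OF assms(2)]
      by (intro mult_right_mono) auto
    also have "\<dots> < (e / (H.nrm h + 1)) * (H.nrm h + 1)"
      using e pos by (intro mult_strict_left_mono) auto
    finally show ?thesis using pos by simp
  qed
  have "dist (\<langle>T s f, h\<rangle>) (\<langle>T t f, h\<rangle>) < e" if "s \<in> {0..}" "dist s t < \<delta>" for s
    using main[of s "t - s"] main[of t "s - t"] that t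
    by (cases "s \<le> t") (auto simp: dist_real_def abs_minus_commute)
  then show "\<exists>d>0. \<forall>s\<in>{0..}. dist s t < d \<longrightarrow> dist (\<langle>T s f, h\<rangle>) (\<langle>T t f, h\<rangle>) < e"
    using \<delta>(1) by blast
qed

text \<open>The heat equation in weak form, so that only a real derivative is needed. The generator
  provides a limit at 0 from the right only, hence a separate argument for the left
  quotient.\<close>

lemma T_ip_deriv:
  assumes g: "lap g f" and h: "h \<in> H" and t: "t > 0"
  shows "((\<lambda>t. \<langle>T t g, h\<rangle>) has_real_derivative - \<langle>T t f, h\<rangle>) (at t)"
  unfolding DERIV_def
proof (rule LIM_I)
  have gH: "g \<in> H" and fH: "f \<in> H"
    and lim: "((\<lambda>t. H.nrm (\<lambda>x. (g x - T t g x) / t - f x)) \<longlongrightarrow> 0) (at_right 0)"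
    using g T_gen by auto
  define q where "q k = (\<lambda>x. (g x - T k g x) / k)" for k
  have q: "q k = (\<lambda>x. (1 / k) * g x + (- 1 / k) * T k g x)" for k
    by (auto simp: q_def diff_divide_distrib)
  have qH: "q k \<in> H" if "k > 0" for k
    unfolding q using that gH by (intro H_lin T_H) auto
  have quot: "(\<langle>T (a + k) g, h\<rangle> - \<langle>T a g, h\<rangle>) / k = - \<langle>T a (q k), h\<rangle>" if "a \<ge> 0" "k > 0" for a k
  proof -
    have "T a (q k) = (\<lambda>x. (1 / k) * T a g x + (- 1 / k) * T a (T k g) x)"
      unfolding q using that gH by (intro T_lin T_H) auto
    then have "\<langle>T a (q k), h\<rangle> = (1 / k) * \<langle>T a g, h\<rangle> + (- 1 / k) * \<langle>T a (T k g), h\<rangle>"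
      using that gH h by (simp only: H.bilin T_H less_imp_le)
    then show ?thesis using that gH by (simp add: T_add field_simps)
  qed
  fix e :: real assume e: "0 < e"
  define e' where "e' = e / (2 * (H.nrm h + 1))"
  have hp: "0 < H.nrm h + 1" using H.nrm_ge_0[OF h] by simp
  have e': "e' > 0" and e'_lt: "2 * e' * H.nrm h < e"
    using e hp by (auto simp: e'_def field_simps)
  have "eventually (\<lambda>r. H.nrm (\<lambda>x. q r x - f x) < e') (at_right 0)"
    using order_tendstoD(2)[OF lim e'] by (simp add: q_def)
  then obtain d1 where d1: "d1 > 0" "\<And>r. 0 < r \<Longrightarrow> r < d1 \<Longrightarrow> H.nrm (\<lambda>x. q r x - f x) < e'"
    by (auto simp: eventually_at_right_field)
  obtain d2 where d2: "d2 > 0" "\<And>r. 0 \<le> r \<Longrightarrow> r < d2 \<Longrightarrow> H.nrm (\<lambda>x. T r f x - f x) < e'"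
    using T_small_time[OF fH e'] by blast
  \<comment> \<open>Serves both sides: \<open>v = f\<close> at base time \<open>t\<close> for the
    right quotient, \<open>v = T j f\<close> at base time \<open>t - j\<close> for the left
    one.\<close>
  have est: "\<bar>- \<langle>T a (q j), h\<rangle> + \<langle>T a v, h\<rangle>\<bar> < e"
    if a: "0 \<le> a" and j: "0 < j" "j < d1" and v: "v \<in> H" and vf: "H.nrm (\<lambda>x. v x - f x) < e'" for a j v
  proof -
    have "\<bar>- \<langle>T a (q j), h\<rangle> + \<langle>T a v, h\<rangle>\<bar> = \<bar>\<langle>T a (\<lambda>x. v x - q j x), h\<rangle>\<bar>"
      using a j v h qH by (simp add: T_diff H.diff_left T_H)
    also have "\<dots> \<le> H.nrm (T a (\<lambda>x. v x - q j x)) * H.nrm h"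
      using a j v h qH by (intro H.cauchy_schwarz T_H H.diff_mem) auto
    also have "\<dots> \<le> H.nrm (\<lambda>x. v x - q j x) * H.nrm h"
      using a j v h qH by (intro mult_right_mono T_contr H.diff_mem H.nrm_ge_0) auto
    also have "\<dots> \<le> (2 * e') * H.nrm h"
      using H.nrm_triangle3[OF v fH qH[OF j(1)]] vf d1(2)[OF j] H.nrm_minus_commute[OF fH qH[OF j(1)]]
      by (intro mult_right_mono H.nrm_ge_0 h) auto
    finally show ?thesis using e'_lt by simp
  qed
  have "norm ((\<langle>T (t + k) g, h\<rangle> - \<langle>T t g, h\<rangle>) / k - - \<langle>T t f, h\<rangle>) < e"
    if k: "k \<noteq> 0 \<and> norm (k - 0) < min t (min d1 d2)" for k
  proof (cases "k > 0")
    case True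
    have "\<bar>- \<langle>T t (q k), h\<rangle> + \<langle>T t f, h\<rangle>\<bar> < e"
      using True k t fH e' by (intro est) (auto simp: H.nrm_def ell2_inner_def)
    then show ?thesis using quot[of t k] True t by simp
  next
    case False
    define j where "j = - k"
    have j: "0 < j" "j < t" "j < d1" "j < d2" using False k by (auto simp: j_def)
    have "(\<langle>T (t + k) g, h\<rangle> - \<langle>T t g, h\<rangle>) / k = (\<langle>T ((t - j) + j) g, h\<rangle> - \<langle>T (t - j) g, h\<rangle>) / j"
      using j(1) by (simp add: j_def field_simps)
    also have "\<dots> = - \<langle>T (t - j) (q j), h\<rangle>" by (rule quot) (use j in auto)
    finally have 1: "(\<langle>T (t + k) g, h\<rangle> - \<langle>T t g, h\<rangle>) / k = - \<langle>T (t - j) (q j), h\<rangle>" .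
    have "T t f = T (t - j) (T j f)"
      using T_add[of "t - j" j f] j fH by simp
    moreover have "\<bar>- \<langle>T (t - j) (q j), h\<rangle> + \<langle>T (t - j) (T j f), h\<rangle>\<bar> < e"
      using j fH d2(2)[of j] by (intro est) (auto simp: T_H)
    ultimately show ?thesis unfolding 1 by simp
  qed
  then show "\<exists>s>0. \<forall>x. x \<noteq> 0 \<and> norm (x - 0) < s \<longrightarrow>
      norm ((\<langle>T (t + x) g, h\<rangle> - \<langle>T t g, h\<rangle>) / x - - \<langle>T t f, h\<rangle>) < e"
    using t d1(1) d2(1) by (intro exI[of _ "min t (min d1 d2)"]) auto
qed

lemma T_zero: "0 \<le> t \<Longrightarrow> T t (\<lambda>_. 0) = (\<lambda>_. 0)"
  using T_lin[OF _ const_H const_H, of t 0 0 0 0] by simp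

text \<open>Conservation of mass: \<open>L 1 = 0\<close> makes every pairing with an indicator
  constant in time.\<close>

lemma T_one:
  assumes "0 \<le> t"
  shows "T t (\<lambda>_. 1) = (\<lambda>_. 1)"
proof (cases "t = 0")
  case False
  show ?thesis
  proof
    fix x
    have "\<langle>T t (\<lambda>_. 1), indicator {x}\<rangle> = \<langle>T 0 (\<lambda>_. 1), indicator {x}\<rangle>"
    proof (rule DERIV_isconst_end[where f = "\<lambda>t. \<langle>T t (\<lambda>_. 1), indicator {x}\<rangle>"])
      show "continuous_on {0..t} (\<lambda>t. \<langle>T t (\<lambda>_. 1), indicator {x}\<rangle>)"
        by (rule continuous_on_subset[OF T_ip_continuous]) (auto simp: const_H indicator_H)
      show "((\<lambda>t. \<langle>T t (\<lambda>_. 1), indicator {x}\<rangle>) has_real_derivative 0) (at s)" if "0 < s" for s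
        using T_ip_deriv[OF lap_const indicator_H that, of 1 x] that
        by (simp add: T_zero ell2_inner_def)
    qed (use False assms in auto)
    then show "T t (\<lambda>_. 1) x = 1"
      using m_pos[of x] by (simp add: ip_indicator T_0 const_H)
  qed
qed (simp add: T_0 const_H)

lemma mean_T: "0 \<le> t \<Longrightarrow> f \<in> H \<Longrightarrow> mean (T t f) = mean f"
  by (simp add: mean_def T_sym const_H T_one)

text \<open>\<open>T t\<close> commutes with the difference quotients at 0 and is a contraction, so
  it transports the generator limit.\<close>

lemma lap_T:
  assumes g: "lap g f" and t: "0 \<le> t"
  shows "lap (T t g) (T t f)"
proof -
  have gH: "g \<in> H" and fH: "f \<in> H"
    and lim: "((\<lambda>t. H.nrm (\<lambda>x. (g x - T t g x) / t - f x)) \<longlongrightarrow> 0) (at_right 0)"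
    using g T_gen by auto
  have "((\<lambda>s. H.nrm (\<lambda>x. (T t g x - T s (T t g) x) / s - T t f x)) \<longlongrightarrow> 0) (at_right 0)"
  proof (rule Lim_null_comparison[OF _ lim])
    show "\<forall>\<^sub>F s in at_right 0. norm (H.nrm (\<lambda>x. (T t g x - T s (T t g) x) / s - T t f x))
        \<le> H.nrm (\<lambda>x. (g x - T s g x) / s - f x)"
      unfolding eventually_at_right_field
    proof (intro exI[of _ 1] conjI allI impI)
      fix s :: real assume s: "0 < s"
      let ?p = "\<lambda>x. (1 / s) * g x + (- 1 / s) * T s g x"
      let ?r = "\<lambda>x. 1 * ?p x + (- 1) * f x"
      have p: "?p \<in> H" using s gH by (intro H_lin T_H) auto
      have r: "?r \<in> H" by (rule H_lin[OF p fH])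
      have "T s (T t g) = T t (T s g)"
        using T_add[of s t g] T_add[of t s g] s t gH by (simp add: add.commute)
      moreover have "T t ?p = (\<lambda>x. (1 / s) * T t g x + (- 1 / s) * T t (T s g) x)"
        using s t gH by (intro T_lin T_H) auto
      ultimately have "T t ?r = (\<lambda>x. (T t g x - T s (T t g) x) / s - T t f x)"
        unfolding T_lin[OF t p fH] by (simp add: diff_divide_distrib)
      moreover have "?r = (\<lambda>x. (g x - T s g x) / s - f x)"
        by (simp add: diff_divide_distrib)
      ultimately show "norm (H.nrm (\<lambda>x. (T t g x - T s (T t g) x) / s - T t f x))
          \<le> H.nrm (\<lambda>x. (g x - T s g x) / s - f x)"
        using T_contr[OF t r] H.nrm_ge_0[OF T_H[OF t r]] by simp
    qed simp
  qed
  then show ?thesis using gH fH t by (simp add: T_gen T_H)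
qed

text \<open>A Gronwall argument: the energy has derivative
  \<open>- 2 * \<langle>T s f, T s f\<rangle>\<close> and is at most
  \<open>gap_const * \<langle>T s f, T s f\<rangle>\<close> by \<open>lap_energy_le\<close>.\<close>

lemma lap_energy_decay:
  assumes g: "lap g f" and t: "0 \<le> t"
  shows "Qform b (T t g) (T t g) \<le> exp (- 2 * t / gap_const) * Qform b g g"
proof -
  have gH: "g \<in> H" and fH: "f \<in> H" using g T_gen by auto
  \<comment> \<open>By symmetry the energy at time \<open>s\<close> is a pairing linear in the orbit
    at time \<open>2 * s\<close>, so the weak derivative suffices.\<close>
  let ?F = "\<lambda>s. \<langle>T (2 * s) g, f\<rangle>"
  have F: "?F s = Qform b (T s g) (T s g)" if "0 \<le> s" for s
  proof -
    have "Qform b (T s g) (T s g) = \<langle>T s f, T s g\<rangle>"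
      using lap_T[OF g that] by (simp add: lap_iff)
    also have "\<dots> = \<langle>T s (T s g), f\<rangle>"
      using that gH fH by (simp add: T_sym T_H H.sym[of _ f])
    finally show ?thesis using T_add[OF that that gH] by simp
  qed
  let ?G = "\<lambda>s. exp (2 * s / gap_const) * ?F s"
  have der: "(?G has_real_derivative
      exp (2 * s / gap_const) * (2 / gap_const * ?F s - 2 * \<langle>T s f, T s f\<rangle>)) (at s)" if "0 < s" for s
  proof -
    have "((\<lambda>s. \<langle>T (2 * s) g, f\<rangle>) has_real_derivative - \<langle>T (2 * s) f, f\<rangle> * 2) (at s)"
      by (rule DERIV_chain2[OF T_ip_deriv[OF g fH]]) (use that in \<open>auto intro!: derivative_eq_intros\<close>)
    moreover have "\<langle>T (2 * s) f, f\<rangle> = \<langle>T s f, T s f\<rangle>"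
      using T_add[of s s f] that fH by (simp add: T_sym T_H)
    ultimately have "((\<lambda>s. \<langle>T (2 * s) g, f\<rangle>) has_real_derivative - 2 * \<langle>T s f, T s f\<rangle>) (at s)"
      by (simp add: mult.commute)
    then show ?thesis
      using gap_const_pos by (auto intro!: derivative_eq_intros simp: algebra_simps)
  qed
  have "?G t \<le> ?G 0"
  proof (cases "t = 0")
    case False
    then have tp: "0 < t" using t by simp
    have "continuous_on {0..t} ?F"
      by (rule continuous_on_compose2[OF T_ip_continuous[OF gH fH]]) (auto intro!: continuous_intros)
    then have "continuous_on {0..t} ?G"
      using gap_const_pos by (auto intro!: continuous_intros)
    then obtain l z where z: "0 < z" "z < t" "(?G has_real_derivative l) (at z)" "?G t - ?G 0 = (t - 0) * l"
      using MVT[OF tp, of ?G] der by (meson real_differentiable_def)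
    have "l = exp (2 * z / gap_const) * (2 / gap_const * ?F z - 2 * \<langle>T z f, T z f\<rangle>)"
      using DERIV_unique[OF z(3) der[OF z(1)]] .
    moreover have "2 / gap_const * ?F z - 2 * \<langle>T z f, T z f\<rangle> \<le> 0"
      using lap_energy_le[OF lap_T[OF g, of z]] z(1) F[of z] gap_const_pos by (simp add: field_simps)
    ultimately have "l \<le> 0" by (simp add: mult_nonneg_nonpos)
    then have "(t - 0) * l \<le> 0" using tp by (simp add: mult_nonneg_nonpos)
    then show ?thesis using z(4) by linarith
  qed simp
  then have "exp (2 * t / gap_const) * Qform b (T t g) (T t g) \<le> Qform b g g"
    using F[OF t] F[of 0] gH by (simp add: T_0)
  then have "exp (- 2 * t / gap_const) * (exp (2 * t / gap_const) * Qform b (T t g) (T t g))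
      \<le> exp (- 2 * t / gap_const) * Qform b g g"
    by (intro mult_left_mono) auto
  then show ?thesis by (simp add: mult.assoc[symmetric] exp_add[symmetric])
qed

lemma lap_nrm_decay:
  assumes "lap g f" "0 \<le> t"
  shows "Q.nrm (T t g) \<le> exp (- (1 / gap_const) * t) * Q.nrm g"
proof -
  have D: "g \<in> D" "T t g \<in> D" using assms lap_T by (auto simp: lap_iff)
  have "(exp (- (1 / gap_const) * t))\<^sup>2 = exp (- 2 * t / gap_const)"
    by (simp add: exp_double[symmetric])
  then have "(Q.nrm (T t g))\<^sup>2 \<le> (exp (- (1 / gap_const) * t) * Q.nrm g)\<^sup>2"
    using lap_energy_decay[OF assms] D by (simp add: Q.nrm_sq power_mult_distrib)
  then show ?thesis
    by (rule power2_le_imp_le) (simp add: Q.nrm_ge_0 D)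
qed

section \<open>Passage from the domain of \<open>L\<close> to all functions of finite energy\<close>

lemma T_pointwise_limit:
  assumes "\<And>n::nat. s n \<in> D" "u \<in> D" "\<And>n. mean (s n) = mean u" "0 \<le> t"
    and "(\<lambda>n. Q.nrm (\<lambda>x. s n x - u x)) \<longlonglongrightarrow> 0"
  shows "(\<lambda>n. T t (s n) x) \<longlonglongrightarrow> T t u x"
proof (rule LIM_zero_cancel, rule Lim_null_comparison)
  show "(\<lambda>n. sqrt gap_const * Q.nrm (\<lambda>x. s n x - u x) / sqrt (m x)) \<longlonglongrightarrow> 0"
    using tendsto_divide[OF tendsto_mult[OF tendsto_const assms(5)] tendsto_const, of "sqrt (m x)" "sqrt gap_const"]
      m_pos[of x] by simp
  show "\<forall>\<^sub>F n in sequentially. norm (T t (s n) x - T t u x)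
      \<le> sqrt gap_const * Q.nrm (\<lambda>x. s n x - u x) / sqrt (m x)"
  proof (intro always_eventually allI)
    fix n
    let ?d = "\<lambda>x. s n x - u x"
    have d: "?d \<in> D" "mean ?d = 0" using assms by (auto simp: Q.diff_mem mean_diff D_H)
    have "T t ?d x = T t (s n) x - T t u x" using assms by (simp add: T_diff D_H)
    moreover have "\<bar>T t ?d x\<bar> \<le> H.nrm (T t ?d) / sqrt (m x)"
      by (intro eval_bound T_H D_H d assms)
    moreover have "H.nrm (T t ?d) \<le> sqrt gap_const * Q.nrm ?d"
      using T_contr[OF assms(4) D_H[OF d(1)]] poincare[OF d] by simp
    ultimately show "norm (T t (s n) x - T t u x) \<le> sqrt gap_const * Q.nrm ?d / sqrt (m x)"
      using m_pos[of x] by (smt (verit) divide_right_mono real_norm_def real_sqrt_ge_zero)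
  qed
qed

text \<open>The decay of the approximants from \<open>lap_dense\<close> survives the limit: their
  orbits converge pointwise, and \<open>fatou\<close> applies with the converging bounds.\<close>

lemma T_D_decay:
  assumes f: "f \<in> D" and t: "0 \<le> t"
  shows "T t f \<in> D" and "Q.nrm (T t f) \<le> exp (- (1 / gap_const) * t) * Q.nrm f"
proof -
  obtain s r where s: "\<And>n::nat. lap (s n) (r n)" "\<And>n. mean (s n) = mean f"
    "(\<lambda>n. Q.nrm (\<lambda>x. s n x - f x)) \<longlonglongrightarrow> 0"
    using lap_dense[OF f] by metis
  have sD: "s n \<in> D" and TsD: "T t (s n) \<in> D" for n
    using s(1)[of n] lap_T[OF s(1)[of n] t] by (auto simp: lap_iff)
  let ?e = "exp (- (1 / gap_const) * t)"
  have Q: "Qform b (T t (s n)) (T t (s n)) \<le> (?e * Q.nrm (s n))\<^sup>2" for n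
    using power_mono[OF lap_nrm_decay[OF s(1)[of n] t], of 2] Q.nrm_ge_0[OF TsD] Q.nrm_sq[OF TsD]
    by simp
  have lim: "(\<lambda>n. (?e * Q.nrm (s n))\<^sup>2) \<longlonglongrightarrow> (?e * Q.nrm f)\<^sup>2"
    by (intro tendsto_intros Q.tendsto_nrm sD f s)
  note fat = fatou[OF TsD T_pointwise_limit[OF sD f s(2) t s(3)] Q lim]
  show D: "T t f \<in> D" by (rule fat)
  show "Q.nrm (T t f) \<le> ?e * Q.nrm f"
    unfolding Q.nrm_def[of "T t f"] using fat(2) Q.nrm_ge_0[OF f] by (intro real_le_lsqrt) auto
qed

lemma T_Q_contr:
  assumes "f \<in> D" "0 \<le> t"
  shows "Q.nrm (T t f) \<le> Q.nrm f"
proof -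
  have "exp (- (1 / gap_const) * t) * Q.nrm f \<le> 1 * Q.nrm f"
    using gap_const_pos assms by (intro mult_right_mono Q.nrm_ge_0) auto
  then show ?thesis using T_D_decay[OF assms] by simp
qed

text \<open>For \<open>g\<close> in the domain with \<open>L g = h\<close>, the energy of
  \<open>T r g - g\<close> is its pairing with \<open>T r h - h\<close>, hence small by strong
  continuity in \<open>ell2 m\<close>. Approximation works uniformly in \<open>r\<close> since
  \<open>T r\<close> contracts the energy.\<close>

lemma T_Q_small_time:
  assumes f: "f \<in> D"
  shows "((\<lambda>r. Q.nrm (\<lambda>x. T r f x - f x)) \<longlongrightarrow> 0) (at_right 0)"
proof (rule tendstoI)
  fix e :: real assume e: "0 < e"
  obtain s r where s: "\<And>n::nat. lap (s n) (r n)" "(\<lambda>n. Q.nrm (\<lambda>x. s n x - f x)) \<longlonglongrightarrow> 0"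
    using lap_dense[OF f] by metis
  \<comment> \<open>A quarter is spent twice, on \<open>g - f\<close> and on its image under
    \<open>T r\<close>; half of \<open>e\<close> remains for \<open>T r g - g\<close>.\<close>
  obtain n where n: "Q.nrm (\<lambda>x. s n x - f x) < e / 4"
    using order_tendstoD(2)[OF s(2), of "e / 4"] e eventually_sequentially by auto
  define g h where "g = s n" and "h = r n"
  have g: "lap g h" "g \<in> D" "h \<in> H" "g \<in> H"
    using s(1)[of n] D_H by (auto simp: g_def h_def lap_iff)
  have "((\<lambda>r. sqrt (2 * H.nrm h * H.nrm (\<lambda>x. T r g x - g x))) \<longlongrightarrow> sqrt (2 * H.nrm h * 0)) (at_right 0)"
    by (intro tendsto_intros T_cont g)
  then have "\<forall>\<^sub>F r in at_right 0. sqrt (2 * H.nrm h * H.nrm (\<lambda>x. T r g x - g x)) < e / 2"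
    using e by (intro order_tendstoD(2)[where y = 0]) auto
  moreover have "\<forall>\<^sub>F r in at_right 0. (0::real) < r" by (simp add: eventually_at_right_less)
  ultimately show "\<forall>\<^sub>F r in at_right 0. dist (Q.nrm (\<lambda>x. T r f x - f x)) 0 < e"
  proof eventually_elim
    case (elim r)
    have Tg: "lap (T r g) (T r h)" "T r g \<in> D" "T r h \<in> H"
      using lap_T[OF g(1), of r] elim by (auto simp: lap_iff)
    have Tf: "T r f \<in> D" using T_D_decay(1)[OF f, of r] elim by simp
    have "Qform b (\<lambda>x. T r g x - g x) (\<lambda>x. T r g x - g x) = \<langle>\<lambda>x. T r h x - h x, \<lambda>x. T r g x - g x\<rangle>"
      using lap_lin[OF Tg(1) g(1), of 1 "-1"] Tg g by (auto simp: lap_iff Q.diff_mem)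
    also have "\<dots> \<le> H.nrm (\<lambda>x. T r h x - h x) * H.nrm (\<lambda>x. T r g x - g x)"
      using H.cauchy_schwarz[OF H.diff_mem[OF Tg(3) g(3)] H.diff_mem[OF D_H[OF Tg(2)] g(4)]] by simp
    also have "\<dots> \<le> (2 * H.nrm h) * H.nrm (\<lambda>x. T r g x - g x)"
    proof (intro mult_right_mono H.nrm_ge_0 H.diff_mem D_H Tg g)
      have "H.nrm (\<lambda>x. T r h x - h x) \<le> H.nrm (T r h) + H.nrm h"
        using H.nrm_triangle[OF Tg(3) H.scale_mem[OF g(3), of "-1"]] H.nrm_scale[OF g(3), of "-1"] by simp
      then show "H.nrm (\<lambda>x. T r h x - h x) \<le> 2 * H.nrm h"
        using T_contr[of r h] elim g by simp
    qed
    finally have "Q.nrm (\<lambda>x. T r g x - g x) \<le> sqrt (2 * H.nrm h * H.nrm (\<lambda>x. T r g x - g x))"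
      unfolding Q.nrm_def by (rule real_sqrt_le_mono)
    also have "\<dots> < e / 2" by (rule elim)
    finally have "Q.nrm (\<lambda>x. T r g x - g x) < e / 2" .
    moreover have "Q.nrm (\<lambda>x. T r f x - T r g x) \<le> Q.nrm (\<lambda>x. g x - f x)"
      using T_Q_contr[OF Q.diff_mem[OF f g(2)], of r] elim f g Q.nrm_minus_commute[OF f g(2)]
      by (simp add: T_diff D_H)
    ultimately have "Q.nrm (\<lambda>x. T r f x - f x) < e"
      using Q.nrm_triangle3[OF Tf Tg(2) f] Q.nrm_triangle3[OF Tg(2) g(2) f] n by (simp add: g_def)
    then show ?case using Q.nrm_ge_0[OF Q.diff_mem[OF Tf f]] by simp
  qed
qed

text \<open>Pulling out \<open>T t\<close> leaves a mean zero function with controlled sup norm.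
  Uniformity in \<open>x\<close> is what lets the estimate reach the boundary.\<close>

lemma T_osc_bound:
  assumes f: "f \<in> D" "mean f = 0" and t: "0 \<le> t" "t \<le> s"
  shows "\<bar>T s f x - T t f x\<bar> \<le> sqrt osc_const * Q.nrm (\<lambda>x. T (s - t) f x - f x)"
proof -
  let ?d = "\<lambda>x. T (s - t) f x - f x"
  have Td: "T (s - t) f \<in> D" using T_D_decay(1)[OF f(1), of "s - t"] t by simp
  have d: "?d \<in> D" "mean ?d = 0"
    using t f Td by (auto simp: Q.diff_mem mean_diff D_H mean_T)
  have "T t ?d = (\<lambda>x. T s f x - T t f x)"
    using T_add[of t "s - t" f] t f Td by (simp add: T_diff D_H)
  then have "\<bar>T s f x - T t f x\<bar> = \<bar>T t ?d x\<bar>" by simp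
  also have "\<dots> \<le> sqrt osc_const * Q.nrm (T t ?d)"
    using T_D_decay(1)[OF d(1) t(1)] d t by (intro mean_0_bound) (auto simp: mean_T D_H)
  also have "\<dots> \<le> sqrt osc_const * Q.nrm ?d"
    using osc_const_pos T_Q_contr[OF d(1) t(1)] by (intro mult_left_mono) auto
  finally show ?thesis .
qed

text \<open>For \<open>g\<close> in the domain of \<open>L\<close> the integrand is the continuous
  function \<open>\<langle>T s h, u\<rangle>\<close>, the derivative of
  \<open>- \<langle>T s g, u\<rangle>\<close>; energy decay makes it integrable, so the fundamental
  theorem applies on the half-line.\<close>

lemma integral_Q_T_lap:
  assumes u: "u \<in> D" and g: "lap g h" and mean: "mean g = 0"
  shows "set_integrable lborel {0<..} (\<lambda>s. Qform b u (T s g))"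
    and "(LBINT s:{0<..}. Qform b u (T s g)) = \<langle>u, g\<rangle>"
proof -
  have D: "g \<in> D" "g \<in> H" "h \<in> H" "u \<in> H" using g u by (auto simp: lap_iff D_H)
  have eq: "Qform b u (T s g) = \<langle>T s h, u\<rangle>" if "0 < s" for s
    using lap_T[OF g, of s] that u by (simp add: lap_iff Q.sym[OF u])
  have cont: "continuous_on {0<..} (\<lambda>s. \<langle>T s h, u\<rangle>)"
    by (rule continuous_on_subset[OF T_ip_continuous[OF D(3,4)]]) auto
  have bound: "\<bar>Qform b u (T s g)\<bar> \<le> (Q.nrm u * Q.nrm g) * exp (- (1 / gap_const) * s)" if "0 < s" for s
  proof -
    have "\<bar>Qform b u (T s g)\<bar> \<le> Q.nrm u * Q.nrm (T s g)"
      using T_D_decay(1)[OF D(1), of s] that by (intro Q.cauchy_schwarz u) auto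
    also have "\<dots> \<le> Q.nrm u * (exp (- (1 / gap_const) * s) * Q.nrm g)"
      using T_D_decay(2)[OF D(1), of s] that by (intro mult_left_mono Q.nrm_ge_0 u) auto
    finally show ?thesis by (simp add: mult_ac)
  qed
  have exp: "set_integrable lborel {0<..} (\<lambda>s. (Q.nrm u * Q.nrm g) * exp (- (1 / gap_const) * s))"
    using set_integrable_exp_minus[of "1 / gap_const"] gap_const_pos by (intro set_integrable_mult_right) simp
  have int: "set_integrable lborel {0<..} (\<lambda>s. \<langle>T s h, u\<rangle>)"
  proof (rule set_integrable_bound[OF exp])
    show "set_borel_measurable lborel {0<..} (\<lambda>s. \<langle>T s h, u\<rangle>)"
      unfolding set_borel_measurable_def
      using borel_measurable_continuous_on_indicator[OF _ cont] by simp
    show "AE s in lborel. s \<in> {0<..} \<longrightarrow> norm \<langle>T s h, u\<rangle> \<le> norm ((Q.nrm u * Q.nrm g) * exp (- (1 / gap_const) * s))"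
      using bound eq Q.nrm_ge_0[OF u] Q.nrm_ge_0[OF D(1)] by (intro AE_I2) simp
  qed
  then show "set_integrable lborel {0<..} (\<lambda>s. Qform b u (T s g))"
    using eq by (subst set_integrable_cong[OF refl refl]) auto
  have "(LBINT s:{0<..}. Qform b u (T s g)) = (LBINT s:{0<..}. \<langle>T s h, u\<rangle>)"
    using eq by (intro set_lebesgue_integral_cong) auto
  also have "\<dots> = (LBINT s=0..\<infinity>. \<langle>T s h, u\<rangle>)"
    by (simp add: interval_lebesgue_integral_0_infty)
  also have "\<dots> = 0 - (- \<langle>g, u\<rangle>)"
  proof (rule interval_integral_FTC_integrable)
    show "((\<lambda>s. - \<langle>T s g, u\<rangle>) has_vector_derivative \<langle>T s h, u\<rangle>) (at s)"
      if "0 < ereal s" for s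
      using DERIV_minus[OF T_ip_deriv[OF g D(4), of s]] that
      by (simp add: has_real_derivative_iff_has_vector_derivative)
    show "isCont (\<lambda>s. \<langle>T s h, u\<rangle>) s" if "0 < ereal s" for s
      using cont that by (simp add: continuous_on_eq_continuous_at)
    show "set_integrable lborel (einterval 0 \<infinity>) (\<lambda>s. \<langle>T s h, u\<rangle>)"
      using int by (simp add: zero_ereal_def)
    have "((\<lambda>s. \<langle>T s g, u\<rangle>) \<longlongrightarrow> \<langle>T 0 g, u\<rangle>) (at_right 0)"
      using T_ip_continuous[OF D(2,4)] by (auto simp: continuous_on_def intro: tendsto_within_subset)
    then show "(((\<lambda>s. - \<langle>T s g, u\<rangle>) \<circ> real_of_ereal) \<longlongrightarrow> - \<langle>g, u\<rangle>) (at_right 0)"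
      unfolding zero_ereal_def by (simp add: ereal_tendsto_simps T_0 D tendsto_minus)
    \<comment> \<open>The boundary term at infinity vanishes: mean zero lets Poincare convert energy
      decay into norm decay.\<close>
    have "((\<lambda>s. H.nrm u * (sqrt gap_const * (exp (- (1 / gap_const) * s) * Q.nrm g))) \<longlongrightarrow>
        H.nrm u * (sqrt gap_const * (0 * Q.nrm g))) at_top"
    proof (intro tendsto_intros)
      have "filterlim (\<lambda>s. - (1 / gap_const) * s) at_bot at_top"
        using gap_const_pos by (intro filterlim_tendsto_neg_mult_at_bot[OF tendsto_const _ filterlim_ident]) simp
      then show "((\<lambda>s. exp (- (1 / gap_const) * s)) \<longlongrightarrow> 0) at_top"
        by (rule filterlim_compose[OF exp_at_bot])
    qed
    then have "((\<lambda>s. \<langle>T s g, u\<rangle>) \<longlongrightarrow> 0) at_top"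
    proof (rule Lim_null_comparison[rotated, OF tendsto_eq_rhs])
      show "\<forall>\<^sub>F s in at_top. norm \<langle>T s g, u\<rangle> \<le> H.nrm u * (sqrt gap_const * (exp (- (1 / gap_const) * s) * Q.nrm g))"
        using eventually_gt_at_top[of 0]
      proof eventually_elim
        case (elim s)
        have T: "T s g \<in> D" "mean (T s g) = 0" "Q.nrm (T s g) \<le> exp (- (1 / gap_const) * s) * Q.nrm g"
          using T_D_decay[OF D(1), of s] elim mean by (auto simp: mean_T D)
        have "\<bar>\<langle>T s g, u\<rangle>\<bar> \<le> H.nrm (T s g) * H.nrm u"
          by (intro H.cauchy_schwarz D_H T u)
        also have "\<dots> \<le> (sqrt gap_const * Q.nrm (T s g)) * H.nrm u"
          by (intro mult_right_mono poincare T H.nrm_ge_0 D)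
        also have "\<dots> \<le> (sqrt gap_const * (exp (- (1 / gap_const) * s) * Q.nrm g)) * H.nrm u"
          using gap_const_pos by (intro mult_right_mono mult_left_mono T H.nrm_ge_0 D) auto
        finally show ?case by (simp add: mult_ac)
      qed
    qed simp
    then show "(((\<lambda>s. - \<langle>T s g, u\<rangle>) \<circ> real_of_ereal) \<longlongrightarrow> 0) (at_left \<infinity>)"
      using tendsto_minus by (fastforce simp: ereal_tendsto_simps)
  qed simp
  finally show "(LBINT s:{0<..}. Qform b u (T s g)) = \<langle>u, g\<rangle>"
    by (simp add: H.sym[OF D(4,2)])
qed

text \<open>Dominated convergence along \<open>lap_dense\<close>; needed because it is applied to
  centred indicators, which may lie outside the domain of \<open>L\<close>.\<close>

theorem integral_Q_T:
  assumes u: "u \<in> D" and f: "f \<in> D" and mean: "mean f = 0"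
  shows "set_integrable lborel {0<..} (\<lambda>s. Qform b u (T s f))"
    and "(LBINT s:{0<..}. Qform b u (T s f)) = \<langle>u, f\<rangle>"
proof -
  obtain s r where s: "\<And>n::nat. lap (s n) (r n)" "\<And>n. mean (s n) = mean f"
    "(\<lambda>n. Q.nrm (\<lambda>x. s n x - f x)) \<longlonglongrightarrow> 0"
    using lap_dense[OF f] by metis
  have sD: "s n \<in> D" for n using s(1)[of n] by (simp add: lap_iff)
  note int = integral_Q_T_lap[OF u s(1), unfolded s(2), OF mean]
  let ?F = "\<lambda>n t. indicator {0<..} t *\<^sub>R Qform b u (T t (s n))"
  let ?G = "\<lambda>t. indicator {0<..} t *\<^sub>R Qform b u (T t f)"
  have lim: "(\<lambda>n. ?F n t) \<longlonglongrightarrow> ?G t" for t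
  proof (cases "0 < t")
    case True
    have "(\<lambda>n. Qform b u (T t (s n))) \<longlonglongrightarrow> Qform b u (T t f)"
    proof (rule LIM_zero_cancel, rule Lim_null_comparison)
      show "(\<lambda>n. Q.nrm u * Q.nrm (\<lambda>x. s n x - f x)) \<longlonglongrightarrow> 0"
        by (rule tendsto_mult_right_zero[OF s(3)])
      show "\<forall>\<^sub>F n in sequentially. norm (Qform b u (T t (s n)) - Qform b u (T t f)) \<le> Q.nrm u * Q.nrm (\<lambda>x. s n x - f x)"
      proof (intro always_eventually allI)
        fix n
        have T: "T t (s n) \<in> D" "T t f \<in> D" using T_D_decay(1)[of _ t] sD f True by auto
        have d: "(\<lambda>x. s n x - f x) \<in> D" by (intro Q.diff_mem sD f)
        have "T t (\<lambda>x. s n x - f x) = (\<lambda>x. T t (s n) x - T t f x)"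
          using True sD f by (simp add: T_diff D_H)
        then have "norm (Qform b u (T t (s n)) - Qform b u (T t f)) = \<bar>Qform b u (T t (\<lambda>x. s n x - f x))\<bar>"
          using T u by (simp add: Q.diff_right)
        also have "\<dots> \<le> Q.nrm u * Q.nrm (T t (\<lambda>x. s n x - f x))"
          using T_D_decay(1)[OF d, of t] True by (intro Q.cauchy_schwarz u) auto
        also have "\<dots> \<le> Q.nrm u * Q.nrm (\<lambda>x. s n x - f x)"
          using T_Q_contr[OF d, of t] True by (intro mult_left_mono Q.nrm_ge_0 u) auto
        finally show "norm (Qform b u (T t (s n)) - Qform b u (T t f)) \<le> Q.nrm u * Q.nrm (\<lambda>x. s n x - f x)" .
      qed
    qed
    then show ?thesis by (intro tendsto_intros)
  qed simp
  have F: "?F n \<in> borel_measurable lborel" for n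
    using int(1)[of n] by (auto simp: set_integrable_def)
  have G: "?G \<in> borel_measurable lborel"
    by (rule borel_measurable_LIMSEQ_real[OF lim F])
  \<comment> \<open>Convergent energies are bounded, which yields a single dominating exponential
    for all \<open>n\<close>.\<close>
  have "Bseq (\<lambda>n. Q.nrm (s n))"
    using Q.tendsto_nrm[OF sD f s(3)] by (auto intro!: convergent_imp_Bseq simp: convergent_def)
  then obtain K where K': "0 < K" "\<forall>n. norm (Q.nrm (s n)) \<le> K" by (auto elim!: BseqE)
  have K: "Q.nrm (s n) \<le> K" for n using spec[OF K'(2), of n] by simp
  let ?w = "\<lambda>t. indicator {0<..} t *\<^sub>R ((Q.nrm u * K) * exp (- (1 / gap_const) * t))"
  have "set_integrable lborel {0<..} (\<lambda>t. (Q.nrm u * K) * exp (- (1 / gap_const) * t))"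
    using set_integrable_exp_minus[of "1 / gap_const"] gap_const_pos by (intro set_integrable_mult_right) simp
  then have w: "integrable lborel ?w" by (simp add: set_integrable_def)
  have bound: "norm (?F n t) \<le> ?w t" for n t
  proof (cases "0 < t")
    case True
    have "\<bar>Qform b u (T t (s n))\<bar> \<le> Q.nrm u * Q.nrm (T t (s n))"
      using T_D_decay(1)[OF sD, of t n] True by (intro Q.cauchy_schwarz u) auto
    also have "\<dots> \<le> Q.nrm u * (exp (- (1 / gap_const) * t) * K)"
      using order_trans[OF T_D_decay(2)[OF sD[of n], of t] mult_left_mono[OF K]] True
      by (intro mult_left_mono Q.nrm_ge_0 u) auto
    finally show ?thesis using True by (simp add: mult_ac)
  qed simp
  have "integrable lborel ?G"
    by (rule integrable_dominated_convergence[where s = ?F, OF G F w]) (use lim bound in auto)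
  then show "set_integrable lborel {0<..} (\<lambda>s. Qform b u (T s f))" by (simp add: set_integrable_def)
  have 1: "(\<lambda>n. integral\<^sup>L lborel (?F n)) \<longlonglongrightarrow> integral\<^sup>L lborel ?G"
    by (rule integral_dominated_convergence[OF G F w]) (use lim bound in auto)
  have "(\<lambda>n. \<langle>s n, u\<rangle>) \<longlonglongrightarrow> \<langle>f, u\<rangle>"
  proof (rule H.tendsto_B_left)
    show "(\<lambda>n. H.nrm (\<lambda>x. s n x - f x)) \<longlonglongrightarrow> 0"
    proof (rule Lim_null_comparison)
      show "(\<lambda>n. sqrt gap_const * Q.nrm (\<lambda>x. s n x - f x)) \<longlonglongrightarrow> 0"
        by (rule tendsto_mult_right_zero[OF s(3)])
      have "norm (H.nrm (\<lambda>x. s n x - f x)) \<le> sqrt gap_const * Q.nrm (\<lambda>x. s n x - f x)" for n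
        using poincare[of "\<lambda>x. s n x - f x"] H.nrm_ge_0[of "\<lambda>x. s n x - f x"] sD[of n] f s(2)[of n]
        by (simp add: Q.diff_mem mean_diff D_H)
      then show "\<forall>\<^sub>F n in sequentially. norm (H.nrm (\<lambda>x. s n x - f x)) \<le> sqrt gap_const * Q.nrm (\<lambda>x. s n x - f x)"
        by simp
    qed
  qed (use sD f u in \<open>auto simp: D_H\<close>)
  moreover have "\<langle>s n, u\<rangle> = integral\<^sup>L lborel (?F n)" for n
    using int(2)[of n] H.sym[OF D_H[OF u] D_H[OF sD[of n]]] by (simp add: set_lebesgue_integral_def)
  ultimately have "integral\<^sup>L lborel ?G = \<langle>f, u\<rangle>"
    using LIMSEQ_unique[OF 1] by simp
  then show "(LBINT s:{0<..}. Qform b u (T s f)) = \<langle>u, f\<rangle>"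
    using H.sym[OF D_H[OF u] D_H[OF f]] by (simp add: set_lebesgue_integral_def)
qed

end

section \<open>Royden boundary and Neumann problem\<close>

locale royden_graph = weighted_graph b m
  for b :: "'x::countable \<Rightarrow> 'x \<Rightarrow> real" and m :: "'x \<Rightarrow> real" +
  fixes \<iota> :: "'x \<Rightarrow> 'r::t2_space"
  assumes compactification: "royden_compactification b \<iota>"
begin

abbreviation "bd \<equiv> royden_boundary \<iota>"
abbreviation "ext \<equiv> royden_ext \<iota>"

lemma compact_R: "compact (UNIV :: 'r set)" and inj_iota: "inj \<iota>" and open_range: "open (range \<iota>)"
  and dense: "closure (range \<iota>) = UNIV"
  and extension: "f \<in> D \<Longrightarrow> \<exists>!F. continuous_extension \<iota> f F"
  using compactification by (simp_all add: royden_compactification_def)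

lemma closed_contains: "closed S \<Longrightarrow> range \<iota> \<subseteq> S \<Longrightarrow> y \<in> S"
  using closure_minimal[of "range \<iota>" S] dense by auto

lemma extension_unique:
  assumes "continuous_on UNIV F" "continuous_on UNIV G" "\<And>x. F (\<iota> x) = G (\<iota> x)"
  shows "F y = (G y :: real)"
  using closed_contains[OF closed_Collect_eq[OF assms(1,2)], of y] assms(3) by auto

text \<open>The transfer principle for boundary estimates: bounds uniform over the vertices survive
  passage to the closure.\<close>

lemma extension_bound:
  fixes F :: "'r \<Rightarrow> real"
  assumes "continuous_on UNIV F" "\<And>x. \<bar>F (\<iota> x)\<bar> \<le> c"
  shows "\<bar>F y\<bar> \<le> c"
proof -
  have "closed {y. \<bar>F y\<bar> \<le> c}"
    by (intro closed_Collect_le continuous_on_rabs assms continuous_on_const)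
  from closed_contains[OF this, of y] assms(2) show ?thesis by auto
qed

lemma ext_cont: "f \<in> D \<Longrightarrow> continuous_on UNIV (ext f)"
  and ext_eq: "f \<in> D \<Longrightarrow> ext f (\<iota> x) = f x"
  using theI'[OF extension, of f] unfolding royden_ext_def continuous_extension_def by auto

lemma ext_unique:
  assumes "f \<in> D" "continuous_on UNIV F" "\<And>x. F (\<iota> x) = f x"
  shows "ext f y = F y"
  by (rule extension_unique[OF ext_cont[OF assms(1)] assms(2)]) (simp add: ext_eq assms)

lemma ext_lin:
  assumes "u \<in> D" "v \<in> D"
  shows "ext (\<lambda>x. c * u x + d * v x) y = c * ext u y + d * ext v y"
  by (rule ext_unique) (auto simp: D_lin assms ext_eq intro!: continuous_intros ext_cont)

text \<open>The zero set of the extension together with \<open>\<iota> z\<close> is closed and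
  contains all vertices, hence is everything.\<close>

lemma ext_indicator_boundary:
  assumes "y \<in> bd"
  shows "ext (indicator {z}) y = 0"
proof -
  have D: "indicator {z} \<in> D" using Q_indicator(1)[OF const_D[of 0]] .
  have "closed ({y. ext (indicator {z}) y = 0} \<union> {\<iota> z})"
    by (intro closed_Un closed_Collect_eq ext_cont D continuous_on_const) auto
  moreover have "ext (indicator {z}) (\<iota> x) = 0 \<or> \<iota> x = \<iota> z" for x
    by (cases "x = z") (simp_all add: ext_eq[OF D])
  ultimately have "y \<in> {y. ext (indicator {z}) y = 0} \<union> {\<iota> z}"
    by (intro closed_contains) auto
  then show ?thesis using assms by (auto simp: royden_boundary_def)
qed

lemma closed_boundary: "closed bd"
  unfolding royden_boundary_def using open_range by (simp add: closed_def double_complement Compl_eq_Diff_UNIV[symmetric])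

lemma compact_boundary: "compact bd"
  using compact_Int_closed[OF compact_R closed_boundary] by simp

end

locale neumann_problem = royden_graph b m \<iota>
  for b :: "'x::countable \<Rightarrow> 'x \<Rightarrow> real" and m :: "'x \<Rightarrow> real" and \<iota> :: "'x \<Rightarrow> 'r::t2_space" +
  fixes \<mu> :: "'r measure" and \<phi> :: "'r \<Rightarrow> real"
  assumes radon: "radon_measure_on (royden_boundary \<iota>) \<mu>"
    and phi_borel: "\<phi> \<in> borel_measurable (restrict_space borel (royden_boundary \<iota>))"
    and phi_bounded: "bounded (\<phi> ` royden_boundary \<iota>)"
    and phi_integral: "(\<integral>y. \<phi> y \<partial>\<mu>) = 0"
begin

lemma sets_mu: "sets \<mu> = sets (restrict_space borel bd)"
  using radon by (simp add: radon_measure_on_def)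

lemma space_mu: "space \<mu> = bd"
  using sets_eq_imp_space_eq[OF sets_mu] by (simp add: space_restrict_space)

text \<open>The boundary is closed in a compact space, hence compact, and Radon measures are finite
  on compact sets.\<close>

sublocale mu: finite_measure \<mu>
proof
  have "emeasure \<mu> bd < \<infinity>"
    using radon compact_boundary unfolding radon_measure_on_def by blast
  then show "emeasure \<mu> (space \<mu>) \<noteq> \<infinity>" by (simp add: space_mu)
qed

lemma phi_measurable [measurable]: "\<phi> \<in> borel_measurable \<mu>"
  using phi_borel measurable_cong_sets[OF sets_mu refl] by blast

lemma continuous_measurable:
  fixes F :: "'r \<Rightarrow> real"
  assumes "continuous_on UNIV F"
  shows "F \<in> borel_measurable \<mu>"
  using measurable_restrict_space1[OF borel_measurable_continuous_onI[OF assms], of bd]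
    measurable_cong_sets[OF sets_mu refl] by blast

definition phi_sup :: real where "phi_sup = (SOME c. 0 \<le> c \<and> (\<forall>y\<in>bd. \<bar>\<phi> y\<bar> \<le> c))"

lemma phi_sup_nonneg: "0 \<le> phi_sup" and phi_le: "y \<in> bd \<Longrightarrow> \<bar>\<phi> y\<bar> \<le> phi_sup"
proof -
  obtain c where "\<forall>y\<in>bd. \<bar>\<phi> y\<bar> \<le> c" using phi_bounded by (auto simp: bounded_iff)
  then have "0 \<le> max c 0 \<and> (\<forall>y\<in>bd. \<bar>\<phi> y\<bar> \<le> max c 0)" by (auto intro: order_trans)
  then have "0 \<le> phi_sup \<and> (\<forall>y\<in>bd. \<bar>\<phi> y\<bar> \<le> phi_sup)"
    unfolding phi_sup_def by (rule someI)
  then show "0 \<le> phi_sup" "y \<in> bd \<Longrightarrow> \<bar>\<phi> y\<bar> \<le> phi_sup" by auto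
qed

lemma phi_mult_integrable:
  fixes F :: "'r \<Rightarrow> real"
  assumes "F \<in> borel_measurable \<mu>" "\<And>y. y \<in> bd \<Longrightarrow> \<bar>F y\<bar> \<le> c"
  shows "integrable \<mu> (\<lambda>y. \<phi> y * F y)" and "\<bar>\<integral>y. \<phi> y * F y \<partial>\<mu>\<bar> \<le> phi_sup * c * measure \<mu> bd"
proof -
  have b: "norm (\<phi> y * F y) \<le> phi_sup * c" if "y \<in> bd" for y
    using mult_mono[OF phi_le[OF that] assms(2)[OF that]] phi_sup_nonneg by (simp add: abs_mult)
  show i: "integrable \<mu> (\<lambda>y. \<phi> y * F y)"
    by (rule mu.integrable_const_bound[where B = "phi_sup * c"])
      (use assms b in \<open>auto simp: space_mu\<close>)
  have "\<bar>\<integral>y. \<phi> y * F y \<partial>\<mu>\<bar> \<le> (\<integral>y. norm (\<phi> y * F y) \<partial>\<mu>)"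
    using integral_norm_bound[of \<mu> "\<lambda>y. \<phi> y * F y"] by simp
  also have "\<dots> \<le> (\<integral>y. phi_sup * c \<partial>\<mu>)"
    by (rule integral_mono) (use i b in \<open>auto simp: space_mu\<close>)
  finally show "\<bar>\<integral>y. \<phi> y * F y \<partial>\<mu>\<bar> \<le> phi_sup * c * measure \<mu> bd"
    by (simp add: space_mu mult_ac)
qed

lemma phi_integrable: "integrable \<mu> \<phi>"
  using phi_mult_integrable(1)[of "\<lambda>_. 1" 1] by simp

lemma continuous_bounded:
  fixes F :: "'r \<Rightarrow> real"
  assumes "continuous_on UNIV F"
  shows "\<exists>c. \<forall>y. \<bar>F y\<bar> \<le> c"
  using compact_imp_bounded[OF compact_continuous_image[OF assms compact_R]] by (auto simp: bounded_iff)

lemma phi_continuous_integrable: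
  fixes F :: "'r \<Rightarrow> real"
  assumes "continuous_on UNIV F"
  shows "integrable \<mu> (\<lambda>y. \<phi> y * F y)"
  using continuous_bounded[OF assms] phi_mult_integrable(1)[OF continuous_measurable[OF assms]] by blast

definition flux :: "('x \<Rightarrow> real) \<Rightarrow> real" where "flux v = (\<integral>y. \<phi> y * ext v y \<partial>\<mu>)"

lemma flux_lin:
  assumes "u \<in> D" "v \<in> D"
  shows "flux (\<lambda>x. c * u x + d * v x) = c * flux u + d * flux v"
proof -
  have "flux (\<lambda>x. c * u x + d * v x) = (\<integral>y. c * (\<phi> y * ext u y) + d * (\<phi> y * ext v y) \<partial>\<mu>)"
    unfolding flux_def by (simp add: ext_lin assms algebra_simps)
  also have "\<dots> = c * flux u + d * flux v"
    unfolding flux_def using phi_continuous_integrable[OF ext_cont] assms by simp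
  finally show ?thesis .
qed

text \<open>As \<phi> integrates to 0, a value \<open>v z\<close> can be subtracted; the oscillation
  bound then extends from vertices to the boundary.\<close>

lemma flux_bound:
  assumes v: "v \<in> D"
  shows "\<bar>flux v\<bar> \<le> (phi_sup * sqrt osc_const * measure \<mu> bd) * Q.nrm v"
proof -
  fix z :: 'x
  have "flux v = (\<integral>y. \<phi> y * ext v y - v z * \<phi> y \<partial>\<mu>)"
    unfolding flux_def using phi_continuous_integrable[OF ext_cont[OF v]] phi_integrable phi_integral by simp
  also have "\<dots> = (\<integral>y. \<phi> y * (ext v y - v z) \<partial>\<mu>)" by (simp add: algebra_simps)
  also have "\<bar>\<dots>\<bar> \<le> phi_sup * (sqrt osc_const * Q.nrm v) * measure \<mu> bd"
  proof (rule phi_mult_integrable(2))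
    have c: "continuous_on UNIV (\<lambda>y. ext v y - v z)" by (intro continuous_intros ext_cont v)
    show "(\<lambda>y. ext v y - v z) \<in> borel_measurable \<mu>" by (rule continuous_measurable[OF c])
    show "\<bar>ext v y - v z\<bar> \<le> sqrt osc_const * Q.nrm v" for y
      by (rule extension_bound[OF c]) (simp add: ext_eq v osc_bound_nrm)
  qed
  finally show ?thesis by (simp add: mult_ac)
qed

text \<open>Weak formulation. In the backward direction, indicators as test functions have zero flux
  and thus force harmonicity.\<close>

lemma neumann_solution_iff:
  "neumann_solution b m \<iota> \<mu> \<phi> u \<longleftrightarrow> u \<in> D \<and> (\<forall>v\<in>D. Qform b u v = flux v)"
proof
  assume n: "neumann_solution b m \<iota> \<mu> \<phi> u"
  then have "formal_laplacian b m u = (\<lambda>_. 0)" by (auto simp: neumann_solution_def)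
  with n show "u \<in> D \<and> (\<forall>v\<in>D. Qform b u v = flux v)"
    by (auto simp: neumann_solution_def normal_derivative_def form_domain_eq flux_def ell2_inner_def)
next
  assume u: "u \<in> D \<and> (\<forall>v\<in>D. Qform b u v = flux v)"
  have "flux (indicator {z}) = (\<integral>y. 0 \<partial>\<mu>)" for z
    unfolding flux_def by (rule Bochner_Integration.integral_cong) (auto simp: space_mu ext_indicator_boundary)
  then have "m z * formal_laplacian b m u z = 0" for z
    using Q_indicator(1,2)[of u z] u by simp
  then have l: "formal_laplacian b m u = (\<lambda>_. 0)" using m_pos by (metis less_irrefl mult_eq_0_iff)
  have "integrable \<mu> (\<lambda>y. \<phi> y * \<phi> y)"
    by (rule phi_mult_integrable(1)[OF phi_measurable phi_le])
  then show "neumann_solution b m \<iota> \<mu> \<phi> u"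
    using u Q_indicator(3)[of u]
    by (auto simp: neumann_solution_def normal_derivative_def form_domain_eq flux_def[symmetric] l
      const_H ell2_inner_def power2_eq_square)
qed

lemma solution_exists_unique:
  "\<exists>!u. neumann_solution b m \<iota> \<mu> \<phi> u \<and> ((\<lambda>x. u x * m x) has_sum 0) UNIV"
proof -
  obtain g where g: "g \<in> D" "mean g = 0" "\<And>v. v \<in> D \<Longrightarrow> Qform b g v = flux v"
    using Q_riesz[of flux, OF flux_lin flux_bound] by blast
  show ?thesis
  proof (rule ex1I[of _ g])
    show "neumann_solution b m \<iota> \<mu> \<phi> g \<and> ((\<lambda>x. g x * m x) has_sum 0) UNIV"
      using g mean_eq_0_iff[of g] by (auto simp: neumann_solution_iff D_H)
    fix u assume "neumann_solution b m \<iota> \<mu> \<phi> u \<and> ((\<lambda>x. u x * m x) has_sum 0) UNIV"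
    then have u: "u \<in> D" "mean u = 0" "\<And>v. v \<in> D \<Longrightarrow> Qform b u v = flux v"
      using mean_eq_0_iff[of u] by (auto simp: neumann_solution_iff D_H)
    \<comment> \<open>Tested against itself, the difference of two solutions has zero energy; its
      mean zero then excludes nonzero constants.\<close>
    let ?d = "\<lambda>x. u x - g x"
    have d: "?d \<in> D" "mean ?d = 0" using u g by (auto simp: Q.diff_mem mean_diff D_H)
    have "Qform b ?d ?d = 0" using u g d(1) by (simp add: Q.diff_left)
    then have "\<bar>?d x\<bar> \<le> 0" for x using mean_0_bound[OF d, of x] by (simp add: Q.nrm_def)
    then show "u = g" by (auto simp: fun_eq_iff)
  qed
qed

end

locale neumann_heat = neumann_problem b m \<iota> \<mu> \<phi> + heat b m T
  for b :: "'x::countable \<Rightarrow> 'x \<Rightarrow> real" and m :: "'x \<Rightarrow> real" and \<iota> :: "'x \<Rightarrow> 'r::t2_space"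
    and \<mu> :: "'r measure" and \<phi> :: "'r \<Rightarrow> real"
    and T :: "real \<Rightarrow> ('x \<Rightarrow> real) \<Rightarrow> 'x \<Rightarrow> real" +
  fixes p :: "real \<Rightarrow> 'r \<Rightarrow> 'r \<Rightarrow> real" and u :: "'x \<Rightarrow> real"
  assumes kernel: "heat_kernel_ext m \<iota> T p"
    and solution: "neumann_solution b m \<iota> \<mu> \<phi> u"
    and normalized: "((\<lambda>x. u x * m x) has_sum 0) UNIV"
begin

lemma u_D: "u \<in> D" and u_flux: "v \<in> D \<Longrightarrow> Qform b u v = flux v" and mean_u: "mean u = 0"
  using solution normalized mean_eq_0_iff[of u] by (auto simp: neumann_solution_iff D_H)

lemma p_cont2: "0 < t \<Longrightarrow> continuous_on UNIV (\<lambda>(y, z). p t y z)"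
  and p_vertex: "0 < t \<Longrightarrow> p t (\<iota> x) (\<iota> y) = T t (indicator {y}) x / m y"
  using kernel by (auto simp: heat_kernel_ext_def heat_kernel_def)

lemma p_cont:
  assumes "0 < t"
  shows "continuous_on UNIV (p t y)" and "continuous_on UNIV (\<lambda>y. p t y z)"
proof -
  show "continuous_on UNIV (p t y)"
    using continuous_on_compose2[OF p_cont2[OF assms], of UNIV "\<lambda>z. (y, z)"]
    by (simp add: continuous_on_Pair)
  show "continuous_on UNIV (\<lambda>y. p t y z)"
    using continuous_on_compose2[OF p_cont2[OF assms], of UNIV "\<lambda>y. (y, z)"]
    by (simp add: continuous_on_Pair)
qed

text \<open>Symmetry of \<open>T t\<close> moves the indicator to the fixed vertex \<open>x\<close>;
  in its second variable the kernel is then an orbit of the semigroup.\<close>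

lemma p_vertex_sym:
  assumes "0 < t"
  shows "p t (\<iota> x) (\<iota> y) = T t (indicator {x}) y / m x"
proof -
  have "\<langle>T t (indicator {y}), indicator {x}\<rangle> = \<langle>T t (indicator {x}), indicator {y}\<rangle>"
    using T_sym[of t "indicator {y}" "indicator {x}"] H.sym[OF indicator_H T_H[OF _ indicator_H], of t y x] assms
    by (simp add: indicator_H)
  then show ?thesis
    using m_pos[of x] m_pos[of y] by (simp add: p_vertex[OF assms] ip_indicator field_simps)
qed

lemma p_sym:
  assumes "0 < t"
  shows "p t y (\<iota> x) = p t (\<iota> x) y"
  by (rule extension_unique[OF p_cont(2)[OF assms] p_cont(1)[OF assms]])
    (simp only: p_vertex[OF assms, of _ x] p_vertex_sym[OF assms, of x])

section \<open>Decay and time regularity of the heat kernel\<close>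

definition delta :: "'x \<Rightarrow> 'x \<Rightarrow> real" where "delta x = (\<lambda>z. indicator {x} z - m x / mass)"

lemma delta_D: "delta x \<in> D" and mean_delta: "mean (delta x) = 0"
  using Q_indicator(1)[OF const_D[of 0], of x]
  by (auto simp: delta_def Q.diff_mem const_D mean_diff D_H const_H mean_const mean_indicator)

lemma p_delta:
  assumes "0 < t"
  shows "p t (\<iota> x) (\<iota> y) - 1 / mass = T t (delta x) y / m x"
proof -
  have "T t (delta x) = (\<lambda>y. 1 * T t (indicator {x}) y + (- (m x / mass)) * T t (\<lambda>_. 1) y)"
    unfolding delta_def using assms T_lin[of t "indicator {x}" "\<lambda>_. 1" 1 "- (m x / mass)"]
    by (simp add: indicator_H const_H)
  then show ?thesis
    using assms m_pos[of x] mass_pos by (simp add: p_vertex_sym T_one field_simps)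
qed

text \<open>Identifies the boundary values of the centred kernel as those of an admissible test
  function for the Neumann problem.\<close>

lemma p_delta_ext:
  assumes "0 < t"
  shows "m x * (p t (\<iota> x) y - 1 / mass) = ext (T t (delta x)) y"
proof -
  have "T t (delta x) \<in> D" using T_D_decay(1)[OF delta_D, of t x] assms by simp
  from ext_unique[OF this, of "\<lambda>y. m x * (p t (\<iota> x) y - 1 / mass)" y] show ?thesis
    using m_pos[of x] p_cont(1)[OF assms] by (simp add: p_delta[OF assms] continuous_intros)
qed

definition rate :: real where "rate = 1 / gap_const"
definition amp :: "'x \<Rightarrow> real" where "amp x = sqrt osc_const * Q.nrm (delta x) / m x"

lemma rate_pos: "0 < rate" and amp_nonneg: "0 \<le> amp x"
  using gap_const_pos osc_const_pos m_pos[of x] Q.nrm_ge_0[OF delta_D]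
  by (auto simp: rate_def amp_def)

text \<open>At vertices, combine the sup bound for mean zero functions with energy decay; being
  uniform, the estimate reaches all boundary points.\<close>

lemma p_decay:
  assumes "0 < t"
  shows "\<bar>p t (\<iota> x) y - 1 / mass\<bar> \<le> amp x * exp (- rate * t)"
proof (rule extension_bound)
  show "continuous_on UNIV (\<lambda>y. p t (\<iota> x) y - 1 / mass)"
    by (intro continuous_intros p_cont assms)
  fix z
  have "\<bar>T t (delta x) z\<bar> \<le> sqrt osc_const * Q.nrm (T t (delta x))"
    using assms T_D_decay(1)[OF delta_D, of t x] by (intro mean_0_bound) (auto simp: mean_T D_H delta_D mean_delta)
  also have "\<dots> \<le> sqrt osc_const * (exp (- rate * t) * Q.nrm (delta x))"
    using T_D_decay(2)[OF delta_D, of t x] assms osc_const_pos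
    by (intro mult_left_mono) (auto simp: rate_def)
  finally have "\<bar>T t (delta x) z\<bar> / m x \<le> sqrt osc_const * (exp (- rate * t) * Q.nrm (delta x)) / m x"
    using m_pos[of x] by (intro divide_right_mono) auto
  then show "\<bar>p t (\<iota> x) (\<iota> z) - 1 / mass\<bar> \<le> amp x * exp (- rate * t)"
    using m_pos[of x] by (simp add: p_delta[OF assms] amp_def mult_ac)
qed

text \<open>Regularity in time at boundary points comes from \<open>T_osc_bound\<close>, which is
  uniform over vertices. One-sided limits are all that the discretization of time below
  uses.\<close>

lemma p_right_continuous:
  assumes t: "0 < t" and s: "s \<longlonglongrightarrow> t" "\<And>n::nat. t < s n"
  shows "(\<lambda>n. p (s n) (\<iota> x) y) \<longlonglongrightarrow> p t (\<iota> x) y"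
proof (rule LIM_zero_cancel, rule Lim_null_comparison)
  have "filterlim (\<lambda>n. s n - t) (at_right 0) sequentially"
    using s tendsto_diff[OF s(1) tendsto_const[of t]]
    by (auto simp: filterlim_at intro!: always_eventually)
  from filterlim_compose[OF T_Q_small_time[OF delta_D] this]
  have "(\<lambda>n. Q.nrm (\<lambda>z. T (s n - t) (delta x) z - delta x z)) \<longlonglongrightarrow> 0" .
  from tendsto_mult_right_zero[OF this, of "sqrt osc_const / m x"]
  show "(\<lambda>n. sqrt osc_const / m x * Q.nrm (\<lambda>z. T (s n - t) (delta x) z - delta x z)) \<longlonglongrightarrow> 0" .
  show "\<forall>\<^sub>F n in sequentially. norm (p (s n) (\<iota> x) y - p t (\<iota> x) y)
      \<le> sqrt osc_const / m x * Q.nrm (\<lambda>z. T (s n - t) (delta x) z - delta x z)"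
  proof (intro always_eventually allI)
    fix n
    have sn: "0 < s n" using t s(2)[of n] by simp
    have "\<bar>p (s n) (\<iota> x) y - p t (\<iota> x) y\<bar>
        \<le> sqrt osc_const / m x * Q.nrm (\<lambda>z. T (s n - t) (delta x) z - delta x z)"
    proof (rule extension_bound)
      show "continuous_on UNIV (\<lambda>y. p (s n) (\<iota> x) y - p t (\<iota> x) y)"
        by (intro continuous_intros p_cont t sn)
      fix z
      have "p (s n) (\<iota> x) (\<iota> z) - p t (\<iota> x) (\<iota> z) = (T (s n) (delta x) z - T t (delta x) z) / m x"
        using p_delta[OF sn, of x z] p_delta[OF t, of x z] by (simp add: diff_divide_distrib)
      moreover have "\<bar>T (s n) (delta x) z - T t (delta x) z\<bar>
          \<le> sqrt osc_const * Q.nrm (\<lambda>z. T (s n - t) (delta x) z - delta x z)"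
        using t s(2)[of n] by (intro T_osc_bound delta_D mean_delta) auto
      ultimately show "\<bar>p (s n) (\<iota> x) (\<iota> z) - p t (\<iota> x) (\<iota> z)\<bar>
          \<le> sqrt osc_const / m x * Q.nrm (\<lambda>z. T (s n - t) (delta x) z - delta x z)"
        using m_pos[of x] by (simp add: divide_right_mono)
    qed
    then show "norm (p (s n) (\<iota> x) y - p t (\<iota> x) y)
        \<le> sqrt osc_const / m x * Q.nrm (\<lambda>z. T (s n - t) (delta x) z - delta x z)" by simp
  qed
qed

text \<open>Zero integral of \<phi> permits centring the kernel; the weak formulation with test
  function \<open>T t (delta x)\<close> then gives the energy pairing.\<close>

lemma phi_p_integral:
  assumes "0 < t"
  shows "integrable \<mu> (\<lambda>y. \<phi> y * p t (\<iota> x) y)"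
    and "(\<integral>y. \<phi> y * (p t (\<iota> x) y - 1 / mass) \<partial>\<mu>) = (\<integral>y. \<phi> y * p t (\<iota> x) y \<partial>\<mu>)"
    and "(\<integral>y. \<phi> y * p t (\<iota> x) y \<partial>\<mu>) = Qform b u (T t (delta x)) / m x"
proof -
  show i: "integrable \<mu> (\<lambda>y. \<phi> y * p t (\<iota> x) y)"
    by (rule phi_continuous_integrable[OF p_cont(1)[OF assms]])
  have "(\<integral>y. \<phi> y * (p t (\<iota> x) y - 1 / mass) \<partial>\<mu>) = (\<integral>y. \<phi> y * p t (\<iota> x) y - (1 / mass) * \<phi> y \<partial>\<mu>)"
    by (simp add: algebra_simps)
  also have "\<dots> = (\<integral>y. \<phi> y * p t (\<iota> x) y \<partial>\<mu>)"
    using i phi_integrable phi_integral by simp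
  finally show e: "(\<integral>y. \<phi> y * (p t (\<iota> x) y - 1 / mass) \<partial>\<mu>) = (\<integral>y. \<phi> y * p t (\<iota> x) y \<partial>\<mu>)" .
  have "T t (delta x) \<in> D" using T_D_decay(1)[OF delta_D, of t x] assms by simp
  then have "Qform b u (T t (delta x)) = flux (T t (delta x))" by (rule u_flux)
  also have "\<dots> = (\<integral>y. m x * (\<phi> y * (p t (\<iota> x) y - 1 / mass)) \<partial>\<mu>)"
    unfolding flux_def p_delta_ext[OF assms, symmetric] by (simp add: mult.left_commute)
  also have "\<dots> = m x * (\<integral>y. \<phi> y * p t (\<iota> x) y \<partial>\<mu>)" by (simp add: e)
  finally show "(\<integral>y. \<phi> y * p t (\<iota> x) y \<partial>\<mu>) = Qform b u (T t (delta x)) / m x"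
    using m_pos[of x] by simp
qed

text \<open>\<open>integral_Q_T\<close> evaluates the time integral to
  \<open>\<langle>u, delta x\<rangle>\<close>, where the centring term drops out because
  \<open>u\<close> has mean zero.\<close>

lemma heat_representation:
  "set_integrable lborel {0<..} (\<lambda>s. \<integral>y. \<phi> y * p s (\<iota> x) y \<partial>\<mu>)"
  "u x = (LBINT s:{0<..}. \<integral>y. \<phi> y * p s (\<iota> x) y \<partial>\<mu>)"
proof -
  note int = integral_Q_T[OF u_D delta_D mean_delta, of x]
  have "set_integrable lborel {0<..} (\<lambda>s. Qform b u (T s (delta x)) / m x)"
    using int(1) by (rule set_integrable_divide)
  then show "set_integrable lborel {0<..} (\<lambda>s. \<integral>y. \<phi> y * p s (\<iota> x) y \<partial>\<mu>)"
    by (rule set_integrable_cong[THEN iffD1, rotated -1]) (auto simp: phi_p_integral(3))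
  have "(LBINT s:{0<..}. \<integral>y. \<phi> y * p s (\<iota> x) y \<partial>\<mu>) = (LBINT s:{0<..}. Qform b u (T s (delta x)) / m x)"
    by (intro set_lebesgue_integral_cong) (auto simp: phi_p_integral(3))
  also have "\<dots> = \<langle>u, delta x\<rangle> / m x" by (simp add: int(2))
  also have "\<langle>u, delta x\<rangle> = u x * m x"
    unfolding delta_def using u_D mean_u
    by (simp add: H.diff_right D_H indicator_H const_H ip_indicator ip_const_right)
  finally show "u x = (LBINT s:{0<..}. \<integral>y. \<phi> y * p s (\<iota> x) y \<partial>\<mu>)"
    using m_pos[of x] by simp
qed

section \<open>Joint integrability and the Green kernel\<close>

definition excess :: "'x \<Rightarrow> real \<Rightarrow> 'r \<Rightarrow> real" where
  "excess x s y = indicator {0<..} s * (p s (\<iota> x) y - 1 / mass)"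

text \<open>The topology of the compactification need not be second countable, so measurability on the
  product is obtained from a discretization of time, using right continuity.\<close>

lemma excess_measurable: "(\<lambda>(s, y). excess x s y) \<in> borel_measurable (lborel \<Otimes>\<^sub>M \<mu>)"
proof (rule borel_measurable_LIMSEQ_real)
  \<comment> \<open>The right end of a grid cell of width 1/(n+1). The summand 1 puts the sampled
    time strictly after \<open>s\<close>, as \<open>p_right_continuous\<close> requires.\<close>
  define \<sigma> where "\<sigma> n i = (real_of_int i + 1) / real (Suc n)" for n i
  \<comment> \<open>The guard is needed since continuity of \<open>p\<close> in space is known at
    positive times only.\<close>
  define k where "k n i z = (if 0 < \<sigma> n i \<and> 0 < fst z then p (\<sigma> n i) (\<iota> x) (snd z) - 1 / mass else 0)"
    for n i and z :: "real \<times> 'r"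
  let ?g = "\<lambda>n z. k n \<lfloor>real (Suc n) * fst z\<rfloor> z"
  show "?g n \<in> borel_measurable (lborel \<Otimes>\<^sub>M \<mu>)" for n
  proof (rule measurable_compose_countable)
    show "k n i \<in> borel_measurable (lborel \<Otimes>\<^sub>M \<mu>)" for i
    proof (cases "0 < \<sigma> n i")
      case True
      have "(\<lambda>y. p (\<sigma> n i) (\<iota> x) y) \<in> borel_measurable \<mu>"
        by (rule continuous_measurable[OF p_cont(1)[OF True]])
      then have [measurable]: "(\<lambda>z. p (\<sigma> n i) (\<iota> x) (snd z)) \<in> borel_measurable (lborel \<Otimes>\<^sub>M \<mu>)"
        by (rule measurable_compose[OF measurable_snd])
      show ?thesis unfolding k_def by measurable
    qed (simp add: k_def[abs_def])
    show "(\<lambda>z. \<lfloor>real (Suc n) * fst z\<rfloor>) \<in> measurable (lborel \<Otimes>\<^sub>M \<mu>) (count_space UNIV)"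
      by measurable
  qed
  fix z :: "real \<times> 'r"
  obtain s y where z: "z = (s, y)" by force
  show "(\<lambda>n. ?g n z) \<longlonglongrightarrow> (case z of (s, y) \<Rightarrow> excess x s y)"
  proof (cases "0 < s")
    case True
    define r where "r n = \<sigma> n \<lfloor>real (Suc n) * s\<rfloor>" for n
    have bounds: "s < r n \<and> r n \<le> s + 1 / real (Suc n)" for n
    proof -
      have *: "s < (real_of_int \<lfloor>N * s\<rfloor> + 1) / N \<and> (real_of_int \<lfloor>N * s\<rfloor> + 1) / N \<le> s + 1 / N"
        if N: "0 < N" for N
      proof
        have l: "N * s < real_of_int \<lfloor>N * s\<rfloor> + 1" "real_of_int \<lfloor>N * s\<rfloor> + 1 \<le> N * s + 1" by linarith+
        show "s < (real_of_int \<lfloor>N * s\<rfloor> + 1) / N"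
          using l(1) N by (simp add: pos_less_divide_eq mult.commute)
        have "(real_of_int \<lfloor>N * s\<rfloor> + 1) / N \<le> (N * s + 1) / N"
          by (rule divide_right_mono[OF l(2)]) (use N in simp)
        then show "(real_of_int \<lfloor>N * s\<rfloor> + 1) / N \<le> s + 1 / N"
          using N by (simp add: add_divide_distrib)
      qed
      show ?thesis unfolding r_def \<sigma>_def by (rule *) simp
    qed
    have "r \<longlonglongrightarrow> s"
    proof (rule tendsto_sandwich[where f = "\<lambda>_. s" and h = "\<lambda>n. s + 1 / real (Suc n)"])
      show "\<forall>\<^sub>F n in sequentially. s \<le> r n" "\<forall>\<^sub>F n in sequentially. r n \<le> s + 1 / real (Suc n)"
        using bounds by (auto intro!: always_eventually less_imp_le)
      show "(\<lambda>n. s + 1 / real (Suc n)) \<longlonglongrightarrow> s"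
        using tendsto_add[OF tendsto_const LIMSEQ_inverse_real_of_nat, of s] by (simp add: inverse_eq_divide)
    qed simp
    then have "(\<lambda>n. p (r n) (\<iota> x) y - 1 / mass) \<longlonglongrightarrow> p s (\<iota> x) y - 1 / mass"
      using bounds by (intro tendsto_intros p_right_continuous True) auto
    moreover have "?g n z = p (r n) (\<iota> x) y - 1 / mass" for n
    proof -
      have "0 < r n" using bounds[of n] True by simp
      then show ?thesis using True by (simp add: z k_def r_def del: of_nat_Suc)
    qed
    ultimately show ?thesis using True by (simp add: z excess_def del: of_nat_Suc)
  qed (simp add: z k_def excess_def)
qed

lemma excess_bound: "\<bar>excess x s y\<bar> \<le> indicator {0<..} s * (amp x * exp (- rate * s))"
  using p_decay[of s x y] by (auto simp: excess_def indicator_def)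

lemma excess_section_measurable: "excess x s \<in> borel_measurable \<mu>"
proof (cases "0 < s")
  case True
  have "continuous_on UNIV (\<lambda>y. p s (\<iota> x) y - 1 / mass)" by (intro continuous_intros p_cont True)
  from continuous_measurable[OF this] show ?thesis using True by (simp add: excess_def[abs_def])
qed (simp add: excess_def[abs_def])

lemma phi_excess_integrable: "integrable (lborel \<Otimes>\<^sub>M \<mu>) (\<lambda>(s, y). \<phi> y * excess x s y)"
proof -
  interpret P: pair_sigma_finite lborel \<mu> ..
  have m1: "(\<lambda>(s, y). \<phi> y * excess x s y) \<in> borel_measurable (lborel \<Otimes>\<^sub>M \<mu>)"
  proof -
    note [measurable] = excess_measurable[of x, unfolded split_beta']
    show ?thesis unfolding split_beta' by measurable
  qed
  have sec: "integrable \<mu> (\<lambda>y. \<phi> y * excess x s y)" for s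
    by (rule phi_mult_integrable(1)[OF excess_section_measurable]) (rule excess_bound)
  show ?thesis
  proof (rule P.Fubini_integrable[OF m1])
    let ?c = "phi_sup * measure \<mu> bd * amp x"
    have "set_integrable lborel {0<..} (\<lambda>s. ?c * exp (- rate * s))"
      by (intro set_integrable_mult_right set_integrable_exp_minus rate_pos)
    then have i: "integrable lborel (\<lambda>s. indicator {0<..} s * (?c * exp (- rate * s)))"
      by (simp add: set_integrable_def)
    show "integrable lborel (\<lambda>s. \<integral>y. norm (case (s, y) of (s, y) \<Rightarrow> \<phi> y * excess x s y) \<partial>\<mu>)"
    proof (rule Bochner_Integration.integrable_bound[OF i])
      note [measurable] = m1
      show "(\<lambda>s. \<integral>y. norm (case (s, y) of (s, y) \<Rightarrow> \<phi> y * excess x s y) \<partial>\<mu>) \<in> borel_measurable lborel"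
        by measurable
      show "AE s in lborel. norm (\<integral>y. norm (case (s, y) of (s, y) \<Rightarrow> \<phi> y * excess x s y) \<partial>\<mu>)
          \<le> norm (indicator {0<..} s * (?c * exp (- rate * s)))"
      proof (rule AE_I2)
        fix s
        let ?e = "indicator {0<..} s * (amp x * exp (- rate * s))"
        have e: "0 \<le> ?e" by (simp add: amp_nonneg)
        have "(\<integral>y. norm (\<phi> y * excess x s y) \<partial>\<mu>) \<le> (\<integral>y. phi_sup * ?e \<partial>\<mu>)"
        proof (rule integral_mono)
          show "norm (\<phi> y * excess x s y) \<le> phi_sup * ?e" if "y \<in> space \<mu>" for y
            using mult_mono[OF phi_le excess_bound, of y x s y] that phi_sup_nonneg
            by (simp add: space_mu abs_mult)
        qed (use sec in auto)
        also have "\<dots> = indicator {0<..} s * (?c * exp (- rate * s))"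
          by (simp add: space_mu mult_ac)
        finally show "norm (\<integral>y. norm (case (s, y) of (s, y) \<Rightarrow> \<phi> y * excess x s y) \<partial>\<mu>)
            \<le> norm (indicator {0<..} s * (?c * exp (- rate * s)))"
          by (simp add: abs_of_nonneg[OF Bochner_Integration.integral_nonneg])
      qed
    qed
    show "AE s in lborel. integrable \<mu> (\<lambda>y. case (s, y) of (s, y) \<Rightarrow> \<phi> y * excess x s y)"
      using sec by simp
  qed
qed

text \<open>Fubini. The term \<open>1 / mass\<close>, which makes the time integral of the kernel
  converge, leaves the inner boundary integral unchanged by \<open>phi_p_integral\<close>.\<close>

lemma green_representation:
  "integrable \<mu> (\<lambda>y. \<phi> y * green_kernel m \<iota> p x y)"
  "u x = (\<integral>y. \<phi> y * green_kernel m \<iota> p x y \<partial>\<mu>)"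
proof -
  interpret P: pair_sigma_finite lborel \<mu> ..
  have g: "(\<integral>s. \<phi> y * excess x s y \<partial>lborel) = \<phi> y * green_kernel m \<iota> p x y" for y
    by (simp add: green_kernel_def set_lebesgue_integral_def excess_def mass_def)
  show "integrable \<mu> (\<lambda>y. \<phi> y * green_kernel m \<iota> p x y)"
    using P.integrable_snd[OF phi_excess_integrable[of x]] by (simp only: g)
  have "(\<integral>y. \<phi> y * green_kernel m \<iota> p x y \<partial>\<mu>) = (\<integral>s. (\<integral>y. \<phi> y * excess x s y \<partial>\<mu>) \<partial>lborel)"
    using P.Fubini_integral[OF phi_excess_integrable[of x]] by (simp only: g)
  moreover have "(\<integral>y. \<phi> y * excess x s y \<partial>\<mu>) = indicator {0<..} s *\<^sub>R (\<integral>y. \<phi> y * p s (\<iota> x) y \<partial>\<mu>)" for s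
    by (cases "0 < s") (simp_all add: excess_def phi_p_integral(2))
  ultimately show "u x = (\<integral>y. \<phi> y * green_kernel m \<iota> p x y \<partial>\<mu>)"
    by (simp add: heat_representation(2)[of x] set_lebesgue_integral_def)
qed

section \<open>The Revuz identity localised at a vertex\<close>

lemma measure_vertex: "measure (vertex_measure m) {x} = m x"
  using m_pos[of x]
  by (simp add: vertex_measure_def measure_def emeasure_point_measure_finite2)

lemma trans_op_indicator: "trans_op m \<iota> p s (indicator {\<iota> x}) y = m x * p s y (\<iota> x)"
proof -
  have "\<iota> \<in> vertex_measure m \<rightarrow>\<^sub>M borel" by (simp add: vertex_measure_def)
  then have "measure (royden_measure m \<iota>) {\<iota> x} = measure (vertex_measure m) (\<iota> -` {\<iota> x} \<inter> space (vertex_measure m))"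
    unfolding royden_measure_def by (intro measure_distr) auto
  also have "\<iota> -` {\<iota> x} \<inter> space (vertex_measure m) = {x}"
    using inj_iota by (auto simp: vertex_measure_def space_point_measure inj_def)
  finally have *: "measure (royden_measure m \<iota>) {\<iota> x} = m x" by (simp add: measure_vertex)
  have "trans_op m \<iota> p s (indicator {\<iota> x}) y = (\<integral>z. indicator {\<iota> x} z * p s y (\<iota> x) \<partial>royden_measure m \<iota>)"
    unfolding trans_op_def by (rule Bochner_Integration.integral_cong) (auto simp: indicator_def)
  then show ?thesis using * by (simp add: royden_measure_def)
qed

lemma local_time_representation:
  assumes L: "local_time b m \<iota> \<mu> p \<Omega> Y \<theta> P L"
  defines "f \<equiv> \<lambda>y. if y \<in> bd then \<phi> y else 0"
  shows "\<forall>t>0. integrable (completion (P (\<iota> x))) (af_integral Y L f t)"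
    and "((\<lambda>t. \<integral>\<omega>. af_integral Y L f t \<omega> \<partial>completion (P (\<iota> x))) \<longlongrightarrow> u x) at_top"
proof -
  define h where "h = (indicator {\<iota> x} :: 'r \<Rightarrow> real)"
  define E where "E t z = (\<integral>\<omega>. af_integral Y L f t \<omega> \<partial>completion (P (\<iota> z)))" for t z
  define F where "F s = (\<integral>y. \<phi> y * p s (\<iota> x) y \<partial>\<mu>)" for s
  have f: "f \<in> borel_measurable borel"
  proof -
    have "f = (\<lambda>y. indicator bd y *\<^sub>R \<phi> y)" by (auto simp: f_def)
    then show ?thesis
      using phi_borel closed_boundary borel_measurable_restrict_space_iff[of bd borel \<phi>] by simp
  qed
  have h: "h \<in> borel_measurable borel" unfolding h_def by measurable
  have bf: "bounded (range f)" using phi_le phi_sup_nonneg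
    by (auto simp: bounded_iff f_def intro!: exI[of _ phi_sup])
  have bh: "bounded (range h)" by (auto simp: bounded_iff h_def indicator_def intro!: exI[of _ 1])
  have rev: "(\<forall>x. integrable (completion (P (\<iota> x))) (af_integral Y L f t)) \<and>
      (\<integral>z. h (\<iota> z) * E t z \<partial>vertex_measure m) =
      (LBINT s:{0..t}. \<integral>y. f y * trans_op m \<iota> p s h y \<partial>distr \<mu> borel (\<lambda>y. y))" if "0 < t" for t
    using L that f h bf bh unfolding local_time_def E_def by blast
  then show "\<forall>t>0. integrable (completion (P (\<iota> x))) (af_integral Y L f t)" by blast
  have id: "(\<lambda>y. y) \<in> \<mu> \<rightarrow>\<^sub>M borel"
    using measurable_restrict_space1[OF measurable_ident, of borel bd] measurable_cong_sets[OF sets_mu refl]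
    by (auto simp: id_def)
  have rhs: "(\<integral>y. f y * trans_op m \<iota> p s h y \<partial>distr \<mu> borel (\<lambda>y. y)) = m x * F s" if "0 < s" for s
  proof -
    have "(\<integral>y. f y * trans_op m \<iota> p s h y \<partial>distr \<mu> borel (\<lambda>y. y)) =
        (\<integral>y. f y * (m x * p s (\<iota> x) y) \<partial>distr \<mu> borel (\<lambda>y. y))"
      by (simp add: h_def trans_op_indicator p_sym[OF that])
    also have "\<dots> = (\<integral>y. f y * (m x * p s (\<iota> x) y) \<partial>\<mu>)"
      by (intro integral_distr id borel_measurable_times f borel_measurable_const
          borel_measurable_continuous_onI p_cont that)
    also have "\<dots> = (\<integral>y. m x * (\<phi> y * p s (\<iota> x) y) \<partial>\<mu>)"
      by (rule Bochner_Integration.integral_cong) (auto simp: f_def space_mu)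
    finally show ?thesis by (simp add: F_def)
  qed
  \<comment> \<open>The indicator \<open>h\<close> selects the vertex \<open>x\<close>; the weight
    \<open>m x\<close> reappears on the other side and cancels.\<close>
  have lhs: "(\<integral>z. h (\<iota> z) * E t z \<partial>vertex_measure m) = m x * E t x" for t
  proof -
    have "(\<integral>z. h (\<iota> z) * E t z \<partial>vertex_measure m) = (\<integral>z. indicator {x} z * E t x \<partial>vertex_measure m)"
      using inj_iota by (intro Bochner_Integration.integral_cong) (auto simp: h_def indicator_def inj_def)
    moreover have "space (vertex_measure m) = UNIV"
      by (simp add: vertex_measure_def space_point_measure)
    ultimately show ?thesis by (simp add: measure_vertex)
  qed
  \<comment> \<open>\<open>p\<close> is specified at positive times only, so the integrand is set to
    0 at \<open>s = 0\<close>, a change on a null set.\<close>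
  let ?G = "\<lambda>s. indicator {0<..} s * F s"
  have E: "E t x = (LBINT s:{0..t}. ?G s)" if "0 < t" for t
  proof -
    have "m x * E t x = (LBINT s:{0..t}. \<integral>y. f y * trans_op m \<iota> p s h y \<partial>distr \<mu> borel (\<lambda>y. y))"
      using rev[OF that] lhs by simp
    also have "\<dots> = (LBINT s:{0..t}. m x * ?G s)"
      unfolding set_lebesgue_integral_def
      by (rule integral_discrete_difference[where X = "{0}"]) (auto simp: rhs indicator_def)
    finally show ?thesis using m_pos[of x] by simp
  qed
  have G: "(\<lambda>s. indicator {0..} s *\<^sub>R ?G s) = (\<lambda>s. indicator {0<..} s *\<^sub>R F s)"
    by (auto simp: indicator_def)
  have "set_integrable lborel {0..} ?G"
    using heat_representation(1)[of x] unfolding set_integrable_def G by (simp add: F_def)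
  then have "((\<lambda>t. LBINT s:{0..t}. ?G s) \<longlongrightarrow> (LBINT s:{0..}. ?G s)) at_top"
    by (intro tendsto_set_lebesgue_integral_at_top) auto
  also have "(LBINT s:{0..}. ?G s) = u x"
    using heat_representation(2)[of x] unfolding set_lebesgue_integral_def G by (simp add: F_def)
  finally have "((\<lambda>t. LBINT s:{0..t}. ?G s) \<longlongrightarrow> u x) at_top" .
  then have "((\<lambda>t. E t x) \<longlongrightarrow> u x) at_top"
    by (rule tendsto_cong[THEN iffD1, rotated])
      (use eventually_gt_at_top[of 0] in \<open>eventually_elim, simp add: E\<close>)
  then show "((\<lambda>t. \<integral>\<omega>. af_integral Y L f t \<omega> \<partial>completion (P (\<iota> x))) \<longlongrightarrow> u x) at_top"
    by (simp add: E_def)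
qed

end

theorem theorem4p13:
  fixes b :: "'x::countable \<Rightarrow> 'x \<Rightarrow> real"
    and m :: "'x \<Rightarrow> real"
    and \<iota> :: "'x \<Rightarrow> 'r::t2_space"
    and \<mu> :: "'r measure"
    and \<phi> :: "'r \<Rightarrow> real"
  assumes "canonically_compactifiable b"
    and "finite_discrete_measure m"
    and "royden_compactification b \<iota>"
    and "radon_measure_on (royden_boundary \<iota>) \<mu>"
    and "\<phi> \<in> borel_measurable (restrict_space borel (royden_boundary \<iota>))"
    and "bounded (\<phi> ` royden_boundary \<iota>)"
    and "(\<integral>y. \<phi> y \<partial>\<mu>) = 0"
  shows "(\<exists>!u. neumann_solution b m \<iota> \<mu> \<phi> u \<and> ((\<lambda>x. u x * m x) has_sum 0) UNIV) \<and>
    (\<forall>u. neumann_solution b m \<iota> \<mu> \<phi> u \<and> ((\<lambda>x. u x * m x) has_sum 0) UNIV \<longrightarrow>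
      (\<forall>T p. heat_semigroup b m T \<and> heat_kernel_ext m \<iota> T p \<longrightarrow>
        (\<forall>(\<Omega> :: 'w set) Y \<theta> P L x.
           hunt_process \<Omega> Y \<theta> P \<and> has_transition_densities m \<iota> p \<Omega> Y P \<and>
           local_time b m \<iota> \<mu> p \<Omega> Y \<theta> P L \<longrightarrow>
             (\<forall>t > 0. integrable (completion (P (\<iota> x)))
                (af_integral Y L (\<lambda>y. if y \<in> royden_boundary \<iota> then \<phi> y else 0) t)) \<and>
             ((\<lambda>t. \<integral>\<omega>. af_integral Y L (\<lambda>y. if y \<in> royden_boundary \<iota> then \<phi> y else 0) t \<omega>
                    \<partial>completion (P (\<iota> x))) \<longlongrightarrow> u x) at_top) \<and>
        (\<forall>x. set_integrable lborel {0<..} (\<lambda>s. \<integral>y. \<phi> y * p s (\<iota> x) y \<partial>\<mu>) \<and>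
             u x = (LBINT s:{0<..}. \<integral>y. \<phi> y * p s (\<iota> x) y \<partial>\<mu>)) \<and>
        (\<forall>x. integrable \<mu> (\<lambda>y. \<phi> y * green_kernel m \<iota> p x y) \<and>
             u x = (\<integral>y. \<phi> y * green_kernel m \<iota> p x y \<partial>\<mu>))))"
proof -
  interpret neumann_problem b m \<iota> \<mu> \<phi>
    using assms by unfold_locales
  show ?thesis
  proof (rule conjI[OF solution_exists_unique], intro allI impI, elim conjE, goal_cases)
    case (1 u T p)
    interpret neumann_heat b m \<iota> \<mu> \<phi> T p u
      using 1 by unfold_locales
    show ?case
      using local_time_representation heat_representation green_representation by blast
  qed
qed

end
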